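(* Consider the FSIPL algorithm described in the context, run with the parameter regime (R) of the context, and let $\{(x^k,y^k)\}_{k\in\mathbb N}$ be the generated sequence ($y^k$ being the intermediate point associated with the accepted trial point at iteration $k$). Define $P:\mathbb R^n\times\mathbb R^p\times\mathbb R^m\times\mathbb R^p\times\mathbb R\to(-\infty,+\infty]$ by $$P(x,z,\upsilon,s,\omega):=f(x)+g(z)+\delta_{\mathcal C}(x,\upsilon)+\delta_{\mathcal D}(x,z,s)+\omega^2,$$ where $\delta$ denotes the indicator function ($0$ on the set, $+\infty$ off it), $$\mathcal C:=\{(x,\upsilon)\in\mathbb R^n\times\mathbb R^m: h_i(x)=\upsilon_i^3,\ i=1,\dots,m\},$$ $$\mathcal D:=\{(x,z,s)\in\mathbb R^n\times\mathbb R^p\times\mathbb R^p: \mathcal A_j(x)-z_j=s_j^3,\ j=1,\dots,p\}.$$ If $P$ satisfies the Kurdyka--Łojasiewicz (KL) property, then both sequences $\{x^k\}_{k\in\mathbb N}$ and $\{y^k\}_{k\in\mathbb N}$ converge to a (common) stationary point of the problem $\min_{x\in\mathcal M}F(x)$.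
   Context: Notation. $\|\cdot\|$ is the Euclidean norm (spectral norm for matrices). For a smooth map $\psi:\mathbb R^n\to\mathbb R^m$ with $m$ components, $\nabla\psi(x)\in\mathbb R^{m\times n}$ is its Jacobian; for real-valued $f$, $\nabla f(x)\in\mathbb R^n$ is the gradient. For closed convex $g$ and $t>0$: $M_g^t(x):=\min_y\{g(y)+\frac1{2t}\|y-x\|^2\}$ and $\mathrm{prox}_{tg}(x)$ is the unique minimizer. $\mathcal S$ is the set of nonnegative summable real sequences. $\partial$ is the limiting subdifferential: for proper lsc $\psi$ and $z\in\mathrm{dom}\,\psi$, $v\in\hat\partial\psi(z)$ iff $\psi(x)\ge\psi(z)+\langle v,x-z\rangle+o(\|x-z\|)$; $v\in\partial\psi(z)$ iff there are $z^k\to z$, $\psi(z^k)\to\psi(z)$, $v^k\in\hat\partial\psi(z^k)$, $v^k\to v$; both are empty off $\mathrm{dom}\,\psi$. KL property. A proper $\psi:\mathbb R^q\to(-\infty,+\infty]$ satisfies the KL property at $x\in\mathrm{dom}(\partial\psi)$ if there exist $\epsilon\in(0,+\infty]$, $\delta>0$ and a continuous concave $\phi:[0,\epsilon)\to[0,+\infty)$ with $\phi(0)=0$, $\phi$ continuously differentiable on $(0,\epsilon)$ with $\phi'>0$, such that $\phi'(\psi(z)-\psi(x))\,\mathrm{dist}(0,\partial\psi(z))>1$ for all $z$ with $\|z-x\|\le\delta$ and $\psi(x)<\psi(z)<\psi(x)+\epsilon$. "$P$ satisfies the KL property" means it does so at every point of $\mathrm{dom}(\partial P)$. Problem. $\mathcal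 M\subseteq\mathbb R^n$ is a compact embedded submanifold, $\mathcal M_a:=\{x:\mathrm{dist}(x,\mathcal M)\le a\}$, and the problem is $\min_{x\in\mathcal M}F(x):=f(x)+g(\mathcal A(x))$, where $f:\mathbb R^n\to\mathbb R$ and $\mathcal A=(\mathcal A_1,\dots,\mathcal A_p):\mathbb R^n\to\mathbb R^p$ are continuously differentiable and $g:\mathbb R^p\to\mathbb R$ is closed and convex. Standing assumptions: (i) $\mathcal M=\{x:h(x)=0\}$ for some $h:\mathbb R^n\to\mathbb R^m$, and there is $\kappa>0$ with $\mathrm{dist}(x,\mathcal M)\le\kappa\|h(x)\|$ for all $x\in\mathbb R^n$; (ii) $\nabla h$ is $L_h$-Lipschitz on $\mathbb R^n$, and there are $\theta>0$, $0<C_1\le C_2$ such that for all $x\in\mathcal M_{2\theta}$ the eigenvalues of $\nabla h(x)\nabla h(x)^\top$ lie in $[C_1,C_2]$; (iii) $\nabla f$ is $L_f$-Lipschitz on $\mathbb R^n$; (iv) $g$ is $\ell_g$-Lipschitz on $\mathbb R^p$; (v) $\nabla\mathcal A$ is $L_{\mathcal A}$-Lipschitz on $\mathbb R^n$. Constants $\ell_f,\ell_{\mathcal A}>0$ are fixed with $\|\nabla f(x)\|\le\ell_f$ and $\|\nabla\mathcal A(x)\|\le\ell_{\mathcal A}$ for all $x\in\mathcal M_{2\theta}$. $L_h>0$. Stationarity. $x^*$ is a stationary point of the problem if $h(x^* )=0$ and there exists $\lambda^*\in\mathbb R^m$ with $0\in\nabla f(x^* )+\nabla\mathcal A(x^*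 )^\top\partial g(\mathcal A(x^* ))+\nabla h(x^* )^\top\lambda^*$. FSIPL algorithm. Inputs: $x^0\in\mathcal M$, $\gamma\in(0,1)$, $\alpha>0$, positive numbers $\underline t\le\overline t$, $\overline\Delta,\overline\eta,\overline\tau,\sigma$, the constants $\theta,\kappa$ above, and $\{\rho_k\}\in\mathcal S$. Put $N(x):=\frac12\|h(x)\|^2$ (so $\nabla N(x)=\nabla h(x)^\top h(x)$) and $\Phi_\alpha(x):=F(x)+\alpha\|h(x)\|$. For $k=0,1,2,\dots$: 1. Choose $t_k\in[\underline t,\overline t]$, $\Delta_k\in[0,\overline\Delta]$. 2. Find $(\lambda^k,\mu^k)\in\mathbb R^m\times\mathbb R^p$ with $\|\nabla G_k(\lambda^k,\mu^k)\|\le\Delta_k$, where $G_k(\lambda,\mu):=\frac{t_k}2\|\nabla f(x^k)+\nabla h(x^k)^\top\lambda+\nabla\mathcal A(x^k)^\top\mu\|^2+\frac{t_k}2\|\mu\|^2-M_g^{t_k}(\mathcal A(x^k)+t_k\mu)$ (a convex $C^1$ function). 3. Set $d^k:=-t_k(\nabla f(x^k)+\nabla h(x^k)^\top\lambda^k+\nabla\mathcal A(x^k)^\top\mu^k)$ and $v^k:=\mathrm{prox}_{t_kg}(\mathcal A(x^k)+t_k\mu^k)-\mathcal A(x^k)$. 4. Set $\eta_k\leftarrow\overline\eta$, $\tau_k\leftarrow\overline\tau$. 5. (Inner loop) Set $y^k:=x^k+\eta_kd^k$, and $\hat x^{k+1}:=y^k-\tau_k\nabla N(y^k)$ if $\|h(y^k)\|\le\theta/\kappa$,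 otherwise $\hat x^{k+1}:=$ a nearest point of $\mathcal M$ to $y^k$. If $\|h(\hat x^{k+1})\|\le\theta/\kappa$ and $\Phi_\alpha(\hat x^{k+1})\le\Phi_\alpha(x^k)-\frac\sigma2(\eta_k^2\|d^k\|^2+\tau_k^2\|h(y^k)\|)-\frac{\eta_k}{2t_k}\|v^k\|^2+\eta_k(\alpha+\ell_g+\|\lambda^k\|+\|\mu^k\|)\Delta_k+\rho_k$, accept: $x^{k+1}\leftarrow\hat x^{k+1}$ and go to the next $k$. Otherwise reject: $\eta_k\leftarrow\gamma\eta_k$, $\tau_k\leftarrow\frac\gamma2\tau_k$, and repeat step 5. Parameter regime (R). Let $M_1:=\sqrt{C_2}(\ell_f+\ell_g\ell_{\mathcal A})$, $M_2:=\kappa(\ell_f+\ell_g\ell_{\mathcal A})$, $\hat\tau:=\min\{\frac{2\kappa C_1}{\theta L_hC_2},\frac1{C_2}\}$, $\hat\tau_2:=\min\{\hat\tau,\frac{2(\alpha C_1-M_1)}{\alpha L_hC_2\theta/\kappa+\sigma}\}$, and $\hat\eta_2(t,\Delta):=\min\big\{\frac{\theta}{t(2\ell_f+\ell_g)+(\frac{\ell_{\mathcal A}+1}{\sqrt{C_1}}+1)\Delta},\,1,\ \frac1{t(L_f+\ell_gL_{\mathcal A}+\alpha L_h+\sigma)}\big\}$. The requirements are: $\alpha>\max\{M_1/C_1,\,M_2+\sigma\hat\tau^2/2\}$; $\overline\eta=1$; $\overline\tau\le\hat\tau_2$; $\hat\eta_2(t_k,\Delta_k)\ge1$ for all $k$;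 $\overline\Delta=\frac{\theta\sqrt{C_1}}{2(\ell_{\mathcal A}+1+\sqrt{C_1})}$; for all $k$, $t_k\le\min\{\frac{\theta}{4\ell_f+2\ell_g},\frac1{L_f+\ell_gL_{\mathcal A}+\alpha L_h+\sigma}\}$; $\Delta_0\le\overline\Delta$ and, for all $k\ge1$, $\Delta_k\le\min\{\Delta_{k-1},\ \frac{\sigma}{8(\alpha+\ell_g+\lambda_{\max}+\mu_{\max})}S_{k-1},\ \overline\Delta\}$, where $S_k:=\max\{\overline\tau^2\|h(y^k)\|,\|v^k\|^2,\|d^k\|^2\}$, $\lambda_{\max}:=\frac1{\sqrt{C_1}}\big((3+\ell_{\mathcal A})\ell_f+(3\ell_{\mathcal A}+1)\ell_g+(\frac{\ell_{\mathcal A}+1}{\sqrt{C_1}}+1)\frac{(\ell_{\mathcal A}+1)\overline\Delta}{\underline t}\big)$ and $\mu_{\max}:=\ell_f+3\ell_g+(\frac{\ell_{\mathcal A}+1}{\sqrt{C_1}}+1)\frac{\overline\Delta}{\underline t}$. *)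

theory Defs
  imports "HOL-Analysis.Analysis" "HOL-Library.Landau_Symbols"
begin

section \<open>Calculus\<close>

definition grad :: "('a::real_inner \<Rightarrow> real) \<Rightarrow> 'a \<Rightarrow> 'a" where
  "grad f x = (THE D. GDERIV f x :> D)"

text \<open>The library norm on matrices is the Frobenius norm, hence a separate constant.\<close>

definition spectral_norm :: "real^'n^'m \<Rightarrow> real" where
  "spectral_norm B = onorm (\<lambda>x. B *v x)"

definition jacobian_lipschitz :: "real \<Rightarrow> (real^'n \<Rightarrow> real^'m) \<Rightarrow> bool" where
  "jacobian_lipschitz L F \<longleftrightarrow>
     (\<forall>x y. spectral_norm (jacobian F (at x) - jacobian F (at y)) \<le> L * norm (x - y))"

definition C1_on :: "'a set \<Rightarrow> ('a::real_normed_vector \<Rightarrow> 'b::real_normed_vector) \<Rightarrow> bool" where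
  "C1_on U F \<longleftrightarrow>
     (\<exists>D. (\<forall>x\<in>U. (F has_derivative blinfun_apply (D x)) (at x)) \<and> continuous_on U D)"

definition eigenvalue :: "real^'n^'n \<Rightarrow> real \<Rightarrow> bool" where
  "eigenvalue B l \<longleftrightarrow> (\<exists>v. v \<noteq> 0 \<and> B *v v = l *\<^sub>R v)"

text \<open>Local slice definition. Only $C^1$ charts are required, so every notion of embedded
  submanifold of class $C^k$, $1 \le k \le \infty$, is covered.\<close>

definition embedded_submanifold :: "'a::euclidean_space set \<Rightarrow> bool" where
  "embedded_submanifold M \<longleftrightarrow>
     (\<exists>d. \<forall>x\<in>M. \<exists>U V \<phi> \<psi> T. open U \<and> x \<in> U \<and> open (V :: 'a set) \<and>
        homeomorphism U V \<phi> \<psi> \<and> C1_on U \<phi> \<and> C1_on V \<psi> \<and>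
        subspace T \<and> dim T = d \<and> \<phi> ` (U \<inter> M) = V \<inter> T)"

definition tube :: "'a::metric_space set \<Rightarrow> real \<Rightarrow> 'a set" where
  "tube M a = {x. infdist x M \<le> a}"


section \<open>Variational analysis\<close>

text \<open>For closed convex \<open>g\<close> and \<open>t > 0\<close> the infimum is attained, at exactly one point.\<close>

definition moreau :: "real \<Rightarrow> ('a::real_normed_vector \<Rightarrow> real) \<Rightarrow> 'a \<Rightarrow> real" where
  "moreau t g x = (INF y. g y + 1 / (2 * t) * (norm (y - x))\<^sup>2)"

definition prox :: "real \<Rightarrow> ('a::real_normed_vector \<Rightarrow> real) \<Rightarrow> 'a \<Rightarrow> 'a" where
  "prox t g x = (THE y. is_arg_min (\<lambda>y. g y + 1 / (2 * t) * (norm (y - x))\<^sup>2) (\<lambda>_. True) y)"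

definition delta :: "'a set \<Rightarrow> 'a \<Rightarrow> ereal" where
  "delta S x = (if x \<in> S then 0 else \<infinity>)"

definition regular_subdiff :: "('a::real_inner \<Rightarrow> ereal) \<Rightarrow> 'a \<Rightarrow> 'a set" where
  "regular_subdiff \<psi> z = {v. \<bar>\<psi> z\<bar> \<noteq> \<infinity> \<and>
     (\<exists>r. r \<in> o[at z](\<lambda>x. norm (x - z)) \<and>
          (\<forall>x. \<psi> z + ereal (v \<bullet> (x - z) + r x) \<le> \<psi> x))}"

definition limiting_subdiff :: "('a::real_inner \<Rightarrow> ereal) \<Rightarrow> 'a \<Rightarrow> 'a set" where
  "limiting_subdiff \<psi> z = {v. \<bar>\<psi> z\<bar> \<noteq> \<infinity> \<and>
     (\<exists>zs vs. zs \<longlonglongrightarrow> z \<and> (\<lambda>k. \<psi> (zs k)) \<longlonglongrightarrow> \<psi> z \<and>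
              (\<forall>k. vs k \<in> regular_subdiff \<psi> (zs k)) \<and> vs \<longlonglongrightarrow> v)}"

text \<open>The distance from the origin to a set is taken in the extended reals, so that it is
  \<open>\<infinity>\<close> for the empty set (\<open>infdist\<close> would give \<open>0\<close>).\<close>

definition KL_at :: "('a::real_inner \<Rightarrow> ereal) \<Rightarrow> 'a \<Rightarrow> bool" where
  "KL_at \<psi> x \<longleftrightarrow>
     (\<exists>(\<epsilon>::ereal) (\<delta>::real) (\<phi>::real \<Rightarrow> real) \<phi>'.
        0 < \<epsilon> \<and> 0 < \<delta> \<and>
        continuous_on {t. 0 \<le> t \<and> ereal t < \<epsilon>} \<phi> \<and>
        concave_on {t. 0 \<le> t \<and> ereal t < \<epsilon>} \<phi> \<and>
        (\<forall>t. 0 \<le> t \<and> ereal t < \<epsilon> \<longrightarrow> 0 \<le> \<phi> t) \<and>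
        \<phi> 0 = 0 \<and>
        (\<forall>t. 0 < t \<and> ereal t < \<epsilon> \<longrightarrow> (\<phi> has_real_derivative \<phi>' t) (at t) \<and> 0 < \<phi>' t) \<and>
        continuous_on {t. 0 < t \<and> ereal t < \<epsilon>} \<phi>' \<and>
        (\<forall>z. norm (z - x) \<le> \<delta> \<and> \<psi> x < \<psi> z \<and> \<psi> z < \<psi> x + \<epsilon> \<longrightarrow>
           ereal (\<phi>' (real_of_ereal (\<psi> z - \<psi> x))) * (INF v\<in>limiting_subdiff \<psi> z. ereal (norm v)) > 1))"

definition KL_property :: "('a::real_inner \<Rightarrow> ereal) \<Rightarrow> bool" where
  "KL_property \<psi> \<longleftrightarrow> (\<forall>x. limiting_subdiff \<psi> x \<noteq> {} \<longrightarrow> KL_at \<psi> x)"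


section \<open>The problem\<close>

locale composite_problem =
  fixes f :: "real^'n \<Rightarrow> real" and g :: "real^'p \<Rightarrow> real"
    and A :: "real^'n \<Rightarrow> real^'p" and h :: "real^'n \<Rightarrow> real^'m"
    and M :: "(real^'n) set"
    and \<kappa> \<theta> C1 C2 Lh Lf lg LA lf lA :: real
  assumes M_compact: "compact M"
    and M_submanifold: "embedded_submanifold M"
    and f_C1: "C1_on UNIV f"
    and A_C1: "C1_on UNIV A"
    and g_closed: "closed (epigraph UNIV g)"
    and g_convex: "convex_on UNIV g"
    and M_eq: "M = {x. h x = 0}"
    and \<kappa>_pos: "0 < \<kappa>"
    and error_bound: "\<And>x. infdist x M \<le> \<kappa> * norm (h x)"
    and h_differentiable: "\<And>x. h differentiable (at x)"
    and Lh_pos: "0 < Lh"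
    and h_lipschitz: "jacobian_lipschitz Lh h"
    and \<theta>_pos: "0 < \<theta>"
    and C1_pos: "0 < C1" and C1_le_C2: "C1 \<le> C2"
    and h_eigenvalues: "\<And>x l. x \<in> tube M (2 * \<theta>) \<Longrightarrow>
          eigenvalue (jacobian h (at x) ** transpose (jacobian h (at x))) l \<Longrightarrow> l \<in> {C1..C2}"
    and f_lipschitz: "Lf-lipschitz_on UNIV (grad f)"
    and g_lipschitz: "lg-lipschitz_on UNIV g"
    and A_lipschitz: "jacobian_lipschitz LA A"
    and lf_pos: "0 < lf" and lA_pos: "0 < lA"
    and f_bound: "\<And>x. x \<in> tube M (2 * \<theta>) \<Longrightarrow> norm (grad f x) \<le> lf"
    and A_bound: "\<And>x. x \<in> tube M (2 * \<theta>) \<Longrightarrow> spectral_norm (jacobian A (at x)) \<le> lA"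

definition stationary_point ::
  "(real^'n \<Rightarrow> real) \<Rightarrow> (real^'p \<Rightarrow> real) \<Rightarrow> (real^'n \<Rightarrow> real^'p) \<Rightarrow> (real^'n \<Rightarrow> real^'m)
    \<Rightarrow> real^'n \<Rightarrow> bool" where
  "stationary_point f g A h x \<longleftrightarrow>
     h x = 0 \<and>
     (\<exists>lam. 0 \<in> {grad f x + transpose (jacobian A (at x)) *v s + transpose (jacobian h (at x)) *v lam
                  | s. s \<in> limiting_subdiff (\<lambda>z. ereal (g z)) (A x)})"

definition KL_potential ::
  "(real^'n \<Rightarrow> real) \<Rightarrow> (real^'p \<Rightarrow> real) \<Rightarrow> (real^'n \<Rightarrow> real^'p) \<Rightarrow> (real^'n \<Rightarrow> real^'m)
    \<Rightarrow> (real^'n) \<times> (real^'p) \<times> (real^'m) \<times> (real^'p) \<times> real \<Rightarrow> ereal" where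
  "KL_potential f g A h = (\<lambda>(x, z, \<upsilon>, s, \<omega>).
     ereal (f x) + ereal (g z)
     + delta {(x, \<upsilon>). \<forall>i. h x $ i = (\<upsilon> $ i) ^ 3} (x, \<upsilon>)
     + delta {(x, z, s). \<forall>j. A x $ j - z $ j = (s $ j) ^ 3} (x, z, s)
     + ereal (\<omega>\<^sup>2))"


section \<open>The FSIPL algorithm\<close>

locale fsipl_input = composite_problem f g A h M \<kappa> \<theta> C1 C2 Lh Lf lg LA lf lA
  for f :: "real^'n \<Rightarrow> real" and g :: "real^'p \<Rightarrow> real"
    and A :: "real^'n \<Rightarrow> real^'p" and h :: "real^'n \<Rightarrow> real^'m"
    and M :: "(real^'n) set"
    and \<kappa> \<theta> C1 C2 Lh Lf lg LA lf lA :: real +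
  fixes \<gamma> \<alpha> tmin tmax \<Delta>bar \<eta>bar \<tau>bar \<sigma> :: real and \<rho> :: "nat \<Rightarrow> real"
  assumes \<gamma>_range: "0 < \<gamma>" "\<gamma> < 1"
    and \<alpha>_pos: "0 < \<alpha>"
    and t_range: "0 < tmin" "tmin \<le> tmax"
    and bar_pos: "0 < \<Delta>bar" "0 < \<eta>bar" "0 < \<tau>bar"
    and \<sigma>_pos: "0 < \<sigma>"
    and \<rho>_nonneg: "\<And>k. 0 \<le> \<rho> k"
    and \<rho>_summable: "summable \<rho>"
begin

definition N :: "real^'n \<Rightarrow> real" where
  "N x = 1 / 2 * (norm (h x))\<^sup>2"

definition F :: "real^'n \<Rightarrow> real" where
  "F x = f x + g (A x)"

definition \<Phi> :: "real^'n \<Rightarrow> real" where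
  "\<Phi> x = F x + \<alpha> * norm (h x)"

definition M1 :: real where
  "M1 = sqrt C2 * (lf + lg * lA)"

definition M2 :: real where
  "M2 = \<kappa> * (lf + lg * lA)"

definition \<tau>hat :: real where
  "\<tau>hat = min (2 * \<kappa> * C1 / (\<theta> * Lh * C2)) (1 / C2)"

definition \<tau>hat2 :: real where
  "\<tau>hat2 = min \<tau>hat (2 * (\<alpha> * C1 - M1) / (\<alpha> * Lh * C2 * \<theta> / \<kappa> + \<sigma>))"

definition \<eta>hat2 :: "real \<Rightarrow> real \<Rightarrow> real" where
  "\<eta>hat2 t \<Delta> =
     Min {\<theta> / (t * (2 * lf + lg) + ((lA + 1) / sqrt C1 + 1) * \<Delta>),
          1,
          1 / (t * (Lf + lg * LA + \<alpha> * Lh + \<sigma>))}"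

definition lam_max :: real where
  "lam_max = 1 / sqrt C1 *
     ((3 + lA) * lf + (3 * lA + 1) * lg
      + ((lA + 1) / sqrt C1 + 1) * ((lA + 1) * \<Delta>bar / tmin))"

definition mu_max :: real where
  "mu_max = lf + 3 * lg + ((lA + 1) / sqrt C1 + 1) * (\<Delta>bar / tmin)"

end

locale fsipl_iterates = fsipl_input f g A h M \<kappa> \<theta> C1 C2 Lh Lf lg LA lf lA
    \<gamma> \<alpha> tmin tmax \<Delta>bar \<eta>bar \<tau>bar \<sigma> \<rho>
  for f :: "real^'n \<Rightarrow> real" and g :: "real^'p \<Rightarrow> real"
    and A :: "real^'n \<Rightarrow> real^'p" and h :: "real^'n \<Rightarrow> real^'m"
    and M :: "(real^'n) set"
    and \<kappa> \<theta> C1 C2 Lh Lf lg LA lf lA :: real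
    and \<gamma> \<alpha> tmin tmax \<Delta>bar \<eta>bar \<tau>bar \<sigma> :: real and \<rho> :: "nat \<Rightarrow> real" +
  fixes t \<Delta> :: "nat \<Rightarrow> real"
    and lam :: "nat \<Rightarrow> real^'m" and mu :: "nat \<Rightarrow> real^'p"
    and x y :: "nat \<Rightarrow> real^'n"
begin

definition G :: "nat \<Rightarrow> (real^'m) \<times> (real^'p) \<Rightarrow> real" where
  "G k = (\<lambda>(l, m).
     t k / 2 * (norm (grad f (x k) + transpose (jacobian h (at (x k))) *v l
                      + transpose (jacobian A (at (x k))) *v m))\<^sup>2
     + t k / 2 * (norm m)\<^sup>2
     - moreau (t k) g (A (x k) + t k *\<^sub>R m))"

definition d :: "nat \<Rightarrow> real^'n" where
  "d k = - (t k *\<^sub>R (grad f (x k) + transpose (jacobian h (at (x k))) *v lam k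
                     + transpose (jacobian A (at (x k))) *v mu k))"

definition v :: "nat \<Rightarrow> real^'p" where
  "v k = prox (t k) g (A (x k) + t k *\<^sub>R mu k) - A (x k)"

text \<open>The step sizes used in the trial of the inner loop that follows \<open>j\<close> rejections.\<close>

definition \<eta> :: "nat \<Rightarrow> real" where
  "\<eta> j = \<eta>bar * \<gamma> ^ j"

definition \<tau> :: "nat \<Rightarrow> real" where
  "\<tau> j = \<tau>bar * (\<gamma> / 2) ^ j"

text \<open>A relation, because the nearest point of \<open>M\<close> need not be unique.\<close>

definition trial :: "nat \<Rightarrow> nat \<Rightarrow> real^'n \<Rightarrow> real^'n \<Rightarrow> bool" where
  "trial k j yk xhat \<longleftrightarrow>
     yk = x k + \<eta> j *\<^sub>R d k \<and>
     (if norm (h yk) \<le> \<theta> / \<kappa> then xhat = yk - \<tau> j *\<^sub>R grad N yk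
      else xhat \<in> M \<and> dist yk xhat = infdist yk M)"

definition acceptable :: "nat \<Rightarrow> nat \<Rightarrow> real^'n \<Rightarrow> real^'n \<Rightarrow> bool" where
  "acceptable k j yk xhat \<longleftrightarrow>
     norm (h xhat) \<le> \<theta> / \<kappa> \<and>
     \<Phi> xhat \<le> \<Phi> (x k)
       - \<sigma> / 2 * ((\<eta> j)\<^sup>2 * (norm (d k))\<^sup>2 + (\<tau> j)\<^sup>2 * norm (h yk))
       - \<eta> j / (2 * t k) * (norm (v k))\<^sup>2
       + \<eta> j * (\<alpha> + lg + norm (lam k) + norm (mu k)) * \<Delta> k
       + \<rho> k"

definition inner_loop :: "nat \<Rightarrow> bool" where
  "inner_loop k \<longleftrightarrow>
     (\<exists>j. (\<forall>i<j. \<exists>y' x'. trial k i y' x' \<and> \<not> acceptable k i y' x') \<and>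
          trial k j (y k) (x (Suc k)) \<and> acceptable k j (y k) (x (Suc k)))"

definition S :: "nat \<Rightarrow> real" where
  "S k = Max {\<tau>bar\<^sup>2 * norm (h (y k)), (norm (v k))\<^sup>2, (norm (d k))\<^sup>2}"

end

locale fsipl_run = fsipl_iterates +
  assumes x_init: "x 0 \<in> M"
    and t_choice: "\<And>k. t k \<in> {tmin..tmax}"
    and \<Delta>_choice: "\<And>k. \<Delta> k \<in> {0..\<Delta>bar}"
    and dual_inexact: "\<And>k. norm (grad (G k) (lam k, mu k)) \<le> \<Delta> k"
    and inner_loop: "\<And>k. inner_loop k"

locale fsipl_run_regime = fsipl_run +
  assumes \<alpha>_regime: "\<alpha> > max (M1 / C1) (M2 + \<sigma> * \<tau>hat\<^sup>2 / 2)"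
    and \<eta>bar_regime: "\<eta>bar = 1"
    and \<tau>bar_regime: "\<tau>bar \<le> \<tau>hat2"
    and \<eta>hat2_regime: "\<And>k. \<eta>hat2 (t k) (\<Delta> k) \<ge> 1"
    and \<Delta>bar_regime: "\<Delta>bar = \<theta> * sqrt C1 / (2 * (lA + 1 + sqrt C1))"
    and t_regime: "\<And>k. t k \<le> min (\<theta> / (4 * lf + 2 * lg)) (1 / (Lf + lg * LA + \<alpha> * Lh + \<sigma>))"
    and \<Delta>_regime_0: "\<Delta> 0 \<le> \<Delta>bar"
    and \<Delta>_regime_Suc: "\<And>k. \<Delta> (Suc k) \<le>
          Min {\<Delta> k, \<sigma> / (8 * (\<alpha> + lg + lam_max + mu_max)) * S k, \<Delta>bar}"

end

theory Submission
  imports Defs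
begin

text \<open>Under the parameter regime the first trial of the inner loop is always accepted, even without
  the slack \<open>\<rho>\<close>: the dual residual controls \<open>\<nabla>h d\<close> and \<open>v - \<nabla>A d\<close>, so that the tangential step
  decreases the merit function \<open>\<Phi>\<close> up to a multiple of \<open>\<Delta>\<close>, and the normal step does not increase it.
  Since \<open>\<Delta>\<close> is bounded by the previous \<open>S\<close>, the values \<open>H k = \<Phi> (x (k+1)) + \<sigma>/4 S k\<close> decrease by at
  least \<open>\<sigma>/8 (S (k+1) + S k)\<close>.

  The KL inequality is applied at points \<open>W k\<close> where the potential is at least \<open>H (k+1)\<close> and has a
  subgradient of norm \<open>O(sqrt (S (k+1) + S k))\<close>. The usual telescoping of the concave
  desingularizing function then makes the step lengths summable, and the limit of the iterates is
  stationary because the multipliers are bounded.\<close>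

section \<open>Gradients, Jacobians and spectral bounds\<close>

text \<open>The merit function \<open>\<Phi>\<close> is a poor carrier for the KL inequality: off
  \<open>M\<close> its penalty ties the multiplier of \<open>h\<close> to
  \<open>\<alpha> h / norm h\<close>, a vector of norm \<open>\<alpha>\<close>, so its subgradients
  need not be small along the iterates. The potential moves the residuals \<open>h x\<close> and
  \<open>A x - z\<close> into cubed slacks instead. Arbitrary multipliers are then admissible, in
  particular those computed by the algorithm, for which the first two components of the subgradient
  are small. A linear slack would leave the multiplier itself as a component; with a cube it is
  multiplied by the squared slack and so tends to zero.

  The unit of length is \<open>sqrt (S k)\<close>: \<open>S\<close> holds the squares of
  \<open>norm d\<close> and \<open>norm v\<close> but the first power of \<open>norm (h y)\<close>,
  so constraint residuals are of second order and can afford the loss in the 2/3 power. The sum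
  \<open>S (k+1) + S k\<close> appears because \<open>\<Delta> (k+1)\<close> is controlled by
  \<open>S k\<close> and not by \<open>S (k+1)\<close>; the summand \<open>\<sigma>/4 S k\<close> of
  \<open>H k\<close> stores the decrease that pays for this error one step later.\<close>

declare transpose_matrix_vector [simp del]

lemma grad_eqI:
  assumes "GDERIV f x :> D"
  shows "grad f x = D"
  unfolding grad_def
proof (rule the_equality)
  fix E assume "GDERIV f x :> E"
  then have "(\<lambda>h. h \<bullet> E) = (\<lambda>h. h \<bullet> D)"
    using assms unfolding gderiv_def by (rule has_derivative_unique)
  then have "(E - D) \<bullet> (E - D) = 0"
    by (metis inner_diff_right right_minus_eq)
  then show "E = D" by simp
qed (fact assms)

lemma GDERIV_grad:
  fixes f :: "'a::euclidean_space \<Rightarrow> real"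
  assumes "f differentiable (at x)"
  shows "GDERIV f x :> grad f x"
proof -
  obtain f' where f': "(f has_derivative f') (at x)"
    using assms by (auto simp: differentiable_def)
  have "f' = (\<lambda>h. h \<bullet> adjoint f' 1)"
    using adjoint_works[of f' _ "1::real"] has_derivative_linear[OF f'] by auto
  then have "GDERIV f x :> adjoint f' 1"
    using f' unfolding gderiv_def by metis
  then show ?thesis
    using grad_eqI by metis
qed

lemma C1_on_imp_differentiable:
  assumes "C1_on UNIV F"
  shows "F differentiable (at x)"
  using assms unfolding C1_on_def differentiable_def by blast

lemma inner_transpose_mult:
  fixes B :: "real^'n^'m"
  shows "(transpose B *v u) \<bullet> w = u \<bullet> (B *v w)"
  by (simp add: transpose_matrix_vector dot_lmul_matrix)

lemma norm_mult_le_spectral_norm: "norm (B *v w) \<le> spectral_norm B * norm w"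
  unfolding spectral_norm_def by (rule onorm) simp

text \<open>The square of the left side is \<open>u \<bullet> (B *v (transpose B *v u))\<close>, so
  the bound for \<open>B\<close> itself applies and one factor cancels.\<close>

lemma norm_transpose_mult_le_spectral_norm:
  "norm (transpose B *v u) \<le> spectral_norm B * norm u"
proof -
  have "norm (transpose B *v u) * norm (transpose B *v u) = u \<bullet> (B *v (transpose B *v u))"
    by (metis inner_transpose_mult norm_eq_sqrt_inner power2_eq_square power2_norm_eq_inner)
  also have "\<dots> \<le> norm u * norm (B *v (transpose B *v u))"
    by (rule norm_cauchy_schwarz)
  also have "\<dots> \<le> norm u * (spectral_norm B * norm (transpose B *v u))"
    by (intro mult_left_mono norm_mult_le_spectral_norm) simp
  finally show ?thesis
    by (cases "norm (transpose B *v u) = 0")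
       (auto simp: mult_ac spectral_norm_def onorm_pos_le)
qed

lemma norm_vector_leI:
  fixes w :: "'a::real_inner"
  assumes "\<And>u. norm u = 1 \<Longrightarrow> u \<bullet> w \<le> c" and "0 \<le> c"
  shows "norm w \<le> c"
proof (cases "w = 0")
  case False
  then have "(w /\<^sub>R norm w) \<bullet> w \<le> c"
    by (intro assms) simp
  then show ?thesis
    using False by (simp add: dot_square_norm power2_eq_square field_simps)
qed (use assms in simp)

lemma norm_add_square:
  fixes a b :: "'a::real_inner"
  shows "(norm (a + b))\<^sup>2 = (norm a)\<^sup>2 + 2 * (a \<bullet> b) + (norm b)\<^sup>2"
  by (simp add: power2_norm_eq_inner inner_add_left inner_add_right inner_commute)

text \<open>The gap between \<open>f\<close> and its quadratic model along the segment has
  nonpositive derivative, so comparing the ends suffices and no integral occurs. The Lipschitz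
  hypothesis is anchored at the base point \<open>x\<close>.\<close>

lemma gradient_descent_inequality:
  fixes f :: "'a::real_inner \<Rightarrow> real"
  assumes D: "\<And>z. GDERIV f z :> D z"
    and L: "\<And>z. norm (D z - D x) \<le> L * norm (z - x)"
  shows "f y \<le> f x + D x \<bullet> (y - x) + L / 2 * (norm (y - x))\<^sup>2"
proof -
  define e where "e = y - x"
  define \<phi> where "\<phi> s = f (x + s *\<^sub>R e) - s * (D x \<bullet> e) - L / 2 * s\<^sup>2 * (norm e)\<^sup>2" for s
  have "\<phi> 1 \<le> \<phi> 0"
  proof (rule DERIV_nonpos_imp_nonincreasing[where f=\<phi>])
    fix s :: real assume s: "0 \<le> s" "s \<le> 1"
    define w where "w = x + s *\<^sub>R e"
    have "((\<lambda>s. f (x + s *\<^sub>R e)) has_derivative (\<lambda>r. (r *\<^sub>R e) \<bullet> D w)) (at s)"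
      using D[of w] unfolding gderiv_def w_def
      by (intro has_derivative_compose[where f="\<lambda>s. x + s *\<^sub>R e" and g=f])
         (auto intro!: derivative_eq_intros)
    then have "((\<lambda>s. f (x + s *\<^sub>R e)) has_real_derivative e \<bullet> D w) (at s)"
      unfolding has_field_derivative_def by (simp add: mult_commute_abs)
    then have "(\<phi> has_real_derivative (e \<bullet> D w - D x \<bullet> e - L * s * (norm e)\<^sup>2)) (at s)"
      unfolding \<phi>_def by (auto intro!: derivative_eq_intros)
    moreover have "e \<bullet> D w - D x \<bullet> e - L * s * (norm e)\<^sup>2 \<le> 0"
    proof -
      have "e \<bullet> D w - D x \<bullet> e = (D w - D x) \<bullet> e"
        by (simp add: inner_diff_left inner_diff_right inner_commute)
      also have "\<dots> \<le> norm (D w - D x) * norm e"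
        by (rule norm_cauchy_schwarz)
      also have "\<dots> \<le> (L * norm (w - x)) * norm e"
        by (intro mult_right_mono L) simp
      also have "\<dots> = L * s * (norm e)\<^sup>2"
        using s by (simp add: w_def power2_eq_square)
      finally show ?thesis by simp
    qed
    ultimately show "\<exists>l. (\<phi> has_real_derivative l) (at s) \<and> l \<le> 0" by blast
  qed simp
  then show ?thesis
    by (simp add: \<phi>_def e_def)
qed

lemma jacobian_lipschitz_nonneg:
  assumes "jacobian_lipschitz L (F :: real^'n \<Rightarrow> real^'m)"
  shows "0 \<le> L"
proof -
  have "0 \<le> spectral_norm (jacobian F (at (1 :: real^'n)) - jacobian F (at 0))"
    unfolding spectral_norm_def by (rule onorm_pos_le) simp
  also have "\<dots> \<le> L * norm ((1 :: real^'n) - 0)"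
    using assms unfolding jacobian_lipschitz_def by blast
  finally show ?thesis
    by (simp add: zero_le_mult_iff)
qed

lemma norm_transpose_jacobian_diff:
  assumes "jacobian_lipschitz L F"
  shows "norm (transpose (jacobian F (at u)) *v l - transpose (jacobian F (at w)) *v l) \<le> L * norm (u - w) * norm l"
proof -
  have "transpose (jacobian F (at u)) *v l - transpose (jacobian F (at w)) *v l
      = transpose (jacobian F (at u) - jacobian F (at w)) *v l"
    by (simp add: matrix_vector_mult_diff_rdistrib[symmetric]) (simp add: transpose_def minus_vec_def)
  then have "norm (transpose (jacobian F (at u)) *v l - transpose (jacobian F (at w)) *v l)
      \<le> spectral_norm (jacobian F (at u) - jacobian F (at w)) * norm l"
    using norm_transpose_mult_le_spectral_norm by metis
  also have "\<dots> \<le> L * norm (u - w) * norm l"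
    using assms unfolding jacobian_lipschitz_def by (intro mult_right_mono) auto
  finally show ?thesis .
qed

text \<open>Testing with a unit vector \<open>u\<close> reduces the claim to the scalar inequality
  for \<open>u \<bullet> F\<close>, whose gradient is the transposed Jacobian applied to
  \<open>u\<close>; this yields the factor 1/2 for vector-valued maps.\<close>

lemma linearization_error:
  fixes F :: "real^'n \<Rightarrow> real^'m"
  assumes diff: "\<And>z. F differentiable (at z)"
    and L: "jacobian_lipschitz L F"
  shows "norm (F y - F x - jacobian F (at x) *v (y - x)) \<le> L / 2 * (norm (y - x))\<^sup>2"
proof (rule norm_vector_leI)
  fix u :: "real^'m" assume u: "norm u = 1"
  have "u \<bullet> F y \<le> u \<bullet> F x + (transpose (jacobian F (at x)) *v u) \<bullet> (y - x)
      + L / 2 * (norm (y - x))\<^sup>2"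
  proof (rule gradient_descent_inequality[where D="\<lambda>z. transpose (jacobian F (at z)) *v u"])
    fix z
    have "(F has_derivative (\<lambda>w. jacobian F (at z) *v w)) (at z)"
      using diff jacobian_works by blast
    then have "((\<lambda>z. u \<bullet> F z) has_derivative (\<lambda>w. u \<bullet> (jacobian F (at z) *v w))) (at z)"
      by (rule has_derivative_inner_right)
    then show "GDERIV (\<lambda>z. u \<bullet> F z) z :> transpose (jacobian F (at z)) *v u"
      unfolding gderiv_def by (simp add: inner_commute[of _ "transpose _ *v _"] inner_transpose_mult)
    show "norm (transpose (jacobian F (at z)) *v u - transpose (jacobian F (at x)) *v u)
        \<le> L * norm (z - x)"
      using norm_transpose_jacobian_diff[OF L, of z u x] u by simp
  qed
  then show "u \<bullet> (F y - F x - jacobian F (at x) *v (y - x)) \<le> L / 2 * (norm (y - x))\<^sup>2"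
    by (simp add: inner_transpose_mult inner_diff_right matrix_vector_mult_diff_distrib)
qed (use jacobian_lipschitz_nonneg[OF L] in simp)

lemma segment_lipschitz:
  fixes F :: "'a::real_normed_vector \<Rightarrow> 'b::real_normed_vector"
  assumes "\<And>z. z \<in> closed_segment x y \<Longrightarrow> (F has_derivative F' z) (at z)"
    and "\<And>z w. z \<in> closed_segment x y \<Longrightarrow> norm (F' z w) \<le> B * norm w"
    and "0 \<le> B"
  shows "norm (F y - F x) \<le> B * norm (y - x)"
proof (rule differentiable_bound[OF convex_closed_segment])
  show "(F has_derivative F' z) (at z within closed_segment x y)" if "z \<in> closed_segment x y" for z
    using assms(1)[OF that] by (rule has_derivative_at_withinI)
  show "onorm (F' z) \<le> B" if "z \<in> closed_segment x y" for z
    using assms(2)[OF that] assms(3) by (intro onorm_bound)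
qed auto

section \<open>Positive semidefinite forms, extreme eigenvalues and Gram matrices\<close>

lemma psd_form:
  fixes T :: "'a::real_inner \<Rightarrow> 'a"
  assumes T: "linear T" and sym: "\<And>a b. T a \<bullet> b = a \<bullet> T b"
    and psd: "\<And>a. 0 \<le> T a \<bullet> a"
  shows psd_Cauchy_Schwarz: "(T a \<bullet> b)\<^sup>2 \<le> (T a \<bullet> a) * (T b \<bullet> b)"
    and psd_form_zero: "T a \<bullet> a = 0 \<Longrightarrow> T a = 0"
proof -
  show CS: "(T a \<bullet> b)\<^sup>2 \<le> (T a \<bullet> a) * (T b \<bullet> b)" for a b
  proof -
    have q: "0 \<le> (T a \<bullet> a) * s\<^sup>2 + 2 * (T a \<bullet> b) * s + T b \<bullet> b" for s
    proof -
      have "0 \<le> T (s *\<^sub>R a + b) \<bullet> (s *\<^sub>R a + b)" by (rule psd)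
      also have "\<dots> = (T a \<bullet> a) * s\<^sup>2 + 2 * (T a \<bullet> b) * s + T b \<bullet> b"
        using sym[of b a]
        by (simp add: linear_add[OF T] linear_scale[OF T] inner_add_left inner_add_right
            power2_eq_square algebra_simps inner_commute)
      finally show ?thesis .
    qed
    show ?thesis
    proof (cases "T a \<bullet> a = 0")
      case True
      have "T a \<bullet> b = 0"
      proof (rule ccontr)
        assume "T a \<bullet> b \<noteq> 0"
        \<comment> \<open>With a vanishing leading coefficient the quadratic is affine in
          \<open>s\<close>; at this argument its value is -1.\<close>
        then show False
          using q[of "- (T b \<bullet> b + 1) / (2 * (T a \<bullet> b))"] True by simp
      qed
      then show ?thesis using True by simp
    next
      case False
      then have pos: "0 < T a \<bullet> a" using psd[of a] by simp
      have "0 \<le> (T a \<bullet> a) * (- (T a \<bullet> b) / (T a \<bullet> a))\<^sup>2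
          + 2 * (T a \<bullet> b) * (- (T a \<bullet> b) / (T a \<bullet> a)) + T b \<bullet> b" by (rule q)
      then have "0 \<le> (T a \<bullet> a) * ((T a \<bullet> a) * (- (T a \<bullet> b) / (T a \<bullet> a))\<^sup>2
          + 2 * (T a \<bullet> b) * (- (T a \<bullet> b) / (T a \<bullet> a)) + T b \<bullet> b)"
        using pos by (intro mult_nonneg_nonneg) auto
      also have "\<dots> = (T a \<bullet> a) * (T b \<bullet> b) - (T a \<bullet> b)\<^sup>2"
        using pos by (simp add: field_simps power2_eq_square)
      finally show ?thesis by simp
    qed
  qed
  show "T a = 0" if "T a \<bullet> a = 0"
    using CS[of a "T a"] that by simp
qed

text \<open>A minimizer \<open>u0\<close> of the Rayleigh quotient on the sphere is an eigenvector:
  subtracting \<open>l\<close> times the identity leaves a semidefinite form that vanishes at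
  \<open>u0\<close>, and such an operator annihilates \<open>u0\<close>.\<close>

lemma min_eigenvalue_exists:
  fixes B :: "real^'n^'n"
  assumes sym: "transpose B = B"
  obtains l where "eigenvalue B l" "\<And>u. l * (norm u)\<^sup>2 \<le> (B *v u) \<bullet> u"
proof -
  have symB: "(B *v a) \<bullet> b = a \<bullet> (B *v b)" for a b
    using inner_transpose_mult[of B a b] sym by simp
  have "continuous_on (sphere 0 1) (\<lambda>u. (B *v u) \<bullet> u)"
    by (intro continuous_intros) 
  then obtain u0 where "u0 \<in> sphere 0 1"
    and "\<forall>u\<in>sphere 0 1. (B *v u0) \<bullet> u0 \<le> (B *v u) \<bullet> u"
    using continuous_attains_inf[OF compact_sphere, of "0 :: real^'n" 1] by fastforce
  then have u0: "norm u0 = 1"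
    and min: "\<And>u. norm u = 1 \<Longrightarrow> (B *v u0) \<bullet> u0 \<le> (B *v u) \<bullet> u"
    by auto
  define l where "l = (B *v u0) \<bullet> u0"
  have lower: "l * (norm u)\<^sup>2 \<le> (B *v u) \<bullet> u" for u
  proof (cases "u = 0")
    case False
    have "l \<le> (B *v (u /\<^sub>R norm u)) \<bullet> (u /\<^sub>R norm u)"
      unfolding l_def using False by (intro min) simp
    also have "\<dots> = (B *v u) \<bullet> u / (norm u)\<^sup>2"
      by (simp add: matrix_vector_mult_scaleR power2_eq_square divide_inverse)
    finally show ?thesis using False by (simp add: field_simps)
  qed simp
  define T where "T u = B *v u - l *\<^sub>R u" for u
  have "linear T"
    unfolding T_def by (rule linearI) (auto simp: matrix_vector_right_distrib algebra_simps matrix_vector_mult_scaleR)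
  moreover have "T a \<bullet> b = a \<bullet> T b" for a b
    by (simp add: T_def inner_diff_left inner_diff_right symB)
  moreover have "0 \<le> T a \<bullet> a" for a
    using lower[of a] by (simp add: T_def inner_diff_left dot_square_norm)
  moreover have "T u0 \<bullet> u0 = 0"
    using u0 by (simp add: T_def inner_diff_left dot_square_norm l_def)
  ultimately have "T u0 = 0"
    by (rule psd_form_zero)
  then have "eigenvalue B l"
    using u0 unfolding eigenvalue_def T_def by (metis norm_zero right_minus_eq zero_neq_one)
  then show thesis using lower that by blast
qed

text \<open>The upper bound is the lower bound for \<open>- B\<close>, whose eigenvalues are the
  negatives of those of \<open>B\<close>.\<close>

lemma eigenvalue_bounds_quadratic_form:
  fixes B :: "real^'n^'n"
  assumes sym: "transpose B = B" and eig: "\<And>l. eigenvalue B l \<Longrightarrow> l \<in> {a..b}"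
  shows "a * (norm u)\<^sup>2 \<le> (B *v u) \<bullet> u" "(B *v u) \<bullet> u \<le> b * (norm u)\<^sup>2"
proof -
  obtain l where l: "eigenvalue B l" "\<And>u. l * (norm u)\<^sup>2 \<le> (B *v u) \<bullet> u"
    using min_eigenvalue_exists[OF sym] by blast
  have "a * (norm u)\<^sup>2 \<le> l * (norm u)\<^sup>2"
    using eig[OF l(1)] by (intro mult_right_mono) auto
  then show "a * (norm u)\<^sup>2 \<le> (B *v u) \<bullet> u" using l(2)[of u] by linarith
  have neg: "(- B) *v w = - (B *v w)" for w
    by (metis diff_0 matrix_vector_mult_diff_rdistrib matrix_vector_mult_0)
  have "transpose (- B) = - B"
    using sym by (simp add: transpose_def vec_eq_iff)
  then obtain l where l: "eigenvalue (- B) l" "\<And>u. l * (norm u)\<^sup>2 \<le> ((- B) *v u) \<bullet> u"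
    using min_eigenvalue_exists by blast
  have "eigenvalue B (- l)"
    using l(1) unfolding eigenvalue_def neg by (metis minus_equation_iff scaleR_minus_left)
  then have "(- l) * (norm u)\<^sup>2 \<le> b * (norm u)\<^sup>2"
    using eig by (intro mult_right_mono) auto
  then show "(B *v u) \<bullet> u \<le> b * (norm u)\<^sup>2"
    using l(2)[of u] by (simp add: neg)
qed

lemma gram_eigenvalue_bounds:
  fixes J :: "real^'n^'m"
  assumes eig: "\<And>l. eigenvalue (J ** transpose J) l \<Longrightarrow> l \<in> {a..b}"
  shows "a * (norm u)\<^sup>2 \<le> (norm (transpose J *v u))\<^sup>2"
    and "(norm (transpose J *v u))\<^sup>2 \<le> b * (norm u)\<^sup>2"
proof -
  have sym: "transpose (J ** transpose J) = J ** transpose J"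
    by (simp add: matrix_transpose_mul)
  have eq: "((J ** transpose J) *v u) \<bullet> u = (norm (transpose J *v u))\<^sup>2"
    by (metis inner_commute inner_transpose_mult matrix_vector_mul_assoc power2_norm_eq_inner)
  show "a * (norm u)\<^sup>2 \<le> (norm (transpose J *v u))\<^sup>2"
    using eigenvalue_bounds_quadratic_form(1)[OF sym eig, of u] by (simp add: eq)
  show "(norm (transpose J *v u))\<^sup>2 \<le> b * (norm u)\<^sup>2"
    using eigenvalue_bounds_quadratic_form(2)[OF sym eig, of u] by (simp add: eq)
qed

text \<open>The operator \<open>T = I - s J J^T\<close> is self-adjoint, semidefinite because
  \<open>s * b \<le> 1\<close>, and has quadratic form at most \<open>1 - s * a\<close>.
  Cauchy-Schwarz for the form of \<open>T\<close>, applied to \<open>u\<close> and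
  \<open>T u\<close>, turns the bound on the form into a bound on the norm.\<close>

lemma gradient_step_contraction:
  fixes J :: "real^'n^'m"
  assumes lo: "\<And>u. a * (norm u)\<^sup>2 \<le> (norm (transpose J *v u))\<^sup>2"
    and up: "\<And>u. (norm (transpose J *v u))\<^sup>2 \<le> b * (norm u)\<^sup>2"
    and s: "0 \<le> s" "s * b \<le> 1"
  shows "norm (u - s *\<^sub>R (J *v (transpose J *v u))) \<le> (1 - s * a) * norm u"
proof -
  define T where "T u = u - s *\<^sub>R (J *v (transpose J *v u))" for u
  have lin: "linear T"
    unfolding T_def by (rule linearI) (auto simp: matrix_vector_right_distrib algebra_simps matrix_vector_mult_scaleR)
  have JJ: "(J *v (transpose J *v p)) \<bullet> q = (transpose J *v p) \<bullet> (transpose J *v q)" for p q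
    by (metis inner_commute inner_transpose_mult)
  have sym: "T p \<bullet> q = p \<bullet> T q" for p q
    by (simp add: T_def inner_diff_left inner_diff_right JJ inner_commute[of p "J *v _"])
       (simp add: inner_commute)
  have form: "T p \<bullet> p = (norm p)\<^sup>2 - s * (norm (transpose J *v p))\<^sup>2" for p
    by (simp add: T_def inner_diff_left JJ dot_square_norm)
  have psd: "0 \<le> T p \<bullet> p" for p
  proof -
    have "s * (norm (transpose J *v p))\<^sup>2 \<le> s * (b * (norm p)\<^sup>2)"
      using s up by (intro mult_left_mono) auto
    also have "\<dots> \<le> 1 * (norm p)\<^sup>2"
      unfolding mult.assoc[symmetric] using s by (intro mult_right_mono) auto
    finally show ?thesis by (simp add: form)
  qed
  have upper: "T p \<bullet> p \<le> (1 - s * a) * (norm p)\<^sup>2" for p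
    using mult_left_mono[OF lo[of p] s(1)] by (simp add: form algebra_simps)
  have c: "0 \<le> 1 - s * a"
  proof -
    have "0 \<le> (1 - s * a) * (norm (1 :: real^'m))\<^sup>2"
      using psd[of 1] upper[of 1] by linarith
    then show ?thesis by (simp add: zero_le_mult_iff)
  qed
  have "((norm (T u))\<^sup>2)\<^sup>2 = (T u \<bullet> T u)\<^sup>2"
    by (simp add: dot_square_norm)
  also have "\<dots> \<le> (T u \<bullet> u) * (T (T u) \<bullet> T u)"
    using psd_Cauchy_Schwarz[OF lin sym psd] by blast
  also have "\<dots> \<le> ((1 - s * a) * (norm u)\<^sup>2) * ((1 - s * a) * (norm (T u))\<^sup>2)"
    using upper psd c by (intro mult_mono) auto
  finally have "(norm (T u))\<^sup>2 * (norm (T u))\<^sup>2 \<le> ((1 - s * a) * norm u)\<^sup>2 * (norm (T u))\<^sup>2"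
    by (simp add: power2_eq_square algebra_simps)
  then have "(norm (T u))\<^sup>2 \<le> ((1 - s * a) * norm u)\<^sup>2 \<or> norm (T u) = 0"
    by (metis mult_right_le_imp_le not_gr_zero norm_ge_zero order_le_less power2_less_0 zero_less_power2)
  then show ?thesis
    using c unfolding T_def[symmetric] by (auto intro: power2_le_imp_le)
qed

section \<open>Proximal mapping and Moreau envelope\<close>

lemma min_quadratic_lipschitz_exists:
  fixes g :: "'a::euclidean_space \<Rightarrow> real"
  assumes lip: "L-lipschitz_on UNIV g" and t: "0 < t"
  obtains z where "\<And>u. g z + 1 / (2 * t) * (norm (z - x))\<^sup>2 \<le> g u + 1 / (2 * t) * (norm (u - x))\<^sup>2"
proof -
  define G where "G u = g u + 1 / (2 * t) * (norm (u - x))\<^sup>2" for u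
  \<comment> \<open>Radius beyond which the quadratic term outweighs the largest possible decrease
    \<open>L * r\<close> of \<open>g\<close>, so that a minimizer over the compact ball is
    global.\<close>
  define R where "R = 2 * t * L"
  have L: "0 \<le> L" using lip by (rule lipschitz_on_nonneg)
  have R: "0 \<le> R" using L t by (simp add: R_def)
  have "continuous_on (cball x R) G"
    unfolding G_def using lipschitz_on_continuous_on[OF lip]
    by (intro continuous_intros) (auto intro: continuous_on_subset)
  then obtain z where z: "z \<in> cball x R" "\<And>u. u \<in> cball x R \<Longrightarrow> G z \<le> G u"
    using continuous_attains_inf[OF compact_cball, of x R G] R by fastforce
  have "G z \<le> G u" for u
  proof (cases "u \<in> cball x R")
    case False
    define r where "r = norm (u - x)"
    have r: "R < r" using False by (simp add: r_def dist_norm norm_minus_commute)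
    have "g x - g u \<le> L * r"
      using lipschitz_onD[OF lip, of x u] by (simp add: dist_norm r_def norm_minus_commute)
    moreover have "L * r \<le> 1 / (2 * t) * r\<^sup>2"
    proof -
      have "L * r = 1 / (2 * t) * (R * r)" using t by (simp add: R_def)
      also have "\<dots> \<le> 1 / (2 * t) * (r * r)"
        using r R t by (intro mult_left_mono mult_right_mono) auto
      finally show ?thesis by (simp add: power2_eq_square)
    qed
    ultimately have "G x \<le> G u" by (simp add: G_def r_def)
    then show ?thesis using z(2)[of x] R by auto
  qed (use z in auto)
  then show thesis using that unfolding G_def by blast
qed

text \<open>Comparing the minimizer with a point at fraction \<open>s\<close> towards
  \<open>u\<close> leaves the violation \<open>c\<close> of the subgradient inequality bounded by
  \<open>s * b\<close>, with \<open>b\<close> the quadratic cost; small \<open>s\<close> rules out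
  \<open>c > 0\<close>.\<close>

lemma subgradient_of_min_quadratic:
  fixes g :: "'a::euclidean_space \<Rightarrow> real"
  assumes conv: "convex_on UNIV g" and t: "0 < t"
    and z: "\<And>u. g z + 1 / (2 * t) * (norm (z - x))\<^sup>2 \<le> g u + 1 / (2 * t) * (norm (u - x))\<^sup>2"
  shows "g z + (1 / t) *\<^sub>R (x - z) \<bullet> (u - z) \<le> g u"
proof -
  define c where "c = g z + (1 / t) *\<^sub>R (x - z) \<bullet> (u - z) - g u"
  define b where "b = 1 / (2 * t) * (norm (u - z))\<^sup>2"
  have *: "c \<le> s * b" if s: "0 < s" "s \<le> 1" for s
  proof -
    define p where "p = (1 - s) *\<^sub>R z + s *\<^sub>R u"
    have "g p \<le> (1 - s) * g z + s * g u"
      unfolding p_def using s by (intro convex_onD[OF conv]) auto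
    moreover have "(norm (p - x))\<^sup>2 = (norm (z - x))\<^sup>2 - 2 * s * ((x - z) \<bullet> (u - z)) + s\<^sup>2 * (norm (u - z))\<^sup>2"
    proof -
      have "p - x = (z - x) + s *\<^sub>R (u - z)" by (simp add: p_def algebra_simps)
      moreover have "(z - x) \<bullet> (s *\<^sub>R (u - z)) = - s * ((x - z) \<bullet> (u - z))"
        by (metis inner_minus_left inner_scaleR_right minus_diff_eq mult_minus_left mult_minus_right)
      ultimately show ?thesis
        using norm_add_square[of "z - x" "s *\<^sub>R (u - z)"] unfolding \<open>p - x = _\<close>
        by (simp add: power_mult_distrib)
    qed
    moreover define k where "k = 1 / (2 * t)"
    moreover have "c = g z + 2 * k * ((x - z) \<bullet> (u - z)) - g u" by (simp add: c_def k_def)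
    moreover have "s * c \<le> s * (s * (k * nu))"
      if "gp \<le> (1 - s) * g z + s * g u" "np = nz - 2 * s * i + s\<^sup>2 * nu" "c = g z + 2 * k * i - g u"
        "g z + k * nz \<le> gp + k * np" for gp np nz nu i
      using that(1) that(4)[unfolded that(2)] unfolding that(3)
      by (simp add: algebra_simps power2_eq_square)
    ultimately have "s * c \<le> s * (s * b)"
      using z[of p] unfolding b_def k_def[symmetric] by blast
    then show ?thesis using s by simp
  qed
  have "c \<le> 0"
  proof (rule ccontr)
    assume "\<not> c \<le> 0"
    moreover have "0 \<le> b" using t by (simp add: b_def)
    ultimately show False
      \<comment> \<open>If \<open>c > 0\<close>, then \<open>s = 1\<close> gives
        \<open>c \<le> b\<close>, hence \<open>c / (2 * b)\<close> is admissible and yields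
        \<open>c \<le> c / 2\<close>.\<close>
      using *[of 1] *[of "c / (2 * b)"] by (auto simp: field_simps split: if_splits)
  qed
  then show ?thesis by (simp add: c_def)
qed

lemma prox_characterization:
  fixes g :: "'a::euclidean_space \<Rightarrow> real"
  assumes conv: "convex_on UNIV g" and lip: "L-lipschitz_on UNIV g" and t: "0 < t"
  shows prox_subgradient: "g (prox t g x) + (1 / t) *\<^sub>R (x - prox t g x) \<bullet> (u - prox t g x) \<le> g u"
    and prox_minimizes: "g (prox t g x) + 1 / (2 * t) * (norm (prox t g x - x))\<^sup>2 \<le> g u + 1 / (2 * t) * (norm (u - x))\<^sup>2"
proof -
  let ?G = "\<lambda>y. g y + 1 / (2 * t) * (norm (y - x))\<^sup>2"
  obtain z where z: "\<And>u. ?G z \<le> ?G u"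
    using min_quadratic_lipschitz_exists[OF lip t, of x] by blast
  \<comment> \<open>Adding the subgradient inequalities of two minimizers bounds their squared
    distance by zero; uniqueness is what makes the definite description in \<open>prox\<close>
    meaningful.\<close>
  have unique: "w = z" if w: "\<And>u. ?G w \<le> ?G u" for w
  proof -
    have "g w + (1 / t) *\<^sub>R (x - w) \<bullet> (z - w) \<le> g z" "g z + (1 / t) *\<^sub>R (x - z) \<bullet> (w - z) \<le> g w"
      using subgradient_of_min_quadratic[OF conv t] w z by blast+
    then have "(1 / t) * ((x - w) \<bullet> (z - w) + (x - z) \<bullet> (w - z)) \<le> 0"
      by (simp add: distrib_left)
    moreover have "(x - w) \<bullet> (z - w) + (x - z) \<bullet> (w - z) = (norm (z - w))\<^sup>2"
      by (simp add: power2_norm_eq_inner inner_diff_left inner_diff_right inner_commute)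
    ultimately have "(1 / t) * (norm (z - w))\<^sup>2 \<le> 0" by metis
    then have "(norm (z - w))\<^sup>2 \<le> 0"
      using t by (metis mult_le_0_iff not_less zero_less_divide_1_iff)
    then show ?thesis by simp
  qed
  have "prox t g x = z"
    unfolding prox_def is_arg_min_linorder
    using z unique by (intro the_equality) auto
  then show "?G (prox t g x) \<le> ?G u" for u using z by blast
  then show "g (prox t g x) + (1 / t) *\<^sub>R (x - prox t g x) \<bullet> (u - prox t g x) \<le> g u"
    by (rule subgradient_of_min_quadratic[OF conv t])
qed

lemma moreau_eq:
  fixes g :: "'a::euclidean_space \<Rightarrow> real"
  assumes "convex_on UNIV g" and "L-lipschitz_on UNIV g" and "0 < t"
  shows "moreau t g x = g (prox t g x) + 1 / (2 * t) * (norm (prox t g x - x))\<^sup>2"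
  unfolding moreau_def
  using prox_minimizes[OF assms, of x]
  by (intro cInf_eq_minimum) auto

text \<open>The envelope is squeezed between its linear model and that model plus a quadratic.
  Above, the old proximal point serves as a competitor for the shifted problem; below, the
  subgradient inequality at the old proximal point leaves a perfect square.\<close>

lemma GDERIV_moreau:
  fixes g :: "'a::euclidean_space \<Rightarrow> real"
  assumes conv: "convex_on UNIV g" and lip: "L-lipschitz_on UNIV g" and t: "0 < t"
  shows "GDERIV (moreau t g) x :> (1 / t) *\<^sub>R (x - prox t g x)"
proof -
  define z where "z = prox t g x"
  define \<zeta> where "\<zeta> = (1 / t) *\<^sub>R (x - z)"
  have Mx: "moreau t g x = g z + 1 / (2 * t) * (norm (z - x))\<^sup>2"
    unfolding z_def using assms by (rule moreau_eq)
  have upper: "moreau t g (x + e) \<le> moreau t g x + e \<bullet> \<zeta> + 1 / (2 * t) * (norm e)\<^sup>2" for e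
  proof -
    have "moreau t g (x + e) \<le> g z + 1 / (2 * t) * (norm (z - (x + e)))\<^sup>2"
      unfolding moreau_eq[OF assms] using assms by (rule prox_minimizes)
    moreover have "(norm (z - (x + e)))\<^sup>2 = (norm (z - x))\<^sup>2 + 2 * (e \<bullet> (x - z)) + (norm e)\<^sup>2"
      by (simp add: power2_norm_eq_inner inner_diff_left inner_diff_right inner_add_left
          inner_add_right inner_commute algebra_simps)
    moreover have "e \<bullet> \<zeta> = (e \<bullet> (x - z)) / t" by (simp add: \<zeta>_def)
    ultimately show ?thesis
      using t by (simp add: Mx field_simps)
  qed
  have lower: "moreau t g x + e \<bullet> \<zeta> \<le> moreau t g (x + e)" for e
  proof -
    define u where "u = prox t g (x + e)"
    have "g z + \<zeta> \<bullet> (u - z) \<le> g u"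
      unfolding z_def \<zeta>_def using assms by (rule prox_subgradient)
    moreover have "(norm (u - (x + e)))\<^sup>2
        = (norm (u - z - e))\<^sup>2 - 2 * ((x - z) \<bullet> (u - z)) + 2 * (e \<bullet> (x - z)) + (norm (z - x))\<^sup>2"
      by (simp add: power2_norm_eq_inner inner_diff_left inner_diff_right inner_add_left
          inner_add_right inner_commute algebra_simps)
    moreover define k where "k = 1 / (2 * t)"
    moreover have "0 \<le> k * (norm (u - z - e))\<^sup>2" using t by (simp add: k_def)
    moreover have "moreau t g (x + e) = g u + 1 / (2 * t) * (norm (u - (x + e)))\<^sup>2"
      unfolding u_def using assms by (rule moreau_eq)
    moreover have "\<zeta> \<bullet> (u - z) = 2 * k * ((x - z) \<bullet> (u - z))" "e \<bullet> \<zeta> = 2 * k * (e \<bullet> (x - z))"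
      by (simp_all add: \<zeta>_def k_def)
    moreover have "g z + k * nz + ez \<le> m"
      if "g z + zu \<le> g u" "nu = ne - 2 * i + 2 * j + nz" "0 \<le> k * ne" "m = g u + k * nu"
        "zu = 2 * k * i" "ez = 2 * k * j" for zu nu ne i j nz m ez
      using that(1,3) unfolding that(4,6) that(5) that(2) by (simp add: algebra_simps)
    ultimately show ?thesis
      unfolding Mx k_def[symmetric] by blast
  qed
  have bound: "\<bar>moreau t g (x + e) - moreau t g x - e \<bullet> \<zeta>\<bar> \<le> 1 / (2 * t) * (norm e)\<^sup>2" for e
    using upper[of e] lower[of e] by (simp add: abs_if)
  have "((\<lambda>e. norm (moreau t g (x + e) - moreau t g x - e \<bullet> \<zeta>) / norm e) \<longlongrightarrow> 0) (at 0)"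
  proof (rule tendsto_sandwich[of "\<lambda>_. 0"])
    show "\<forall>\<^sub>F e in at 0. norm (moreau t g (x + e) - moreau t g x - e \<bullet> \<zeta>) / norm e \<le> 1 / (2 * t) * norm e"
      unfolding eventually_at_filter
    proof (intro always_eventually allI impI)
      fix e :: 'a assume "e \<noteq> 0"
      then show "norm (moreau t g (x + e) - moreau t g x - e \<bullet> \<zeta>) / norm e \<le> 1 / (2 * t) * norm e"
        using bound[of e] by (simp add: field_simps power2_eq_square)
    qed
    show "((\<lambda>e::'a. 1 / (2 * t) * norm e) \<longlongrightarrow> 0) (at 0)"
      by (intro tendsto_eq_intros) auto
  qed (auto simp: divide_nonneg_nonneg)
  then show ?thesis
    unfolding gderiv_def has_derivative_at z_def[symmetric] \<zeta>_def[symmetric]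
    by (auto intro: bounded_linear_inner_left)
qed

lemma subgradient_norm_le:
  fixes g :: "'a::euclidean_space \<Rightarrow> real"
  assumes lip: "L-lipschitz_on UNIV g" and sub: "\<And>u. g z + \<zeta> \<bullet> (u - z) \<le> g u"
  shows "norm \<zeta> \<le> L"
proof (cases "\<zeta> = 0")
  case False
  have "g z + \<zeta> \<bullet> \<zeta> \<le> g (z + \<zeta>)" using sub[of "z + \<zeta>"] by simp
  then have "norm \<zeta> * norm \<zeta> \<le> L * norm \<zeta>"
    using lipschitz_onD[OF lip, of "z + \<zeta>" z]
    by (simp add: dist_norm dot_square_norm power2_eq_square)
  then show ?thesis using False by simp
qed (use lipschitz_on_nonneg[OF lip] in simp)

section \<open>Subgradients and the Kurdyka--Lojasiewicz argument\<close>

text \<open>The remainder in the definition may be taken from the minorant \<open>Q\<close>, which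
  is finite and differentiable at \<open>w\<close> even where \<open>\<psi>\<close> takes the value
  \<infinity> arbitrarily close to \<open>w\<close>.\<close>

lemma regular_subdiffI_minorant:
  assumes Q: "GDERIV Q w :> V"
    and eq: "\<psi> w = ereal (Q w)" and le: "\<And>w'. ereal (Q w') \<le> \<psi> w'"
  shows "V \<in> regular_subdiff \<psi> w"
  unfolding regular_subdiff_def
proof (intro CollectI conjI exI allI)
  define r where "r w' = Q w' - Q w - V \<bullet> (w' - w)" for w'
  show "\<bar>\<psi> w\<bar> \<noteq> \<infinity>" by (simp add: eq)
  have "((\<lambda>w'. norm (r w') / norm (w' - w)) \<longlongrightarrow> 0) (at w)"
    using Q unfolding gderiv_def has_derivative_iff_norm r_def by (simp add: inner_commute)
  then have "((\<lambda>w'. norm (r w' / norm (w' - w))) \<longlongrightarrow> 0) (at w)"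
    by simp
  then have "((\<lambda>w'. r w' / norm (w' - w)) \<longlongrightarrow> 0) (at w)"
    by (rule tendsto_norm_zero_cancel)
  then show "r \<in> o[at w](\<lambda>w'. norm (w' - w))"
    by (rule smalloI_tendsto) (auto simp: eventually_at_filter)
  show "\<psi> w + ereal (V \<bullet> (w' - w) + r w') \<le> \<psi> w'" for w'
    using le[of w'] by (simp add: eq r_def)
qed

lemma regular_subset_limiting_subdiff: "regular_subdiff \<psi> w \<subseteq> limiting_subdiff \<psi> w"
proof
  fix v assume v: "v \<in> regular_subdiff \<psi> w"
  then have "\<bar>\<psi> w\<bar> \<noteq> \<infinity>" by (simp add: regular_subdiff_def)
  then show "v \<in> limiting_subdiff \<psi> w"
    unfolding limiting_subdiff_def using v
    by (intro CollectI conjI exI[of _ "\<lambda>_. w"] exI[of _ "\<lambda>_. v"]) auto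
qed

text \<open>Since the constraint residuals vanish on the domain of the potential, the Lagrangian with
  arbitrary multipliers \<open>l\<close>, \<open>m\<close> is a smooth minorant; its gradient is a subgradient.\<close>

lemma KL_potential_regular_subgradient:
  fixes f :: "real^'n \<Rightarrow> real" and g :: "real^'p \<Rightarrow> real"
    and A :: "real^'n \<Rightarrow> real^'p" and h :: "real^'n \<Rightarrow> real^'m"
  assumes f: "GDERIV f x :> c"
    and h: "h differentiable (at x)" and A: "A differentiable (at x)"
    and sub: "\<And>u. g z + \<zeta> \<bullet> (u - z) \<le> g u"
    and feas: "\<And>i. h x $ i = (\<upsilon> $ i) ^ 3" "\<And>j. A x $ j - z $ j = (s $ j) ^ 3"
  shows "(c + transpose (jacobian h (at x)) *v l + transpose (jacobian A (at x)) *v m, \<zeta> - m,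
      (\<chi> i. - 3 * l $ i * (\<upsilon> $ i)\<^sup>2), (\<chi> j. - 3 * m $ j * (s $ j)\<^sup>2), 2 * \<omega>)
    \<in> regular_subdiff (KL_potential f g A h) (x, z, \<upsilon>, s, \<omega>)" (is "?V \<in> regular_subdiff ?P ?w")
proof (rule regular_subdiffI_minorant)
  define Q where "Q w = f (fst w) + (g z + \<zeta> \<bullet> (fst (snd w) - z))
      + (l \<bullet> h (fst w) - (\<Sum>i\<in>UNIV. l $ i * (fst (snd (snd w)) $ i) ^ 3))
      + (m \<bullet> (A (fst w) - fst (snd w)) - (\<Sum>j\<in>UNIV. m $ j * (fst (snd (snd (snd w))) $ j) ^ 3))
      + (snd (snd (snd (snd w))))\<^sup>2" for w :: "(real^'n) \<times> (real^'p) \<times> (real^'m) \<times> (real^'p) \<times> real"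
  have f1: "((\<lambda>w. f (fst w)) has_derivative (\<lambda>d. fst d \<bullet> c)) (at ?w)"
    using f unfolding gderiv_def
    by (intro has_derivative_compose[where f=fst and g=f]) (auto intro!: derivative_eq_intros)
  have h1: "((\<lambda>w. h (fst w)) has_derivative (\<lambda>d. jacobian h (at x) *v fst d)) (at ?w)"
    using h unfolding jacobian_works
    by (intro has_derivative_compose[where f=fst and g=h]) (auto intro!: derivative_eq_intros)
  have A1: "((\<lambda>w. A (fst w)) has_derivative (\<lambda>d. jacobian A (at x) *v fst d)) (at ?w)"
    using A unfolding jacobian_works
    by (intro has_derivative_compose[where f=fst and g=A]) (auto intro!: derivative_eq_intros)
  have nth: "((\<lambda>w. F w $ i) has_derivative (\<lambda>d. F' d $ i)) (at ?w)"
    if "(F has_derivative F') (at ?w)" for F :: "_ \<Rightarrow> real^'k" and F' i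
    using bounded_linear.has_derivative[OF bounded_linear_vec_nth that] .
  show "GDERIV Q ?w :> ?V"
    unfolding gderiv_def Q_def
    by (auto intro!: derivative_eq_intros f1 h1 A1 nth
        simp: inner_add_right inner_diff_right inner_diff_left inner_vec_def[where y="\<chi> i. _ i"]
          inner_commute[of _ "transpose _ *v _"] inner_transpose_mult fun_eq_iff
          inner_commute[of _ "_ :: real^'p"] sum_negf algebra_simps)
  have L: "l \<bullet> a - (\<Sum>i\<in>UNIV. l $ i * (b $ i) ^ 3) = 0" if "\<And>i. a $ i = (b $ i) ^ 3" for a b l :: "real^'k"
    using that by (simp add: inner_vec_def)
  show "?P ?w = ereal (Q ?w)"
    unfolding Q_def KL_potential_def delta_def using feas L[of "h x" \<upsilon> l] L[of "A x - z" s m] by simp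
  show "ereal (Q w) \<le> ?P w" for w
  proof -
    obtain x' z' \<upsilon>' s' \<omega>' where w: "w = (x', z', \<upsilon>', s', \<omega>')" by (metis prod_cases5)
    show ?thesis
      unfolding Q_def KL_potential_def delta_def w
      using sub[of z'] L[of "h x'" \<upsilon>' l] L[of "A x' - z'" s' m] by auto
  qed
qed

text \<open>Because \<open>e k\<close> enters the recursion halved, the total length travelled from index \<open>K\<close> on is at
  most \<open>2 c (e K + r K)\<close>; started close enough to \<open>a\<close>, the sequence cannot leave the ball in which
  the recursion is available.\<close>

lemma local_descent_imp_convergent:
  fixes X :: "nat \<Rightarrow> 'a::banach" and e r :: "nat \<Rightarrow> real"
  assumes step: "\<And>k. norm (X (Suc k) - X k) \<le> c * e k"
    and e0: "\<And>k. 0 \<le> e k" and r0: "\<And>k. 0 \<le> r k" and c: "0 \<le> c"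
    and e_lim: "e \<longlonglongrightarrow> 0" and r_lim: "r \<longlonglongrightarrow> 0"
    and rec: "\<And>k. k0 \<le> k \<Longrightarrow> norm (X k - a) < \<delta> \<Longrightarrow> e (Suc k) \<le> e k / 2 + (r k - r (Suc k))"
    and \<delta>: "0 < \<delta>"
    and sub: "strict_mono q" "(X \<circ> q) \<longlonglongrightarrow> a"
  shows "X \<longlonglongrightarrow> a"
proof -
  have "(\<lambda>i. norm ((X \<circ> q) i - a) + 2 * c * (e (q i) + r (q i))) \<longlonglongrightarrow> 0 + 2 * c * (0 + 0)"
    using LIMSEQ_subseq_LIMSEQ[OF e_lim sub(1)] LIMSEQ_subseq_LIMSEQ[OF r_lim sub(1)]
      LIM_zero[OF sub(2)]
    by (intro tendsto_intros tendsto_norm_zero) (simp_all add: o_def)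
  then have "\<forall>\<^sub>F i in sequentially. norm ((X \<circ> q) i - a) + 2 * c * (e (q i) + r (q i)) < \<delta>"
    using \<delta> by (auto dest: order_tendstoD(2))
  moreover have "\<forall>\<^sub>F i in sequentially. k0 \<le> i" by (rule eventually_ge_at_top)
  ultimately obtain i where i: "norm (X (q i) - a) + 2 * c * (e (q i) + r (q i)) < \<delta>" "k0 \<le> i"
    using eventually_happens'[OF sequentially_bot eventually_conj] by (metis (mono_tags, lifting) comp_apply eventually_conj eventually_happens' sequentially_bot)
  define K where "K = q i"
  have K: "k0 \<le> K" using i(2) seq_suble[OF sub(1), of i] by (simp add: K_def)
  \<comment> \<open>Length bound and membership in the ball are proved together, as the recursion is
    available only inside the ball. The extra \<open>2 * e (K + n)\<close> makes the sum telescope: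
    the recursion gives \<open>e (K + n) + 2 * e (K + n + 1)\<close> at most
    \<open>2 * e (K + n)\<close> plus twice the decrease of \<open>r\<close>.\<close>
  have sum_bound: "(\<Sum>j<n. e (K + j)) + 2 * e (K + n) \<le> 2 * e K + 2 * (r K - r (K + n))
      \<and> norm (X (K + n) - a) < \<delta>" for n
  proof (induction n)
    case 0
    have "0 \<le> 2 * c * (e (q i) + r (q i))" using c e0 r0 by simp
    then show ?case using i(1) e0[of K] unfolding K_def by simp
  next
    case (Suc n)
    have rec': "e (Suc (K + n)) \<le> e (K + n) / 2 + (r (K + n) - r (Suc (K + n)))"
      using Suc K by (intro rec) auto
    then have 1: "(\<Sum>j<Suc n. e (K + j)) + 2 * e (K + Suc n) \<le> 2 * e K + 2 * (r K - r (K + Suc n))"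
      using Suc by simp
    have tele: "norm (X (K + n') - X K) \<le> c * (\<Sum>j<n'. e (K + j))" for n'
    proof (induction n')
      case (Suc n')
      have "norm (X (K + Suc n') - X K) \<le> norm (X (Suc (K + n')) - X (K + n')) + norm (X (K + n') - X K)"
        using norm_triangle_ineq[of "X (Suc (K + n')) - X (K + n')" "X (K + n') - X K"] by simp
      also have "\<dots> \<le> c * e (K + n') + c * (\<Sum>j<n'. e (K + j))"
        using step Suc by (intro add_mono) auto
      finally show ?case by (simp add: distrib_left)
    qed simp
    have "(\<Sum>j<Suc n. e (K + j)) \<le> 2 * (e K + r K)"
      using 1 e0[of "K + Suc n"] r0[of "K + Suc n"] unfolding distrib_left right_diff_distrib by linarith
    then have "c * (\<Sum>j<Suc n. e (K + j)) \<le> c * (2 * (e K + r K))"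
      using c by (intro mult_left_mono)
    then have "norm (X (K + Suc n) - X K) \<le> 2 * c * (e K + r K)"
      using tele[of "Suc n"] by (simp add: algebra_simps)
    then have "norm (X (K + Suc n) - a) < \<delta>"
      using i(1) norm_triangle_ineq[of "X (K + Suc n) - X K" "X K - a"] by (simp add: K_def)
    then show ?case using 1 by blast
  qed
  have "(\<Sum>j<n. e (j + K)) \<le> 2 * e K + 2 * r K" for n
    using sum_bound[of n] e0[of "K + n"] r0[of "K + n"] by (simp add: add.commute)
  then have "summable (\<lambda>j. e (j + K))"
    using e0 by (intro summableI_nonneg_bounded) auto
  then have "summable (\<lambda>j. c * e j)"
    by (intro summable_mult) (simp add: summable_iff_shift)
  then have "summable (\<lambda>j. X (Suc j) - X j)"
    by (rule summable_comparison_test'[where N=0]) (rule step)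
  then have "convergent (\<lambda>n. \<Sum>j<n. X (Suc j) - X j)"
    by (simp add: summable_iff_convergent)
  then obtain b where "(\<lambda>n. X n - X 0) \<longlonglongrightarrow> b"
    by (auto simp: convergent_def sum_lessThan_telescope)
  then have "(\<lambda>n. (X n - X 0) + X 0) \<longlonglongrightarrow> b + X 0"
    by (intro tendsto_intros)
  then have "X \<longlonglongrightarrow> b + X 0" by simp
  moreover from this have "b + X 0 = a"
    using LIMSEQ_subseq_LIMSEQ[OF _ sub(1)] LIMSEQ_unique[OF _ sub(2)] by blast
  ultimately show ?thesis by simp
qed

text \<open>The subgradient inequality passes to the limit for each fixed \<open>u\<close>; its
  limit is an affine minorant touching \<open>g\<close> at \<open>a\<close>, hence a regular and
  therefore a limiting subgradient.\<close>

lemma convex_subgradient_limit: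
  fixes g :: "'a::euclidean_space \<Rightarrow> real"
  assumes g: "continuous_on UNIV g"
    and sub: "\<And>k u. g (z k) + \<zeta> k \<bullet> (u - z k) \<le> g u"
    and z: "z \<longlonglongrightarrow> a" and \<zeta>: "\<zeta> \<longlonglongrightarrow> m"
  shows "m \<in> limiting_subdiff (\<lambda>u. ereal (g u)) a"
proof -
  have "g a + m \<bullet> (u - a) \<le> g u" for u
  proof (rule LIMSEQ_le_const2)
    have "(\<lambda>k. g (z k)) \<longlonglongrightarrow> g a"
      using g z by (auto intro: continuous_on_tendsto_compose)
    then show "(\<lambda>k. g (z k) + \<zeta> k \<bullet> (u - z k)) \<longlonglongrightarrow> g a + m \<bullet> (u - a)"
      using z \<zeta> by (intro tendsto_intros)
    show "\<exists>N. \<forall>k\<ge>N. g (z k) + \<zeta> k \<bullet> (u - z k) \<le> g u" using sub by blast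
  qed
  then have "m \<in> regular_subdiff (\<lambda>u. ereal (g u)) a"
    by (intro regular_subdiffI_minorant[where Q="\<lambda>u. g a + m \<bullet> (u - a)"])
       (auto simp: gderiv_def inner_commute intro!: derivative_eq_intros)
  then show ?thesis using regular_subset_limiting_subdiff by blast
qed

text \<open>The derivative of a concave desingularizing function decreases, hence evaluating it at the
  larger value \<open>p\<close> only weakens the bound.\<close>

lemma desingularizing_decrease:
  fixes \<phi> :: "real \<Rightarrow> real"
  assumes conc: "concave_on {s. 0 \<le> s \<and> ereal s < \<epsilon>} \<phi>"
    and der: "\<And>s. 0 < s \<Longrightarrow> ereal s < \<epsilon> \<Longrightarrow> (\<phi> has_real_derivative \<phi>' s) (at s)"
    and a: "0 \<le> b" "b \<le> a" "0 < a" "a \<le> p" "ereal p < \<epsilon>"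
  shows "\<phi>' p * (a - b) \<le> \<phi> a - \<phi> b"
proof -
  let ?D = "{s. 0 \<le> s \<and> ereal s < \<epsilon>}"
  have conv: "convex_on ?D (\<lambda>s. - \<phi> s)" using conc by (simp add: concave_on_def)
  have below: "ereal s < \<epsilon>" if "s \<le> p" for s
    using that by (intro order_le_less_trans[OF _ a(5)]) simp
  have tangent: "\<phi> s \<le> \<phi> c + \<phi>' c * (s - c)" if c: "0 < c" "c \<le> p" and s: "0 \<le> s" "s \<le> p" for c s
  proof -
    have D: "((\<lambda>s. - \<phi> s) has_real_derivative - \<phi>' c) (at c within ?D)"
      by (rule has_field_derivative_at_within[OF DERIV_minus[OF der[OF c(1) below[OF c(2)]]]])
    have "open {s. 0 < s \<and> ereal s < \<epsilon>}"
      by (intro open_Collect_conj open_Collect_less continuous_intros)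
    then have int: "c \<in> interior ?D"
      using c below[OF c(2)] by (intro interiorI[of "{s. 0 < s \<and> ereal s < \<epsilon>}"]) auto
    have "connected ?D"
      using conv convex_on_imp_convex convex_connected by blast
    then have "- \<phi>' c * (s - c) \<le> - \<phi> s - - \<phi> c"
      using convex_on_imp_above_tangent[OF conv _ int _ D, of s] s below[OF s(2)] by auto
    then show ?thesis by simp
  qed
  have "\<phi> b \<le> \<phi> a + \<phi>' a * (b - a)"
    using a by (intro tangent) auto
  then have 1: "\<phi>' a * (a - b) \<le> \<phi> a - \<phi> b" by (simp add: algebra_simps)
  have "\<phi>' p \<le> \<phi>' a"
  proof (cases "a = p")
    case False
    \<comment> \<open>Adding the tangent inequalities at \<open>p\<close> and at \<open>a\<close>
      gives monotonicity of the derivative.\<close>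
    have "\<phi> a \<le> \<phi> p + \<phi>' p * (a - p)" "\<phi> p \<le> \<phi> a + \<phi>' a * (p - a)"
      using a by (auto intro!: tangent)
    then have "0 \<le> (\<phi>' a - \<phi>' p) * (p - a)" by (simp add: algebra_simps)
    then show ?thesis using False a by (simp add: zero_le_mult_iff)
  qed simp
  then have "\<phi>' p * (a - b) \<le> \<phi>' a * (a - b)" using a by (intro mult_right_mono) auto
  then show ?thesis using 1 by linarith
qed

section \<open>The dual residual\<close>

text \<open>Completing the square in \<open>Y\<close> costs at most \<open>b\<^sup>2 / 4\<close>,
  which \<open>X * (X - a)\<close> exceeds once \<open>X\<close> is larger than
  \<open>a + b / 2\<close>. It serves to bound the component \<open>d2\<close> of the step.\<close>

lemma sum_squares_le_linear_imp_bound: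
  fixes X Y a b :: real
  assumes "X\<^sup>2 + Y\<^sup>2 \<le> a * X + b * Y" "0 \<le> a" "0 \<le> b"
  shows "X \<le> a + b / 2"
proof (rule ccontr)
  assume "\<not> X \<le> a + b / 2"
  then have X: "a + b / 2 < X" by simp
  have "b * Y - Y\<^sup>2 \<le> b\<^sup>2 / 4"
    using zero_le_power2[of "Y - b / 2"] by (simp add: power2_eq_square algebra_simps)
  moreover have "b\<^sup>2 / 4 \<le> (a + b / 2) * (b / 2)"
    using assms by (simp add: power2_eq_square algebra_simps)
  moreover have "(a + b / 2) * (b / 2) < X * (X - a)"
  proof -
    have "(a + b / 2) * (b / 2) \<le> (a + b / 2) * (X - a)"
      using X assms by (intro mult_left_mono) auto
    also have "\<dots> < X * (X - a)"
      using X assms by (intro mult_strict_right_mono) auto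
    finally show ?thesis .
  qed
  moreover have "X * (X - a) = X\<^sup>2 - a * X"
    by (simp add: power2_eq_square algebra_simps)
  ultimately show False
    using assms(1) by linarith
qed

text \<open>Here the square is completed in \<open>X\<close> and the bound is for \<open>Y\<close>;
  it serves to bound \<open>v\<close>, with \<open>\<epsilon>\<close> the norm of the residual term
  \<open>e\<close>.\<close>

lemma sum_squares_le_affine_imp_bound:
  fixes X Y a T \<epsilon> :: real
  assumes "X\<^sup>2 + Y\<^sup>2 \<le> a * X + (T + \<epsilon>) * Y + T * \<epsilon>" "0 \<le> a" "0 \<le> T" "0 \<le> \<epsilon>"
  shows "Y \<le> a / 2 + 2 * T + \<epsilon>"
proof (rule ccontr)
  assume "\<not> Y \<le> a / 2 + 2 * T + \<epsilon>"
  then have Y: "a / 2 + 2 * T + \<epsilon> < Y" by simp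
  have "a * X - X\<^sup>2 \<le> a\<^sup>2 / 4"
    using zero_le_power2[of "X - a / 2"] by (simp add: power2_eq_square algebra_simps)
  then have "Y * (Y - T - \<epsilon>) \<le> a\<^sup>2 / 4 + T * \<epsilon>"
    using assms(1) by (simp add: power2_eq_square algebra_simps)
  also have "a\<^sup>2 / 4 + T * \<epsilon> \<le> (a / 2 + 2 * T + \<epsilon>) * (a / 2 + T)"
    using assms by (simp add: power2_eq_square algebra_simps)
  also have "\<dots> \<le> (a / 2 + 2 * T + \<epsilon>) * (Y - T - \<epsilon>)"
    using Y assms by (intro mult_left_mono) auto
  also have "\<dots> < Y * (Y - T - \<epsilon>)"
    using Y assms by (intro mult_strict_right_mono) auto
  finally show False by simp
qed

text \<open>Only the component of \<open>d\<close> in the kernel of \<open>J\<close> can be tested against the definition of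
  \<open>d\<close> without meeting the unknown multiplier \<open>l\<close>; the component in the range of \<open>J\<^sup>T\<close> is of the
  order of the residual \<open>J d\<close>.\<close>

lemma dual_residual_bounds:
  fixes J :: "real^'n^'m" and B :: "real^'n^'p"
  assumes d: "d = - (t *\<^sub>R (c + transpose J *v l + transpose B *v m))"
    and t: "0 < t" and C1: "0 < C1" and nonneg: "0 \<le> lf" "0 \<le> lg" "0 \<le> lA"
    and lower: "\<And>u. C1 * (norm u)\<^sup>2 \<le> (norm (transpose J *v u))\<^sup>2"
    and c: "norm c \<le> lf" and B: "\<And>w. norm (B *v w) \<le> lA * norm w"
    and BT: "\<And>w. norm (transpose B *v w) \<le> lA * norm w"
    and res: "norm (J *v d) \<le> \<Delta>" "norm (v - B *v d) \<le> \<Delta>"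
    and \<zeta>: "norm (m - (1 / t) *\<^sub>R v) \<le> lg"
  shows "norm d \<le> t * (2 * lf + lg) + ((lA + 1) / sqrt C1 + 1) * \<Delta>"
    and "norm m \<le> lf + 3 * lg + ((lA + 1) / sqrt C1 + 1) * (\<Delta> / t)"
    and "norm l \<le> 1 / sqrt C1 * ((3 + lA) * lf + (3 * lA + 1) * lg
      + ((lA + 1) / sqrt C1 + 1) * ((lA + 1) * \<Delta> / t))"
proof -
  define w where "w = v - B *v d"
  define \<zeta> where "\<zeta> = m - (1 / t) *\<^sub>R v"
  have sC1: "0 < sqrt C1" using C1 by simp
  have \<Delta>: "0 \<le> \<Delta>" using res(1) norm_ge_zero order_trans by blast
  have lower': "sqrt C1 * norm u \<le> norm (transpose J *v u)" for u
    using real_sqrt_le_mono[OF lower[of u]] by (simp add: real_sqrt_mult)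
  \<comment> \<open>\<open>J J^T\<close> is injective by the lower bound on
    \<open>transpose J\<close>, hence surjective. The resulting \<open>d1\<close> is the orthogonal
    projection of \<open>d\<close> onto the range of \<open>transpose J\<close>.\<close>
  have "linear (\<lambda>u. J *v (transpose J *v u))"
    by (rule linearI) (auto simp: matrix_vector_right_distrib matrix_vector_mult_scaleR)
  moreover have "inj (\<lambda>u. J *v (transpose J *v u))"
  proof (unfold linear_injective_0[OF \<open>linear (\<lambda>u. J *v (transpose J *v u))\<close>], intro allI impI)
    fix u assume "J *v (transpose J *v u) = 0"
    then have "(norm (transpose J *v u))\<^sup>2 = 0"
      using inner_transpose_mult[of J u "transpose J *v u"] by (simp add: power2_norm_eq_inner)
    then show "u = 0" using lower'[of u] sC1 by (simp add: mult_le_0_iff)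
  qed
  ultimately have "surj (\<lambda>u. J *v (transpose J *v u))"
    by (rule linear_inj_imp_surj)
  then obtain p where p: "J *v (transpose J *v p) = J *v d"
    by (metis surjD)
  define d1 where "d1 = transpose J *v p"
  define d2 where "d2 = d - d1"
  have Jd2: "J *v d2 = 0"
    by (simp add: d2_def d1_def matrix_vector_mult_diff_distrib p)
  have orth: "d1 \<bullet> d2 = 0"
    by (simp add: d1_def inner_transpose_mult Jd2)
  have d1: "norm d1 \<le> \<Delta> / sqrt C1"
  proof -
    have "norm d1 * norm d1 = p \<bullet> (J *v d)"
      by (metis d1_def inner_transpose_mult p power2_eq_square power2_norm_eq_inner)
    also have "\<dots> \<le> norm p * norm (J *v d)" by (rule norm_cauchy_schwarz)
    also have "\<dots> \<le> norm p * \<Delta>" using res by (intro mult_left_mono) auto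
    also have "\<dots> \<le> norm d1 / sqrt C1 * \<Delta>"
      using lower'[of p] sC1 \<Delta> by (intro mult_right_mono) (auto simp: d1_def field_simps)
    finally have "norm d1 * norm d1 \<le> norm d1 * (\<Delta> / sqrt C1)" by (simp add: mult_ac)
    then show ?thesis
      using \<Delta> sC1 by (cases "d1 = 0") (auto intro: mult_left_le_imp_le[of "norm d1"])
  qed
  \<comment> \<open>Error made when \<open>v\<close> is compared with \<open>B *v d2\<close> in
    place of \<open>B *v d\<close>.\<close>
  define e where "e = w + B *v d1"
  have Bd2: "B *v d2 = v - e"
    by (simp add: d2_def e_def w_def matrix_vector_mult_diff_distrib)
  have e: "norm e \<le> (lA / sqrt C1 + 1) * \<Delta>"
  proof -
    have "norm e \<le> norm w + norm (B *v d1)" unfolding e_def by (rule norm_triangle_ineq)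
    also have "norm w \<le> \<Delta>" using res by (simp add: w_def)
    also have "norm (B *v d1) \<le> lA * (\<Delta> / sqrt C1)"
      using B[of d1] mult_left_mono[OF d1 nonneg(3)] by linarith
    finally show ?thesis by (simp add: algebra_simps)
  qed
  have tm: "t *\<^sub>R m = t *\<^sub>R \<zeta> + v"
    using t by (simp add: \<zeta>_def algebra_simps)
  have id: "(norm d2)\<^sup>2 + (t *\<^sub>R \<zeta> + v) \<bullet> (v - e) = - (t * (c \<bullet> d2))"
  proof -
    have "d \<bullet> d2 = (norm d2)\<^sup>2"
      using orth by (simp add: d2_def power2_norm_eq_inner inner_diff_left)
    moreover have "d \<bullet> d2 = - (t * (c \<bullet> d2)) - (t *\<^sub>R m) \<bullet> (B *v d2)"
      unfolding d by (simp add: inner_add_left inner_transpose_mult Jd2 algebra_simps)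
    ultimately show ?thesis unfolding tm Bd2 by simp
  qed
  have cd2: "- (t * (c \<bullet> d2)) \<le> t * lf * norm d2"
  proof -
    have "- (c \<bullet> d2) \<le> norm c * norm d2"
      using norm_cauchy_schwarz[of "- c" d2] by simp
    also have "\<dots> \<le> lf * norm d2" using c by (intro mult_right_mono) auto
    finally have "t * (- (c \<bullet> d2)) \<le> t * (lf * norm d2)" using t by (intro mult_left_mono) auto
    then show ?thesis by simp
  qed
  have \<zeta>_inner: "\<zeta> \<bullet> a \<le> lg * norm a" "- (\<zeta> \<bullet> a) \<le> lg * norm a" for a
    using norm_cauchy_schwarz[of \<zeta> a] norm_cauchy_schwarz[of "- \<zeta>" a]
      mult_right_mono[OF \<zeta>[folded \<zeta>_def] norm_ge_zero[of a]] by auto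
  \<comment> \<open>The identity \<open>id\<close> is exploited twice: here with
    \<open>v - e\<close> as the second unknown, which gives the bound on \<open>d2\<close>, and
    afterwards with \<open>v\<close> itself, which gives the bound on \<open>v\<close> and thereby
    on \<open>m\<close>.\<close>
  have "(norm d2)\<^sup>2 + (norm (v - e))\<^sup>2 \<le> (t * lf) * norm d2 + (t * lg + norm e) * norm (v - e)"
  proof -
    have "(t *\<^sub>R \<zeta> + v) \<bullet> (v - e) = (norm (v - e))\<^sup>2 + t * (\<zeta> \<bullet> (v - e)) + e \<bullet> (v - e)"
      by (simp add: power2_norm_eq_inner inner_add_left inner_diff_left algebra_simps)
    moreover have "t * (- (\<zeta> \<bullet> (v - e))) \<le> t * (lg * norm (v - e))"
      using t by (intro mult_left_mono \<zeta>_inner) auto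
    moreover have "- (e \<bullet> (v - e)) \<le> norm e * norm (v - e)"
      using norm_cauchy_schwarz[of "- e" "v - e"] by simp
    ultimately show ?thesis using id cd2 by (simp add: algebra_simps)
  qed
  then have d2: "norm d2 \<le> t * lf + (t * lg + norm e) / 2"
    using t nonneg by (intro sum_squares_le_linear_imp_bound[where Y="norm (v - e)"]) auto
  have "(norm d2)\<^sup>2 + (norm v)\<^sup>2 \<le> (t * lf) * norm d2 + (t * lg + norm e) * norm v + (t * lg) * norm e"
  proof -
    have "(t *\<^sub>R \<zeta> + v) \<bullet> (v - e) = (norm v)\<^sup>2 + t * (\<zeta> \<bullet> v) - t * (\<zeta> \<bullet> e) - v \<bullet> e"
      by (simp add: power2_norm_eq_inner inner_add_left inner_diff_right algebra_simps)
    moreover have "t * (- (\<zeta> \<bullet> v)) \<le> t * (lg * norm v)" "t * (\<zeta> \<bullet> e) \<le> t * (lg * norm e)"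
      using t by (intro mult_left_mono \<zeta>_inner; simp)+
    moreover have "v \<bullet> e \<le> norm v * norm e" by (rule norm_cauchy_schwarz)
    ultimately show ?thesis using id cd2 by (simp add: algebra_simps)
  qed
  then have v: "norm v \<le> t * lf / 2 + 2 * (t * lg) + norm e"
    using t nonneg by (intro sum_squares_le_affine_imp_bound) auto
  \<comment> \<open>The factor of the inexactness collects \<open>lA / sqrt C1 + 1\<close> from
    \<open>e\<close> and \<open>1 / sqrt C1\<close> from \<open>d1\<close>.\<close>
  define E where "E = (lA + 1) / sqrt C1 + 1"
  have E: "E = (lA / sqrt C1 + 1) + 1 / sqrt C1" by (simp add: E_def add_divide_distrib)
  have E_e: "norm e + \<Delta> / sqrt C1 \<le> E * \<Delta>"
    using e by (simp add: E algebra_simps)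
  have "norm d \<le> norm d1 + norm d2"
    unfolding d2_def by (metis add_diff_cancel_left' add.commute diff_add_cancel norm_triangle_ineq)
  also have "\<dots> \<le> \<Delta> / sqrt C1 + (t * lf + (t * lg + norm e) / 2)"
    using d1 d2 by (rule add_mono)
  also have "\<dots> \<le> t * (2 * lf + lg) + E * \<Delta>"
  proof -
    have "0 \<le> t * lf" "0 \<le> t * lg" using t nonneg by simp_all
    moreover have "t * (2 * lf + lg) = 2 * (t * lf) + t * lg" by (simp add: algebra_simps)
    ultimately show ?thesis using E_e norm_ge_zero[of e] unfolding add_divide_distrib by linarith
  qed
  finally show d_le: "norm d \<le> t * (2 * lf + lg) + ((lA + 1) / sqrt C1 + 1) * \<Delta>"
    by (simp add: E_def)
  have "norm m \<le> norm \<zeta> + norm ((1 / t) *\<^sub>R v)"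
    unfolding \<zeta>_def by (metis diff_add_cancel norm_triangle_ineq)
  also have "\<dots> \<le> lg + (1 / t) * (t * lf / 2 + 2 * (t * lg) + norm e)"
    using \<zeta> v t by (intro add_mono) (auto simp: \<zeta>_def divide_right_mono)
  also have "\<dots> = lf / 2 + 3 * lg + norm e / t"
    using t by (simp add: field_simps)
  also have "\<dots> \<le> lf + 3 * lg + (E * \<Delta>) / t"
  proof -
    have "norm e \<le> E * \<Delta>" using E_e \<Delta> sC1 by (smt (verit) divide_nonneg_pos)
    then have "norm e / t \<le> (E * \<Delta>) / t" using t by (intro divide_right_mono) auto
    then show ?thesis using nonneg by linarith
  qed
  finally show m_le: "norm m \<le> lf + 3 * lg + ((lA + 1) / sqrt C1 + 1) * (\<Delta> / t)"
    by (simp add: E_def)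
  \<comment> \<open>The multiplier is recovered by solving the definition of \<open>d\<close> for
    \<open>transpose J *v l\<close>, since \<open>transpose J\<close> is bounded below by
    \<open>sqrt C1\<close>.\<close>
  have "transpose J *v l = - (1 / t) *\<^sub>R d - c - transpose B *v m"
    using t unfolding d by (simp add: algebra_simps)
  then have "norm (transpose J *v l) \<le> norm d / t + norm c + norm (transpose B *v m)"
    using t norm_triangle_ineq4[of "- (1 / t) *\<^sub>R d - c" "transpose B *v m"]
      norm_triangle_ineq4[of "- (1 / t) *\<^sub>R d" c] by simp
  also have "\<dots> \<le> (t * (2 * lf + lg) + E * \<Delta>) / t + lf + lA * (lf + 3 * lg + E * (\<Delta> / t))"
    using d_le m_le c BT[of m] mult_left_mono[OF m_le nonneg(3)] t
    by (intro add_mono divide_right_mono) (auto simp: E_def)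
  also have "\<dots> = (3 + lA) * lf + (3 * lA + 1) * lg + E * ((lA + 1) * \<Delta> / t)"
    using t by (simp add: field_simps)
  finally have "sqrt C1 * norm l \<le> (3 + lA) * lf + (3 * lA + 1) * lg + E * ((lA + 1) * \<Delta> / t)"
    using lower'[of l] by linarith
  then show "norm l \<le> 1 / sqrt C1 * ((3 + lA) * lf + (3 * lA + 1) * lg
      + ((lA + 1) / sqrt C1 + 1) * ((lA + 1) * \<Delta> / t))"
    using sC1 unfolding E_def[symmetric] by (simp add: field_simps)
qed

text \<open>Real cube roots exist for either sign, so both constraint sets of the potential are
  graphs: each choice of \<open>x\<close> and \<open>z\<close> has exactly one pair of slacks, given
  by this map.\<close>

definition cbrt_vec :: "real^'k \<Rightarrow> real^'k" where
  "cbrt_vec w = (\<chi> i. root 3 (w $ i))"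

lemma cbrt_vec_cube: "(cbrt_vec w $ i) ^ 3 = w $ i"
  by (simp add: cbrt_vec_def odd_real_root_pow)

lemma tendsto_cbrt_vec_zero:
  fixes w :: "'i \<Rightarrow> real^'k"
  assumes "(w \<longlongrightarrow> 0) F"
  shows "((\<lambda>k. cbrt_vec (w k)) \<longlongrightarrow> 0) F"
proof (rule vec_tendstoI)
  fix i
  have "((\<lambda>k. root 3 (w k $ i)) \<longlongrightarrow> root 3 ((0 :: real^'k) $ i)) F"
    by (intro tendsto_real_root tendsto_vec_nth assms)
  then show "((\<lambda>k. cbrt_vec (w k) $ i) \<longlongrightarrow> 0 $ i) F"
    by (simp add: cbrt_vec_def)
qed

text \<open>With \<open>\<upsilon>\<^sup>3 = w\<close> one has \<open>\<upsilon>\<^sup>2 = O(\<bar>w\<bar>\<^sup>2\<^sup>/\<^sup>3)\<close>, and the exponent \<open>2/3 \<ge> 1/2\<close> is what makes these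
  components of the subgradient as small as the square root of the residual.\<close>

lemma cbrt_multiplier_bound:
  fixes l w :: "real^'k"
  assumes w: "norm w \<le> q" and q: "q \<le> Q" and l: "norm l \<le> b"
  shows "norm (\<chi> i. - 3 * l $ i * (cbrt_vec w $ i)\<^sup>2) \<le> real CARD('k) * (3 * b * sqrt (1 + Q)) * sqrt q"
proof -
  have b: "0 \<le> b" using l norm_ge_zero order_trans by blast
  have q0: "0 \<le> q" using w norm_ge_zero order_trans by blast
  have "\<bar>(\<chi> i. - 3 * l $ i * (cbrt_vec w $ i)\<^sup>2) $ i\<bar> \<le> 3 * b * sqrt (1 + Q) * sqrt q" for i
  proof -
    define r where "r = \<bar>cbrt_vec w $ i\<bar>"
    have r0: "0 \<le> r" by (simp add: r_def)
    have "r ^ 3 = \<bar>w $ i\<bar>"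
      unfolding r_def power_abs[symmetric] cbrt_vec_cube ..
    then have r3: "r ^ 3 \<le> q" using component_le_norm_cart[of w i] w by linarith
    \<comment> \<open>Splitting \<open>r\<^sup>2\<close> as \<open>sqrt (r ^ 3 * r)\<close> needs a
      crude bound on the second factor; the first one supplies \<open>sqrt q\<close>.\<close>
    have r1: "r \<le> 1 + Q"
    proof (cases "r \<le> 1")
      case False
      then have "r ^ 1 \<le> r ^ 3" by (intro power_increasing) auto
      then show ?thesis using r3 q by simp
    qed (use q0 q in auto)
    have "r\<^sup>2 = sqrt (r ^ 3 * r)"
      using r0 by (simp flip: power_Suc2 add: real_sqrt_unique[of "r\<^sup>2"] power_mult[symmetric])
    also have "\<dots> \<le> sqrt (q * (1 + Q))"
      using r3 r1 r0 q0 by (intro real_sqrt_le_mono mult_mono) auto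
    finally have r2: "r\<^sup>2 \<le> sqrt (1 + Q) * sqrt q" by (simp add: real_sqrt_mult mult.commute)
    have "\<bar>l $ i\<bar> \<le> b" using component_le_norm_cart[of l i] l by linarith
    then have "\<bar>l $ i\<bar> * r\<^sup>2 \<le> b * (sqrt (1 + Q) * sqrt q)"
      using r2 b by (intro mult_mono) auto
    then show ?thesis by (simp add: abs_mult r_def)
  qed
  then have "(\<Sum>i\<in>UNIV. \<bar>(\<chi> i. - 3 * l $ i * (cbrt_vec w $ i)\<^sup>2) $ i\<bar>)
      \<le> of_nat (card (UNIV :: 'k set)) * (3 * b * sqrt (1 + Q) * sqrt q)"
    by (intro sum_bounded_above)
  then show ?thesis
    using norm_le_l1_cart[of "\<chi> i. - 3 * l $ i * (cbrt_vec w $ i)\<^sup>2"] by simp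
qed

lemma norm_tuple5_le: "norm (a, b, c, p, q) \<le> norm a + norm b + norm c + norm p + norm q"
  using norm_Pair_le[of a "(b, c, p, q)"] norm_Pair_le[of b "(c, p, q)"] norm_Pair_le[of c "(p, q)"]
    norm_Pair_le[of p q] by linarith

text \<open>Replacing the moving Jacobian by the one at the limit costs
  \<open>L * norm (u k - a) * norm (l k)\<close>, which vanishes because \<open>l\<close> converges
  and is therefore bounded.\<close>

lemma tendsto_transpose_jacobian_mult:
  assumes L: "jacobian_lipschitz L F" and u: "u \<longlonglongrightarrow> a" and l: "l \<longlonglongrightarrow> m"
  shows "(\<lambda>k. transpose (jacobian F (at (u k))) *v l k) \<longlonglongrightarrow> transpose (jacobian F (at a)) *v m"
proof -
  have "(\<lambda>k. L * norm (u k - a) * norm (l k)) \<longlonglongrightarrow> L * 0 * norm m"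
    using u l by (intro tendsto_intros tendsto_norm_zero) (simp_all add: LIM_zero)
  then have "(\<lambda>k. L * norm (u k - a) * norm (l k)) \<longlonglongrightarrow> 0" by simp
  then have "(\<lambda>k. transpose (jacobian F (at (u k))) *v l k - transpose (jacobian F (at a)) *v l k) \<longlonglongrightarrow> 0"
    by (rule Lim_null_comparison[rotated]) (intro always_eventually allI norm_transpose_jacobian_diff[OF L])
  moreover have "(\<lambda>k. transpose (jacobian F (at a)) *v l k) \<longlonglongrightarrow> transpose (jacobian F (at a)) *v m"
    using bounded_linear.tendsto[OF matrix_vector_mul_bounded_linear l] .
  ultimately show ?thesis
    using tendsto_add by fastforce
qed

context fsipl_run_regime
begin

section \<open>Descent of the merit function\<close>

abbreviation Jh :: "real^'a \<Rightarrow> real^'a^'c" where "Jh z \<equiv> jacobian h (at z)"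
abbreviation JA :: "real^'a \<Rightarrow> real^'a^'b" where "JA z \<equiv> jacobian A (at z)"
abbreviation z :: "nat \<Rightarrow> real^'b" where "z k \<equiv> prox (t k) g (A (x k) + t k *\<^sub>R mu k)"
abbreviation \<zeta> :: "nat \<Rightarrow> real^'b" where "\<zeta> k \<equiv> mu k - (1 / t k) *\<^sub>R v k"

section \<open>Signs of the constants and bounds on the tube\<close>

lemma t_bounds: "0 < t k" "tmin \<le> t k" "t k \<le> tmax"
  using t_choice[of k] t_range by auto

lemma lg_nonneg: "0 \<le> lg"
  using g_lipschitz by (rule lipschitz_on_nonneg)

lemma Lf_nonneg: "0 \<le> Lf"
  using f_lipschitz by (rule lipschitz_on_nonneg)

lemma LA_nonneg: "0 \<le> LA"
  using A_lipschitz by (rule jacobian_lipschitz_nonneg)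

lemma C2_pos: "0 < C2"
  using C1_pos C1_le_C2 by simp

lemma A_differentiable: "A differentiable (at w)"
  using A_C1 by (rule C1_on_imp_differentiable)

lemma h_has_derivative: "(h has_derivative (\<lambda>e. Jh w *v e)) (at w)"
  using h_differentiable jacobian_works by blast

lemma A_has_derivative: "(A has_derivative (\<lambda>e. JA w *v e)) (at w)"
  using A_differentiable jacobian_works by blast

lemma f_gderiv: "GDERIV f w :> grad f w"
  using f_C1 by (intro GDERIV_grad C1_on_imp_differentiable)

lemma in_tube_of_h: "norm (h w) \<le> \<theta> / \<kappa> \<Longrightarrow> w \<in> tube M \<theta>"
  using error_bound[of w] \<kappa>_pos unfolding tube_def by (simp add: field_simps)

lemma in_double_tube:
  assumes "norm (h w) \<le> \<theta> / \<kappa>" "norm (w' - w) \<le> \<theta>"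
  shows "w' \<in> tube M (2 * \<theta>)"
  using in_tube_of_h[OF assms(1)] infdist_triangle[of w' M w] assms(2)
  unfolding tube_def by (simp add: dist_norm)

lemma h_iterate_le: "norm (h (x k)) \<le> \<theta> / \<kappa>"
proof (cases k)
  case 0
  then show ?thesis using x_init M_eq \<theta>_pos \<kappa>_pos by simp
next
  case (Suc j)
  then show ?thesis using inner_loop[of j] unfolding inner_loop_def acceptable_def by auto
qed

lemma iterate_in_tube: "x k \<in> tube M (2 * \<theta>)"
  using in_double_tube[OF h_iterate_le[of k], of "x k"] \<theta>_pos by simp

lemma Jh_transpose_bounds:
  assumes "w \<in> tube M (2 * \<theta>)"
  shows "C1 * (norm u)\<^sup>2 \<le> (norm (transpose (Jh w) *v u))\<^sup>2"
    and "(norm (transpose (Jh w) *v u))\<^sup>2 \<le> C2 * (norm u)\<^sup>2"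
    and "norm (transpose (Jh w) *v u) \<le> sqrt C2 * norm u"
proof -
  show "C1 * (norm u)\<^sup>2 \<le> (norm (transpose (Jh w) *v u))\<^sup>2"
    and *: "(norm (transpose (Jh w) *v u))\<^sup>2 \<le> C2 * (norm u)\<^sup>2"
    using gram_eigenvalue_bounds[of "Jh w"] h_eigenvalues[OF assms] by blast+
  then show "norm (transpose (Jh w) *v u) \<le> sqrt C2 * norm u"
    using real_sqrt_le_mono[OF *] by (simp add: real_sqrt_mult)
qed

lemma JA_bounds:
  assumes "w \<in> tube M (2 * \<theta>)"
  shows "norm (JA w *v e) \<le> lA * norm e" "norm (transpose (JA w) *v u) \<le> lA * norm u"
  using norm_mult_le_spectral_norm[of "JA w" e] norm_transpose_mult_le_spectral_norm[of "JA w" u]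
    mult_right_mono[OF A_bound[OF assms] norm_ge_zero[of e]]
    mult_right_mono[OF A_bound[OF assms] norm_ge_zero[of u]] by linarith+

text \<open>In the second component the chain-rule factor \<open>t k\<close> cancels the
  \<open>1 / t k\<close> in the gradient of the envelope, and the gradient of the quadratic term in
  \<open>m\<close> cancels the shift by \<open>t k *\<^sub>R m\<close>, leaving the proximal point
  minus \<open>A (x k)\<close>.\<close>

lemma gderiv_G:
  "GDERIV (G k) (l, m) :>
    (t k *\<^sub>R (Jh (x k) *v (grad f (x k) + transpose (Jh (x k)) *v l + transpose (JA (x k)) *v m)),
     t k *\<^sub>R (JA (x k) *v (grad f (x k) + transpose (Jh (x k)) *v l + transpose (JA (x k)) *v m))
       + prox (t k) g (A (x k) + t k *\<^sub>R m) - A (x k))"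
proof -
  let ?r = "\<lambda>w. grad f (x k) + transpose (Jh (x k)) *v fst w + transpose (JA (x k)) *v snd w"
  let ?q = "A (x k) + t k *\<^sub>R m"
  have G_eq: "G k = (\<lambda>w. t k / 2 * (?r w \<bullet> ?r w) + t k / 2 * (snd w \<bullet> snd w)
      - moreau (t k) g (A (x k) + t k *\<^sub>R snd w))"
    by (auto simp: G_def power2_norm_eq_inner)
  have mv: "((\<lambda>w. B *v F w) has_derivative (\<lambda>e. B *v F' e)) (at a)"
    if "(F has_derivative F') (at a)" for B :: "real^'i^'j" and F :: "'k::real_normed_vector \<Rightarrow> _" and F' a
    using bounded_linear.has_derivative[OF matrix_vector_mul_bounded_linear that] .
  have mor: "((\<lambda>w. moreau (t k) g (A (x k) + t k *\<^sub>R snd w)) has_derivative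
      (\<lambda>e. (t k *\<^sub>R snd e) \<bullet> ((1 / t k) *\<^sub>R (?q - prox (t k) g ?q)))) (at (l, m))"
    using GDERIV_moreau[OF g_convex g_lipschitz t_bounds(1)[of k], of ?q] unfolding gderiv_def
    by (intro has_derivative_compose[where f="\<lambda>w. A (x k) + t k *\<^sub>R snd w" and g="moreau (t k) g"])
       (auto intro!: derivative_eq_intros)
  define R where "R = ?r (l, m)"
  let ?r' = "\<lambda>e. transpose (Jh (x k)) *v fst e + transpose (JA (x k)) *v snd e"
  have r: "(?r has_derivative ?r') (at (l, m))"
    by (auto intro!: derivative_eq_intros mv)
  have rr: "((\<lambda>w. t k / 2 * (?r w \<bullet> ?r w)) has_derivative (\<lambda>e. t k * (?r' e \<bullet> R))) (at (l, m))"
    by (rule has_derivative_eq_rhs[OF has_derivative_mult_right[OF has_derivative_inner[OF r r]]])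
       (simp add: fun_eq_iff R_def inner_commute)
  have mm: "((\<lambda>w. t k / 2 * (snd w \<bullet> snd w)) has_derivative (\<lambda>e. t k * (snd e \<bullet> m))) (at (l, m))"
    by (auto intro!: derivative_eq_intros simp: inner_commute)
  have "t k * (?r' e \<bullet> R) + t k * (snd e \<bullet> m)
        - (t k *\<^sub>R snd e) \<bullet> ((1 / t k) *\<^sub>R (?q - prox (t k) g ?q))
      = e \<bullet> (t k *\<^sub>R (Jh (x k) *v R), t k *\<^sub>R (JA (x k) *v R) + prox (t k) g ?q - A (x k))" for e
    using t_bounds(1)[of k]
    by (cases e) (simp add: inner_transpose_mult inner_add_left inner_add_right inner_diff_right field_simps)
  then show ?thesis
    using has_derivative_diff[OF has_derivative_add[OF rr mm] mor]
    unfolding gderiv_def G_eq R_def by simp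
qed

text \<open>At the computed multipliers the gradient of \<open>G k\<close> is the pair of
  \<open>- (Jh (x k) *v d k)\<close> and \<open>v k - JA (x k) *v d k\<close>; the stopping test is
  thus a bound on the two linearized residuals.\<close>

lemma dual_residual:
  shows "norm (Jh (x k) *v d k) \<le> \<Delta> k" "norm (v k - JA (x k) *v d k) \<le> \<Delta> k"
proof -
  have "grad (G k) (lam k, mu k) = (- (Jh (x k) *v d k), v k - JA (x k) *v d k)"
    using grad_eqI[OF gderiv_G] by (simp add: d_def v_def matrix_vector_mult_scaleR
      linear_neg[OF matrix_vector_mul_linear])
  then show "norm (Jh (x k) *v d k) \<le> \<Delta> k" "norm (v k - JA (x k) *v d k) \<le> \<Delta> k"
    using dual_inexact[of k] norm_fst_le[of "- (Jh (x k) *v d k)" "v k - JA (x k) *v d k"]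
      norm_snd_le[of "v k - JA (x k) *v d k" "- (Jh (x k) *v d k)"] by auto
qed

text \<open>\<open>\<zeta> k\<close> is the optimality subgradient of the proximal problem,
  rewritten through \<open>mu k\<close> and \<open>v k\<close>. It differs from \<open>mu k\<close>
  by a multiple of \<open>v k\<close>, so that \<open>mu k\<close> is asymptotically a subgradient
  of \<open>g\<close>.\<close>

lemma \<zeta>_subgradient: "g (z k) + \<zeta> k \<bullet> (u - z k) \<le> g u"
proof -
  have "(1 / t k) *\<^sub>R (A (x k) + t k *\<^sub>R mu k - z k) = \<zeta> k"
    using t_bounds(1)[of k] by (simp add: v_def algebra_simps)
  then show ?thesis
    using prox_subgradient[OF g_convex g_lipschitz t_bounds(1)] by metis
qed

lemma norm_\<zeta>: "norm (\<zeta> k) \<le> lg"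
  using \<zeta>_subgradient by (rule subgradient_norm_le[OF g_lipschitz])

lemma \<Delta>_nonneg: "0 \<le> \<Delta> k" and \<Delta>_le: "\<Delta> k \<le> \<Delta>bar"
  using \<Delta>_choice[of k] by auto

text \<open>\<open>mu_max\<close> and \<open>lam_max\<close> are the bounds of the individual
  iteration with \<open>\<Delta> k / t k\<close> replaced by its largest possible value
  \<open>\<Delta>bar / tmin\<close>.\<close>

lemma
  shows norm_d: "norm (d k) \<le> t k * (2 * lf + lg) + ((lA + 1) / sqrt C1 + 1) * \<Delta> k"
    and norm_mu_le: "norm (mu k) \<le> mu_max"
    and norm_lam_le: "norm (lam k) \<le> lam_max"
proof -
  note bounds = dual_residual_bounds[OF d_def t_bounds(1) C1_pos less_imp_le[OF lf_pos] lg_nonneg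
    less_imp_le[OF lA_pos], where v="v k" and \<Delta>="\<Delta> k"]
  note bounds' = bounds[of k, OF _ f_bound, OF _ iterate_in_tube,
    OF Jh_transpose_bounds(1) JA_bounds dual_residual norm_\<zeta>, OF iterate_in_tube iterate_in_tube iterate_in_tube]
  show "norm (d k) \<le> t k * (2 * lf + lg) + ((lA + 1) / sqrt C1 + 1) * \<Delta> k"
    by (rule bounds')
  have q: "\<Delta> k / t k \<le> \<Delta>bar / tmin"
    using \<Delta>_le \<Delta>_nonneg t_bounds t_range bar_pos by (intro frac_le) auto
  have c: "0 \<le> (lA + 1) / sqrt C1 + 1"
    using lA_pos C1_pos by (intro add_nonneg_nonneg divide_nonneg_nonneg) auto
  have "norm (mu k) \<le> lf + 3 * lg + ((lA + 1) / sqrt C1 + 1) * (\<Delta> k / t k)"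
    by (rule bounds')
  then show "norm (mu k) \<le> mu_max"
    unfolding mu_max_def using mult_left_mono[OF q c] by linarith
  have "norm (lam k) \<le> 1 / sqrt C1 * ((3 + lA) * lf + (3 * lA + 1) * lg
      + ((lA + 1) / sqrt C1 + 1) * ((lA + 1) * \<Delta> k / t k))"
    by (rule bounds')
  also have "\<dots> \<le> lam_max"
    unfolding lam_max_def using q c lA_pos C1_pos
    by (intro mult_left_mono add_left_mono) (auto simp: mult_left_mono simp flip: times_divide_eq_right)
  finally show "norm (lam k) \<le> lam_max" .
qed

text \<open>The first entry of the minimum in \<open>\<eta>hat2\<close> is \<open>\<theta>\<close>
  over the bound for \<open>norm (d k)\<close>; that it is at least 1 says that the full tangential
  step stays in the doubled tube.\<close>

lemma norm_d_le: "norm (d k) \<le> \<theta>"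
proof -
  define D where "D = t k * (2 * lf + lg) + ((lA + 1) / sqrt C1 + 1) * \<Delta> k"
  have "0 < D"
    unfolding D_def using t_bounds(1)[of k] lf_pos lg_nonneg lA_pos C1_pos \<Delta>_nonneg[of k]
    by (intro add_pos_nonneg mult_pos_pos mult_nonneg_nonneg) auto
  moreover have "1 \<le> \<theta> / D"
    using \<eta>hat2_regime[of k] unfolding \<eta>hat2_def D_def by simp
  ultimately have "D \<le> \<theta>" by (simp add: field_simps)
  then show ?thesis using norm_d[of k] by (simp add: D_def)
qed

lemma tangential_point_in_tube: "x k + d k \<in> tube M (2 * \<theta>)"
  using norm_d_le[of k] by (intro in_double_tube[OF h_iterate_le[of k]]) auto

lemma A_linearization:
  "norm (A (x k + d k) - A (x k) - JA (x k) *v d k) \<le> LA / 2 * (norm (d k))\<^sup>2"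
  using linearization_error[OF A_differentiable A_lipschitz, of "x k + d k" "x k"] by simp

lemma step_size_bound: "t k * (Lf + lg * LA + \<alpha> * Lh + \<sigma>) \<le> 1"
proof -
  have "0 < Lf + lg * LA + \<alpha> * Lh + \<sigma>"
    using Lf_nonneg lg_nonneg LA_nonneg \<alpha>_pos Lh_pos \<sigma>_pos
    by (intro add_nonneg_pos add_nonneg_nonneg mult_nonneg_nonneg) auto
  then show ?thesis
    using t_regime[of k] by (simp add: field_simps)
qed

text \<open>\<open>g (A (x k + d k))\<close> is compared with \<open>g (z k)\<close>, where a
  subgradient is known. The curvature terms of \<open>f\<close>, \<open>A\<close> and
  \<open>h\<close> add up to \<open>L / 2\<close> times \<open>(norm (d k))\<^sup>2\<close>, and the
  step size bound lets the term \<open>(norm (d k))\<^sup>2 / t k\<close> absorb them with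
  \<open>\<sigma> / 2\<close> to spare.\<close>

lemma tangential_descent:
  "\<Phi> (x k + d k) \<le> \<Phi> (x k) - \<sigma> / 2 * (norm (d k))\<^sup>2 - 1 / (2 * t k) * (norm (v k))\<^sup>2
    + (\<alpha> + lg + norm (lam k) + norm (mu k)) * \<Delta> k"
proof -
  let ?x = "x k" and ?d = "d k" and ?c = "grad f (x k)"
  have t: "0 < t k" by (rule t_bounds)
  have f_step: "f (?x + ?d) \<le> f ?x + ?c \<bullet> ?d + Lf / 2 * (norm ?d)\<^sup>2"
    using gradient_descent_inequality[OF f_gderiv, of ?x Lf "?x + ?d"] f_lipschitz
    by (auto simp: lipschitz_on_def dist_norm)
  have Az: "norm (A (?x + ?d) - z k) \<le> LA / 2 * (norm ?d)\<^sup>2 + \<Delta> k"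
  proof -
    have "A (?x + ?d) - z k = (A (?x + ?d) - A ?x - JA ?x *v ?d) - (v k - JA ?x *v ?d)"
      by (simp add: v_def)
    then have "norm (A (?x + ?d) - z k) = norm ((A (?x + ?d) - A ?x - JA ?x *v ?d) - (v k - JA ?x *v ?d))"
      by (rule arg_cong)
    then show ?thesis
      using norm_triangle_ineq4[of "A (?x + ?d) - A ?x - JA ?x *v ?d" "v k - JA ?x *v ?d"]
        A_linearization[of k] dual_residual(2)[of k] by linarith
  qed
  have g_step: "g (A (?x + ?d)) \<le> g (z k) + lg * (LA / 2 * (norm ?d)\<^sup>2 + \<Delta> k)"
  proof -
    have "g (A (?x + ?d)) - g (z k) \<le> lg * norm (A (?x + ?d) - z k)"
      using lipschitz_onD[OF g_lipschitz, of "A (?x + ?d)" "z k"] by (simp add: dist_norm)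
    then show ?thesis using mult_left_mono[OF Az lg_nonneg] by linarith
  qed
  have gz: "g (z k) \<le> g (A ?x) + \<zeta> k \<bullet> v k"
    using \<zeta>_subgradient[of k "A ?x"] by (simp add: v_def inner_diff_right)
  have h_step: "norm (h (?x + ?d)) \<le> norm (h ?x) + \<Delta> k + Lh / 2 * (norm ?d)\<^sup>2"
  proof -
    have "norm (h (?x + ?d)) \<le> norm (h ?x) + norm (h (?x + ?d) - h ?x - Jh ?x *v ?d) + norm (Jh ?x *v ?d)"
      using norm_triangle_ineq[of "h ?x + (h (?x + ?d) - h ?x - Jh ?x *v ?d)" "Jh ?x *v ?d"]
        norm_triangle_ineq[of "h ?x" "h (?x + ?d) - h ?x - Jh ?x *v ?d"] by simp
    then show ?thesis
      using linearization_error[OF h_differentiable h_lipschitz, of "?x + ?d" ?x] dual_residual(1)[of k] by simp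
  qed
  \<comment> \<open>With the gradient of \<open>f\<close> eliminated through the definition of
    \<open>d\<close>, \<open>lam k\<close> meets only \<open>Jh *v d\<close> and \<open>mu k\<close>
    only \<open>v - JA *v d\<close>, both of size \<open>\<Delta> k\<close>.\<close>
  have key: "?c \<bullet> ?d + \<zeta> k \<bullet> v k \<le> - ((norm ?d)\<^sup>2 / t k) - (norm (v k))\<^sup>2 / t k
      + (norm (lam k) + norm (mu k)) * \<Delta> k"
  proof -
    have "?c = - (1 / t k) *\<^sub>R ?d - transpose (Jh ?x) *v lam k - transpose (JA ?x) *v mu k"
      using t by (simp add: d_def algebra_simps)
    then have "?c \<bullet> ?d = (- (1 / t k) *\<^sub>R ?d - transpose (Jh ?x) *v lam k - transpose (JA ?x) *v mu k) \<bullet> ?d"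
      by (rule arg_cong)
    then have 1: "?c \<bullet> ?d = - (norm ?d)\<^sup>2 / t k - lam k \<bullet> (Jh ?x *v ?d) - mu k \<bullet> (JA ?x *v ?d)"
      by (simp add: inner_diff_left inner_transpose_mult power2_norm_eq_inner)
    have 2: "\<zeta> k \<bullet> v k = mu k \<bullet> v k - (norm (v k))\<^sup>2 / t k"
      by (simp add: inner_diff_left power2_norm_eq_inner)
    have 3: "- (lam k \<bullet> (Jh ?x *v ?d)) \<le> norm (lam k) * \<Delta> k"
      using norm_cauchy_schwarz[of "- lam k" "Jh ?x *v ?d"]
        mult_left_mono[OF dual_residual(1)[of k] norm_ge_zero[of "lam k"]] by simp
    have 4: "mu k \<bullet> (v k - JA ?x *v ?d) \<le> norm (mu k) * \<Delta> k"
      using norm_cauchy_schwarz[of "mu k" "v k - JA ?x *v ?d"]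
        mult_left_mono[OF dual_residual(2)[of k] norm_ge_zero[of "mu k"]] by linarith
    show ?thesis
      using 3 4 unfolding 1 2 by (simp add: inner_diff_right algebra_simps add_divide_distrib)
  qed
  define L where "L = Lf + lg * LA + \<alpha> * Lh"
  have "L / 2 * (norm ?d)\<^sup>2 \<le> (norm ?d)\<^sup>2 / t k - \<sigma> / 2 * (norm ?d)\<^sup>2"
  proof -
    have "(L + \<sigma>) / 2 \<le> 1 / t k"
      using step_size_bound[of k] t zero_le_square[of "1"] unfolding L_def
      by (simp add: field_simps)
    then have "(L + \<sigma>) / 2 * (norm ?d)\<^sup>2 \<le> 1 / t k * (norm ?d)\<^sup>2"
      by (rule mult_right_mono) simp
    then show ?thesis by (simp add: field_simps)
  qed
  moreover have "- ((norm (v k))\<^sup>2 / t k) \<le> - (1 / (2 * t k) * (norm (v k))\<^sup>2)"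
    using t by (simp add: field_simps)
  moreover have "\<alpha> * norm (h (?x + ?d)) \<le> \<alpha> * (norm (h ?x) + \<Delta> k + Lh / 2 * (norm ?d)\<^sup>2)"
    using h_step \<alpha>_pos by (intro mult_left_mono) auto
  ultimately show ?thesis
    using f_step g_step gz key unfolding \<Phi>_def F_def L_def
    by (simp add: algebra_simps add_divide_distrib)
qed

section \<open>The normal step\<close>

lemma F_segment_lipschitz:
  assumes seg: "closed_segment w w' \<subseteq> tube M (2 * \<theta>)"
  shows "norm (A w' - A w) \<le> lA * norm (w' - w)"
    and "F w' \<le> F w + (lf + lg * lA) * norm (w' - w)"
proof -
  show A: "norm (A w' - A w) \<le> lA * norm (w' - w)"
    using A_has_derivative JA_bounds(1) seg lA_pos
    by (intro segment_lipschitz[where F'="\<lambda>u e. JA u *v e"]) auto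
  have "norm (f w' - f w) \<le> lf * norm (w' - w)"
  proof (rule segment_lipschitz[where F'="\<lambda>u e. e \<bullet> grad f u"])
    show "(f has_derivative (\<lambda>e. e \<bullet> grad f u)) (at u)" for u
      using f_gderiv unfolding gderiv_def .
    show "norm (e \<bullet> grad f u) \<le> lf * norm e" if "u \<in> closed_segment w w'" for u e
    proof -
      have "norm (e \<bullet> grad f u) \<le> norm e * norm (grad f u)"
        using Cauchy_Schwarz_ineq2 by simp
      also have "\<dots> \<le> norm e * lf"
        using f_bound that seg by (intro mult_left_mono) auto
      finally show ?thesis by (simp add: mult.commute)
    qed
  qed (use lf_pos in simp)
  moreover have "g (A w') - g (A w) \<le> lg * norm (A w' - A w)"
    using lipschitz_onD[OF g_lipschitz, of "A w'" "A w"] by (simp add: dist_norm)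
  moreover have "lg * norm (A w' - A w) \<le> lg * (lA * norm (w' - w))"
    using A lg_nonneg by (rule mult_left_mono)
  ultimately show "F w' \<le> F w + (lf + lg * lA) * norm (w' - w)"
    unfolding F_def by (simp add: algebra_simps abs_le_iff)
qed

lemma grad_N: "grad N w = transpose (Jh w) *v h w"
proof (rule grad_eqI)
  have "((\<lambda>w. 1 / 2 * (h w \<bullet> h w)) has_derivative (\<lambda>e. e \<bullet> (transpose (Jh w) *v h w))) (at w)"
    by (rule has_derivative_eq_rhs[OF has_derivative_mult_right[OF
          has_derivative_inner[OF h_has_derivative h_has_derivative]]])
       (simp add: fun_eq_iff inner_commute[of _ "transpose (Jh w) *v h w"] inner_transpose_mult
          inner_commute[of "Jh w *v _"])
  then show "GDERIV N w :> transpose (Jh w) *v h w"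
    unfolding gderiv_def N_def power2_norm_eq_inner .
qed

text \<open>The inequalities are the roles of \<open>\<tau>hat2\<close>: semidefiniteness of
  \<open>I - \<tau>bar J J^T\<close>, linear decrease of \<open>norm (h w)\<close> outweighing the
  curvature of \<open>h\<close>, the gain in the penalty outweighing the growth of \<open>F\<close>,
  and comparability with \<open>\<tau>hat\<close> for the projection case.\<close>

lemma normal_step_size:
  shows "\<tau>bar * C2 \<le> 1"
    and "Lh / 2 * \<tau>bar * C2 * (\<theta> / \<kappa>) \<le> C1"
    and "\<tau>bar / 2 * (\<alpha> * Lh * C2 * (\<theta> / \<kappa>) + \<sigma>) \<le> \<alpha> * C1 - M1"
    and "\<tau>bar \<le> \<tau>hat"
proof -
  show "\<tau>bar \<le> \<tau>hat" using \<tau>bar_regime unfolding \<tau>hat2_def by simp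
  then show "\<tau>bar * C2 \<le> 1" "Lh / 2 * \<tau>bar * C2 * (\<theta> / \<kappa>) \<le> C1"
    using C2_pos Lh_pos \<theta>_pos \<kappa>_pos unfolding \<tau>hat_def by (simp_all add: field_simps)
  have "0 < \<alpha> * Lh * C2 * \<theta> / \<kappa> + \<sigma>"
    using \<alpha>_pos C2_pos Lh_pos \<theta>_pos \<kappa>_pos \<sigma>_pos by (intro add_pos_pos divide_pos_pos mult_pos_pos)
  moreover have "\<tau>bar \<le> 2 * (\<alpha> * C1 - M1) / (\<alpha> * Lh * C2 * \<theta> / \<kappa> + \<sigma>)"
    using \<tau>bar_regime unfolding \<tau>hat2_def by simp
  ultimately have "\<tau>bar * (\<alpha> * Lh * C2 * \<theta> / \<kappa> + \<sigma>) \<le> 2 * (\<alpha> * C1 - M1)"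
    by (simp only: pos_le_divide_eq)
  then show "\<tau>bar / 2 * (\<alpha> * Lh * C2 * (\<theta> / \<kappa>) + \<sigma>) \<le> \<alpha> * C1 - M1"
    by simp
qed

text \<open>The linear part contracts by \<open>1 - s * C1\<close>, and the quadratic error is made
  linear in both \<open>s\<close> and \<open>norm (h w)\<close> by bounding one factor of each. All
  steps up to \<open>\<tau>bar\<close> are covered, since every point between \<open>w\<close> and
  the trial point must be kept in the tube.\<close>

lemma gradient_step_residual:
  assumes hw: "norm (h w) \<le> \<theta> / \<kappa>" and s: "0 \<le> s" "s \<le> \<tau>bar"
  shows "norm (h (w - s *\<^sub>R grad N w)) \<le> (1 - s * C1 + Lh / 2 * s * \<tau>bar * C2 * (\<theta> / \<kappa>)) * norm (h w)"
    and "norm (h (w - s *\<^sub>R grad N w)) \<le> norm (h w)"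
proof -
  have w: "w \<in> tube M (2 * \<theta>)" using in_double_tube[OF hw, of w] \<theta>_pos by simp
  let ?e = "w - s *\<^sub>R grad N w"
  have "s * C2 \<le> 1"
    using mult_right_mono[OF s(2) less_imp_le[OF C2_pos]] normal_step_size(1) by linarith
  then have lin: "norm (h w - s *\<^sub>R (Jh w *v grad N w)) \<le> (1 - s * C1) * norm (h w)"
    unfolding grad_N using s by (intro gradient_step_contraction[OF Jh_transpose_bounds(1)[OF w] Jh_transpose_bounds(2)[OF w]])
  have err: "norm (h ?e - h w + s *\<^sub>R (Jh w *v grad N w)) \<le> Lh / 2 * (s\<^sup>2 * (norm (grad N w))\<^sup>2)"
    using linearization_error[OF h_differentiable h_lipschitz, of ?e w]
    by (simp add: matrix_vector_mult_scaleR linear_neg[OF matrix_vector_mul_linear] power_mult_distrib)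
  have "s\<^sup>2 * (norm (grad N w))\<^sup>2 \<le> s * \<tau>bar * (C2 * (\<theta> / \<kappa> * norm (h w)))"
  proof (intro mult_mono)
    show "s\<^sup>2 \<le> s * \<tau>bar" using s by (simp add: power2_eq_square mult_left_mono)
    have "(norm (grad N w))\<^sup>2 \<le> C2 * (norm (h w))\<^sup>2"
      unfolding grad_N by (rule Jh_transpose_bounds(2)[OF w])
    also have "\<dots> \<le> C2 * (\<theta> / \<kappa> * norm (h w))"
      unfolding power2_eq_square using hw C2_pos by (intro mult_left_mono mult_right_mono) auto
    finally show "(norm (grad N w))\<^sup>2 \<le> C2 * (\<theta> / \<kappa> * norm (h w))" .
  qed (use s in auto)
  then have "Lh / 2 * (s\<^sup>2 * (norm (grad N w))\<^sup>2) \<le> Lh / 2 * (s * \<tau>bar * (C2 * (\<theta> / \<kappa> * norm (h w))))"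
    using Lh_pos by (intro mult_left_mono) auto
  moreover have "norm (h ?e) \<le> norm (h ?e - h w + s *\<^sub>R (Jh w *v grad N w)) + norm (h w - s *\<^sub>R (Jh w *v grad N w))"
    using norm_triangle_ineq[of "h ?e - h w + s *\<^sub>R (Jh w *v grad N w)" "h w - s *\<^sub>R (Jh w *v grad N w)"] by simp
  moreover have "(1 - s * C1 + Lh / 2 * s * \<tau>bar * C2 * (\<theta> / \<kappa>)) * norm (h w)
      = (1 - s * C1) * norm (h w) + Lh / 2 * (s * \<tau>bar * (C2 * (\<theta> / \<kappa> * norm (h w))))"
    by (simp add: algebra_simps)
  ultimately show *: "norm (h ?e) \<le> (1 - s * C1 + Lh / 2 * s * \<tau>bar * C2 * (\<theta> / \<kappa>)) * norm (h w)"
    using lin err by linarith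
  have "s * (Lh / 2 * \<tau>bar * C2 * (\<theta> / \<kappa>)) \<le> s * C1"
    using s by (intro mult_left_mono normal_step_size(2))
  then have "(1 - s * C1 + Lh / 2 * s * \<tau>bar * C2 * (\<theta> / \<kappa>)) * norm (h w) \<le> 1 * norm (h w)"
    by (intro mult_right_mono) (auto simp: algebra_simps)
  then show "norm (h ?e) \<le> norm (h w)" using * by simp
qed

definition normal_const :: real where
  "normal_const = max \<kappa> (\<tau>bar * sqrt C2)"

lemma normal_const_pos: "0 < normal_const"
  using \<kappa>_pos by (simp add: normal_const_def)

text \<open>In the gradient case \<open>F\<close> grows by at most
  \<open>\<tau>bar * M1 * norm (h w)\<close> while the penalty decreases proportionally to
  \<open>\<alpha> * C1\<close>. In the projection case \<open>F\<close> grows by at most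
  \<open>M2 * norm (h w)\<close> while the penalty \<open>\<alpha> * norm (h w)\<close> disappears
  altogether.\<close>

lemma normal_step:
  assumes w: "w \<in> tube M (2 * \<theta>)"
    and xh: "if norm (h w) \<le> \<theta> / \<kappa> then xh = w - \<tau>bar *\<^sub>R grad N w
      else xh \<in> M \<and> dist w xh = infdist w M"
  shows "norm (h xh) \<le> norm (h w)" "norm (h xh) \<le> \<theta> / \<kappa>"
    and "\<Phi> xh \<le> \<Phi> w - \<sigma> / 2 * (\<tau>bar\<^sup>2 * norm (h w))"
    and "norm (xh - w) \<le> normal_const * norm (h w)"
    and "norm (A xh - A w) \<le> lA * norm (xh - w)"
proof -
  have "norm (h xh) \<le> norm (h w) \<and> norm (h xh) \<le> \<theta> / \<kappa>
      \<and> \<Phi> xh \<le> \<Phi> w - \<sigma> / 2 * (\<tau>bar\<^sup>2 * norm (h w))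
      \<and> norm (xh - w) \<le> normal_const * norm (h w)
      \<and> norm (A xh - A w) \<le> lA * norm (xh - w)"
  proof (cases "norm (h w) \<le> \<theta> / \<kappa>")
    case True
    then have xh: "xh = w - \<tau>bar *\<^sub>R grad N w" using assms by simp
    have hxh: "norm (h xh) \<le> (1 - \<tau>bar * C1 + Lh / 2 * \<tau>bar * \<tau>bar * C2 * (\<theta> / \<kappa>)) * norm (h w)"
        "norm (h xh) \<le> norm (h w)"
      using gradient_step_residual[OF True, of \<tau>bar] bar_pos unfolding xh by auto
    \<comment> \<open>Each point of the segment is itself a shorter gradient step, whose residual is
      no larger than that at \<open>w\<close>.\<close>
    have seg: "closed_segment w xh \<subseteq> tube M (2 * \<theta>)"
    proof
      fix p assume "p \<in> closed_segment w xh"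
      then obtain u where u: "0 \<le> u" "u \<le> 1" "p = (1 - u) *\<^sub>R w + u *\<^sub>R xh"
        unfolding closed_segment_def by blast
      then have p: "p = w - (u * \<tau>bar) *\<^sub>R grad N w"
        by (simp add: xh algebra_simps)
      have "norm (h p) \<le> norm (h w)"
        unfolding p using u bar_pos
        by (intro gradient_step_residual(2)[OF True]) (auto simp: mult_left_le_one_le)
      then show "p \<in> tube M (2 * \<theta>)"
        using in_double_tube[of p p] True \<theta>_pos by simp
    qed
    have step: "norm (xh - w) \<le> \<tau>bar * (sqrt C2 * norm (h w))"
      using Jh_transpose_bounds(3)[OF w, of "h w"] bar_pos by (simp add: xh grad_N)
    have coef: "0 \<le> lf + lg * lA" using lf_pos lg_nonneg lA_pos by simp
    have "F xh \<le> F w + (lf + lg * lA) * (\<tau>bar * (sqrt C2 * norm (h w)))"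
      using F_segment_lipschitz(2)[OF seg] mult_left_mono[OF step coef] by linarith
    then have F_step: "F xh \<le> F w + \<tau>bar * M1 * norm (h w)"
      by (simp add: M1_def mult_ac)
    have "\<alpha> * norm (h xh) \<le> \<alpha> * ((1 - \<tau>bar * C1 + Lh / 2 * \<tau>bar * \<tau>bar * C2 * (\<theta> / \<kappa>)) * norm (h w))"
      using hxh \<alpha>_pos by (intro mult_left_mono) auto
    moreover have "\<tau>bar * (\<tau>bar / 2 * (\<alpha> * Lh * C2 * (\<theta> / \<kappa>) + \<sigma>)) * norm (h w) \<le> \<tau>bar * (\<alpha> * C1 - M1) * norm (h w)"
      using bar_pos by (intro mult_right_mono mult_left_mono normal_step_size(3)) auto
    ultimately have "\<Phi> xh \<le> \<Phi> w - \<sigma> / 2 * (\<tau>bar\<^sup>2 * norm (h w))"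
      using F_step unfolding \<Phi>_def by (simp add: algebra_simps power2_eq_square)
    moreover have "norm (xh - w) \<le> normal_const * norm (h w)"
    proof -
      have "\<tau>bar * sqrt C2 * norm (h w) \<le> normal_const * norm (h w)"
        unfolding normal_const_def by (intro mult_right_mono) auto
      then show ?thesis using step by simp
    qed
    ultimately show ?thesis
      using hxh True F_segment_lipschitz(1)[OF seg] by simp
  next
    case False
    then have xh: "xh \<in> M" "dist w xh = infdist w M" using assms by auto
    then have h0: "h xh = 0" using M_eq by simp
    have step: "norm (xh - w) \<le> \<kappa> * norm (h w)"
      using error_bound[of w] xh by (simp add: dist_norm norm_minus_commute)
    \<comment> \<open>Each point of the segment is at least as close to \<open>xh\<close> as
      \<open>w\<close> is, and \<open>xh\<close> realizes the distance of \<open>w\<close> to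
      \<open>M\<close>.\<close>
    have seg: "closed_segment w xh \<subseteq> tube M (2 * \<theta>)"
    proof
      fix p assume p: "p \<in> closed_segment w xh"
      have "infdist p M \<le> dist p xh" using xh by (intro infdist_le)
      also have "\<dots> \<le> dist w xh"
        using segment_bound(2)[OF p] by (simp add: dist_norm norm_minus_commute)
      also have "\<dots> \<le> 2 * \<theta>" using w xh by (simp add: tube_def)
      finally show "p \<in> tube M (2 * \<theta>)" by (simp add: tube_def)
    qed
    have coef: "0 \<le> lf + lg * lA" using lf_pos lg_nonneg lA_pos by simp
    have "F xh \<le> F w + (lf + lg * lA) * (\<kappa> * norm (h w))"
      using F_segment_lipschitz(2)[OF seg] mult_left_mono[OF step coef] by linarith
    then have "\<Phi> xh \<le> \<Phi> w + (M2 - \<alpha>) * norm (h w)"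
      by (simp add: \<Phi>_def h0 M2_def algebra_simps)
    also have "(M2 - \<alpha>) * norm (h w) \<le> - (\<sigma> / 2 * \<tau>bar\<^sup>2) * norm (h w)"
    proof (rule mult_right_mono)
      have "\<tau>bar\<^sup>2 \<le> \<tau>hat\<^sup>2"
        using normal_step_size(4) bar_pos by (intro power_mono) auto
      then have "\<sigma> * \<tau>bar\<^sup>2 \<le> \<sigma> * \<tau>hat\<^sup>2" using \<sigma>_pos by simp
      then show "M2 - \<alpha> \<le> - (\<sigma> / 2 * \<tau>bar\<^sup>2)" using \<alpha>_regime by simp
    qed simp
    finally have "\<Phi> xh \<le> \<Phi> w - \<sigma> / 2 * (\<tau>bar\<^sup>2 * norm (h w))" by simp
    moreover have "norm (xh - w) \<le> normal_const * norm (h w)"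
    proof -
      have "\<kappa> * norm (h w) \<le> normal_const * norm (h w)"
        unfolding normal_const_def by (intro mult_right_mono) auto
      then show ?thesis using step by simp
    qed
    moreover have "0 \<le> \<theta> / \<kappa>" using \<theta>_pos \<kappa>_pos by simp
    ultimately show ?thesis
      using h0 F_segment_lipschitz(1)[OF seg] by simp
  qed
  then show "norm (h xh) \<le> norm (h w)" "norm (h xh) \<le> \<theta> / \<kappa>"
    "\<Phi> xh \<le> \<Phi> w - \<sigma> / 2 * (\<tau>bar\<^sup>2 * norm (h w))"
    "norm (xh - w) \<le> normal_const * norm (h w)"
    "norm (A xh - A w) \<le> lA * norm (xh - w)"
    by auto
qed

section \<open>Acceptance of the first trial\<close>

lemma first_step_sizes: "\<eta> 0 = 1" "\<tau> 0 = \<tau>bar"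
  unfolding \<eta>_def \<tau>_def using \<eta>bar_regime by simp_all

text \<open>The claim covers every trial with the initial step sizes, whichever nearest point is
  selected. The decrease is obtained from the regime and not read off the acceptance test, which is
  why it is free of \<open>\<rho> k\<close>.\<close>

lemma first_trial:
  assumes "trial k 0 yk xh"
  shows "yk = x k + d k" "yk \<in> tube M (2 * \<theta>)"
    and "if norm (h yk) \<le> \<theta> / \<kappa> then xh = yk - \<tau>bar *\<^sub>R grad N yk
      else xh \<in> M \<and> dist yk xh = infdist yk M"
    and "\<Phi> xh \<le> \<Phi> (x k) - \<sigma> / 2 * ((norm (d k))\<^sup>2 + \<tau>bar\<^sup>2 * norm (h yk))
      - 1 / (2 * t k) * (norm (v k))\<^sup>2 + (\<alpha> + lg + norm (lam k) + norm (mu k)) * \<Delta> k"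
    and "acceptable k 0 yk xh"
proof -
  show yk: "yk = x k + d k"
    and xh: "if norm (h yk) \<le> \<theta> / \<kappa> then xh = yk - \<tau>bar *\<^sub>R grad N yk
      else xh \<in> M \<and> dist yk xh = infdist yk M"
    using assms unfolding trial_def first_step_sizes scaleR_one by (simp, fast)
  show tube: "yk \<in> tube M (2 * \<theta>)"
    unfolding yk by (rule tangential_point_in_tube)
  show descent: "\<Phi> xh \<le> \<Phi> (x k) - \<sigma> / 2 * ((norm (d k))\<^sup>2 + \<tau>bar\<^sup>2 * norm (h yk))
      - 1 / (2 * t k) * (norm (v k))\<^sup>2 + (\<alpha> + lg + norm (lam k) + norm (mu k)) * \<Delta> k"
    using tangential_descent[of k, folded yk] normal_step(3)[OF tube xh] by (simp add: algebra_simps)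
  show "acceptable k 0 yk xh"
    unfolding acceptable_def first_step_sizes
    using normal_step(2)[OF tube xh] descent \<rho>_nonneg[of k] by simp
qed

text \<open>A positive number of rejections would include a rejected trial with the initial step
  sizes.\<close>

lemma first_trial_taken: "trial k 0 (y k) (x (Suc k))"
proof -
  obtain j where j: "\<And>i. i < j \<Longrightarrow> \<exists>y' x'. trial k i y' x' \<and> \<not> acceptable k i y' x'"
    and "trial k j (y k) (x (Suc k))"
    using inner_loop[of k] unfolding inner_loop_def by blast
  moreover have "j = 0"
    using j[of 0] first_trial(5) by (cases j) auto
  ultimately show ?thesis by simp
qed

lemmas y_eq = first_trial(1)[OF first_trial_taken]
lemmas y_in_tube = first_trial(2)[OF first_trial_taken]
lemmas merit_descent = first_trial(4)[OF first_trial_taken]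
lemmas normal_step_taken = normal_step[OF y_in_tube first_trial(3)[OF first_trial_taken]]

section \<open>The decreasing sequence \<open>H\<close>\<close>

lemma S_ge: "\<tau>bar\<^sup>2 * norm (h (y k)) \<le> S k" "(norm (v k))\<^sup>2 \<le> S k" "(norm (d k))\<^sup>2 \<le> S k"
  unfolding S_def by auto

lemma S_le: "S k \<le> \<tau>bar\<^sup>2 * norm (h (y k)) + (norm (v k))\<^sup>2 + (norm (d k))\<^sup>2"
  unfolding S_def by simp

lemma S_nonneg: "0 \<le> S k"
  using S_ge(2)[of k] zero_le_power2 order_trans by blast

lemma lam_max_nonneg: "0 \<le> lam_max" and mu_max_nonneg: "0 \<le> mu_max"
  using norm_lam_le norm_mu_le norm_ge_zero order_trans by blast+

definition \<Delta>_const :: real where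
  "\<Delta>_const = \<sigma> / (8 * (\<alpha> + lg + lam_max + mu_max))"

lemma \<Delta>_const_pos: "0 < \<Delta>_const"
  unfolding \<Delta>_const_def using \<sigma>_pos \<alpha>_pos lg_nonneg lam_max_nonneg mu_max_nonneg by simp

lemma \<Delta>_le_S: "\<Delta> (Suc k) \<le> \<Delta>_const * S k"
  using \<Delta>_regime_Suc[of k] unfolding \<Delta>_const_def by simp

text \<open>The 8 in the regime makes the inexactness cost at most half of the
  \<open>\<sigma> / 4 * S k\<close> stored in \<open>H k\<close>.\<close>

lemma inexactness_bound:
  "(\<alpha> + lg + norm (lam (Suc k)) + norm (mu (Suc k))) * \<Delta> (Suc k) \<le> \<sigma> / 8 * S k"
proof -
  define c where "c = \<alpha> + lg + lam_max + mu_max"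
  have c: "0 < c" unfolding c_def using \<alpha>_pos lg_nonneg lam_max_nonneg mu_max_nonneg by simp
  have "(\<alpha> + lg + norm (lam (Suc k)) + norm (mu (Suc k))) * \<Delta> (Suc k) \<le> c * (\<Delta>_const * S k)"
    using norm_lam_le[of "Suc k"] norm_mu_le[of "Suc k"] \<Delta>_le_S \<Delta>_nonneg c unfolding c_def
    by (intro mult_mono) auto
  also have "\<dots> = \<sigma> / 8 * S k"
    using c unfolding \<Delta>_const_def c_def[symmetric] by simp
  finally show ?thesis .
qed

definition H :: "nat \<Rightarrow> real" where "H k = \<Phi> (x (Suc k)) + \<sigma> / 4 * S k"
definition E :: "nat \<Rightarrow> real" where "E k = S (Suc k) + S k"

lemma E_nonneg: "0 \<le> E k" and S_le_E: "S k \<le> E k" "S (Suc k) \<le> E k"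
  using S_nonneg[of k] S_nonneg[of "Suc k"] by (auto simp: E_def)

text \<open>The merit decrease \<open>\<sigma> / 2 * S (Suc k)\<close> loses
  \<open>\<sigma> / 4\<close> to the new stored term, and the old stored term loses
  \<open>\<sigma> / 8\<close> to the inexactness. The share of \<open>v\<close> in \<open>S\<close>
  is covered because \<open>\<sigma> \<le> 1 / t (Suc k)\<close>.\<close>

lemma H_descent: "\<sigma> / 8 * E k \<le> H k - H (Suc k)"
proof -
  have "\<sigma> \<le> 1 / t (Suc k)"
  proof -
    have "t (Suc k) * \<sigma> \<le> t (Suc k) * (Lf + lg * LA + \<alpha> * Lh + \<sigma>)"
      using Lf_nonneg lg_nonneg LA_nonneg \<alpha>_pos Lh_pos t_bounds(1)[of "Suc k"]
      by (intro mult_left_mono) auto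
    then show ?thesis
      using step_size_bound[of "Suc k"] t_bounds(1)[of "Suc k"] by (simp add: field_simps)
  qed
  then have "\<sigma> / 2 * (norm (v (Suc k)))\<^sup>2 \<le> 1 / t (Suc k) / 2 * (norm (v (Suc k)))\<^sup>2"
    by (intro mult_right_mono divide_right_mono) auto
  moreover have "\<sigma> / 2 * S (Suc k) \<le> \<sigma> / 2 * (\<tau>bar\<^sup>2 * norm (h (y (Suc k))) + (norm (v (Suc k)))\<^sup>2 + (norm (d (Suc k)))\<^sup>2)"
    using \<sigma>_pos S_le by (intro mult_left_mono) auto
  moreover have "0 \<le> \<sigma> * S (Suc k)" using \<sigma>_pos S_nonneg by simp
  ultimately show ?thesis
    using merit_descent[of "Suc k"] inexactness_bound[of k] unfolding H_def E_def
    by (simp add: algebra_simps)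
qed

lemma H_Suc_le: "H (Suc k) \<le> H k"
  using H_descent[of k] E_nonneg[of k] \<sigma>_pos mult_nonneg_nonneg[of "\<sigma> / 8" "E k"] by linarith

lemma x_bounded: "bounded (range x)"
proof -
  obtain b where b: "\<And>m. m \<in> M \<Longrightarrow> norm m \<le> b"
    using compact_imp_bounded[OF M_compact] unfolding bounded_iff by blast
  have "norm (x k) \<le> b + 2 * \<theta>" for k
  proof -
    obtain m where m: "m \<in> M" "infdist (x k) M = dist (x k) m"
      using infdist_attains_inf[OF compact_imp_closed[OF M_compact], of "x k"] x_init by blast
    then have "norm (x k - m) \<le> 2 * \<theta>"
      using iterate_in_tube[of k] by (simp add: tube_def dist_norm)
    then show ?thesis using b[OF m(1)] norm_triangle_sub[of "x k" m] by linarith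
  qed
  then show ?thesis unfolding bounded_iff by blast
qed

lemma F_continuous: "continuous_on UNIV F"
proof -
  have "continuous_on UNIV f" "continuous_on UNIV A"
    using f_gderiv A_has_derivative has_derivative_continuous
    unfolding gderiv_def continuous_on_eq_continuous_at[OF open_UNIV] by blast+
  moreover have "continuous_on UNIV g" using g_lipschitz by (rule lipschitz_on_continuous_on)
  ultimately show ?thesis
    unfolding F_def by (intro continuous_intros) (auto intro: continuous_on_compose2)
qed

lemma H_convergent: "\<exists>L. H \<longlonglongrightarrow> L"
proof -
  have "compact (F ` closure (range x))"
    using x_bounded F_continuous
    by (intro compact_continuous_image) (auto intro: continuous_on_subset simp: compact_closure)
  then obtain b where b: "\<And>w. w \<in> closure (range x) \<Longrightarrow> \<bar>F w\<bar> \<le> b"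
    using bounded_iff[THEN iffD1, OF compact_imp_bounded[of "F ` closure (range x)"]] by auto
  have "- b \<le> H k" for k
  proof -
    have "- b \<le> F (x (Suc k))"
      using b[of "x (Suc k)"] subsetD[OF closure_subset, of "x (Suc k)" "range x"] by (simp add: abs_le_iff)
    moreover have "0 \<le> \<alpha> * norm (h (x (Suc k)))" "0 \<le> \<sigma> / 4 * S k"
      using \<alpha>_pos \<sigma>_pos S_nonneg[of k] by simp_all
    ultimately show ?thesis unfolding H_def \<Phi>_def by linarith
  qed
  then show ?thesis
    using decseq_convergent[of H "- b"] H_Suc_le by (metis decseq_Suc_iff)
qed

lemma E_tendsto_0: "E \<longlonglongrightarrow> 0"
proof -
  obtain L where L: "H \<longlonglongrightarrow> L" using H_convergent by blast
  have "(\<lambda>k. 8 / \<sigma> * (H k - H (Suc k))) \<longlonglongrightarrow> 8 / \<sigma> * (L - L)"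
    using L LIMSEQ_Suc[OF L] by (intro tendsto_intros)
  then have lim: "(\<lambda>k. 8 / \<sigma> * (H k - H (Suc k))) \<longlonglongrightarrow> 0" by simp
  have "E k \<le> 8 / \<sigma> * (H k - H (Suc k))" for k
    using H_descent[of k] \<sigma>_pos by (simp add: field_simps)
  then show ?thesis
    using E_nonneg by (intro tendsto_sandwich[OF _ _ tendsto_const lim]) auto
qed

section \<open>The Kurdyka--Lojasiewicz potential along the iterates\<close>

definition A_gap_const :: real where
  "A_gap_const = lA * normal_const / \<tau>bar\<^sup>2 + LA / 2 + \<Delta>_const"

lemma h_y_le: "norm (h (y k)) \<le> S k / \<tau>bar\<^sup>2"
  using S_ge(1)[of k] bar_pos by (simp add: field_simps)

text \<open>The gap splits into the normal step, the linearization error of \<open>A\<close> and the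
  dual residual. All are of order \<open>E k\<close>, as \<open>norm (h (y (Suc k)))\<close> enters
  \<open>S\<close> to the first power and the residual is bounded by a multiple of
  \<open>S k\<close>.\<close>

lemma A_gap: "norm (A (x (Suc (Suc k))) - z (Suc k)) \<le> A_gap_const * E k"
proof -
  let ?j = "Suc k"
  have A1: "norm (A (x (Suc ?j)) - A (y ?j)) \<le> lA * normal_const / \<tau>bar\<^sup>2 * E k"
  proof -
    have "norm (A (x (Suc ?j)) - A (y ?j)) \<le> lA * norm (x (Suc ?j) - y ?j)" by (rule normal_step_taken(5))
    also have "\<dots> \<le> lA * (normal_const * (E k / \<tau>bar\<^sup>2))"
    proof -
      have "norm (h (y ?j)) \<le> E k / \<tau>bar\<^sup>2"
        using h_y_le[of ?j] divide_right_mono[OF S_le_E(2)[of k], of "\<tau>bar\<^sup>2"] by simp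
      then have "normal_const * norm (h (y ?j)) \<le> normal_const * (E k / \<tau>bar\<^sup>2)"
        using normal_const_pos by (intro mult_left_mono) auto
      then have "norm (x (Suc ?j) - y ?j) \<le> normal_const * (E k / \<tau>bar\<^sup>2)"
        using normal_step_taken(4)[of ?j] by (rule order_trans[rotated])
      then show ?thesis using lA_pos by (intro mult_left_mono) auto
    qed
    finally show ?thesis by simp
  qed
  have A2: "norm (A (y ?j) - A (x ?j) - JA (x ?j) *v d ?j) \<le> LA / 2 * E k"
    using A_linearization[of ?j] mult_left_mono[OF order_trans[OF S_ge(3) S_le_E(2)], of "LA / 2" k] LA_nonneg
    unfolding y_eq by simp
  have A3: "norm (v ?j - JA (x ?j) *v d ?j) \<le> \<Delta>_const * E k"
    using dual_residual(2)[of ?j] \<Delta>_le_S[of k] mult_left_mono[OF S_le_E(1)[of k], of \<Delta>_const] \<Delta>_const_pos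
    by linarith
  have "A (x (Suc ?j)) - z ?j = (A (x (Suc ?j)) - A (y ?j)) + (A (y ?j) - A (x ?j) - JA (x ?j) *v d ?j)
      - (v ?j - JA (x ?j) *v d ?j)"
    by (simp add: v_def)
  then have "norm (A (x (Suc ?j)) - z ?j) = norm ((A (x (Suc ?j)) - A (y ?j))
      + (A (y ?j) - A (x ?j) - JA (x ?j) *v d ?j) - (v ?j - JA (x ?j) *v d ?j))"
    by (rule arg_cong)
  then have "norm (A (x (Suc ?j)) - z ?j) \<le> norm (A (x (Suc ?j)) - A (y ?j))
      + norm (A (y ?j) - A (x ?j) - JA (x ?j) *v d ?j) + norm (v ?j - JA (x ?j) *v d ?j)"
    using norm_triangle_ineq4[of "(A (x (Suc ?j)) - A (y ?j)) + (A (y ?j) - A (x ?j) - JA (x ?j) *v d ?j)"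
        "v ?j - JA (x ?j) *v d ?j"]
      norm_triangle_ineq[of "A (x (Suc ?j)) - A (y ?j)" "A (y ?j) - A (x ?j) - JA (x ?j) *v d ?j"]
    by linarith
  then show ?thesis
    using A1 A2 A3 unfolding A_gap_const_def distrib_right by linarith
qed

lemma h_iterate_le_E: "norm (h (x (Suc (Suc k)))) \<le> E k / \<tau>bar\<^sup>2"
  using normal_step_taken(1)[of "Suc k"] h_y_le[of "Suc k"] divide_right_mono[OF S_le_E(2)[of k], of "\<tau>bar\<^sup>2"] by simp

lemma A_gap_const_nonneg: "0 \<le> A_gap_const"
  unfolding A_gap_const_def using lA_pos normal_const_pos LA_nonneg \<Delta>_const_pos by simp

definition K_pot :: real where
  "K_pot = lg * A_gap_const + \<alpha> / \<tau>bar\<^sup>2 + \<sigma> / 4"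

lemma K_pot_nonneg: "0 \<le> K_pot"
  unfolding K_pot_def using lg_nonneg A_gap_const_nonneg \<alpha>_pos \<sigma>_pos by simp

text \<open>The point at which the KL inequality is applied pairs the new iterate with the old
  \<open>z\<close> and the old multipliers: \<open>A x - z\<close> is then of second order, whereas for the old
  iterate it is only of first order. The square of the last component absorbs what the potential
  lacks compared with the merit function.\<close>

definition W :: "nat \<Rightarrow> (real^'a) \<times> (real^'b) \<times> (real^'c) \<times> (real^'b) \<times> real" where
  "W k = (x (Suc (Suc k)), z (Suc k), cbrt_vec (h (x (Suc (Suc k)))),
     cbrt_vec (A (x (Suc (Suc k))) - z (Suc k)), sqrt (K_pot * E k))"

text \<open>Gradient of the Lagrangian minorant at \<open>W k\<close> for the multipliers of
  iteration \<open>Suc k\<close>. The second component reduces to \<open>v (Suc k)\<close> divided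
  by \<open>- t (Suc k)\<close>.\<close>

definition V :: "nat \<Rightarrow> (real^'a) \<times> (real^'b) \<times> (real^'c) \<times> (real^'b) \<times> real" where
  "V k = (grad f (x (Suc (Suc k))) + transpose (Jh (x (Suc (Suc k)))) *v lam (Suc k)
       + transpose (JA (x (Suc (Suc k)))) *v mu (Suc k),
     \<zeta> (Suc k) - mu (Suc k),
     (\<chi> i. - 3 * lam (Suc k) $ i * (cbrt_vec (h (x (Suc (Suc k)))) $ i)\<^sup>2),
     (\<chi> j. - 3 * mu (Suc k) $ j * (cbrt_vec (A (x (Suc (Suc k))) - z (Suc k)) $ j)\<^sup>2),
     2 * sqrt (K_pot * E k))"

definition p :: "nat \<Rightarrow> real" where
  "p k = f (x (Suc (Suc k))) + g (z (Suc k)) + K_pot * E k"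

lemma V_subgradient: "V k \<in> regular_subdiff (KL_potential f g A h) (W k)"
  unfolding V_def W_def
  by (intro KL_potential_regular_subgradient f_gderiv h_differentiable A_differentiable
      \<zeta>_subgradient) (simp_all add: cbrt_vec_cube)

lemma KL_potential_W: "KL_potential f g A h (W k) = ereal (p k)"
  unfolding W_def KL_potential_def delta_def p_def
  using K_pot_nonneg E_nonneg by (simp add: cbrt_vec_cube)

lemma g_gap: "\<bar>g (A (x (Suc (Suc k)))) - g (z (Suc k))\<bar> \<le> lg * A_gap_const * E k"
  using lipschitz_onD[OF g_lipschitz, of "A (x (Suc (Suc k)))" "z (Suc k)"]
    mult_left_mono[OF A_gap[of k] lg_nonneg] by (simp add: dist_norm)

text \<open>The summands of \<open>K_pot\<close> cover in turn the change from
  \<open>g (A x)\<close> to \<open>g z\<close>, the penalty and the stored multiple of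
  \<open>S\<close>. This order is essential for the KL step, where the slope taken at
  \<open>p k\<close> has to be usable at \<open>H (Suc k)\<close>.\<close>

lemma p_lower: "H (Suc k) \<le> p k"
proof -
  have "\<alpha> * norm (h (x (Suc (Suc k)))) \<le> \<alpha> / \<tau>bar\<^sup>2 * E k"
    using mult_left_mono[OF h_iterate_le_E[of k] less_imp_le[OF \<alpha>_pos]] by simp
  moreover have "\<sigma> / 4 * S (Suc k) \<le> \<sigma> / 4 * E k"
    using \<sigma>_pos S_le_E by (intro mult_left_mono) auto
  ultimately show ?thesis
    using g_gap[of k] unfolding H_def p_def \<Phi>_def F_def K_pot_def distrib_right by linarith
qed

lemma p_upper: "p k \<le> H (Suc k) + (lg * A_gap_const + K_pot) * E k"
proof -
  have "0 \<le> \<alpha> * norm (h (x (Suc (Suc k))))" "0 \<le> \<sigma> / 4 * S (Suc k)"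
    using \<alpha>_pos \<sigma>_pos S_nonneg[of "Suc k"] by simp_all
  then show ?thesis
    using g_gap[of k] unfolding H_def p_def \<Phi>_def F_def distrib_right by linarith
qed

lemma E_bounded: obtains Q where "\<And>k. E k \<le> Q" "0 \<le> Q"
proof -
  have "Bseq E" using E_tendsto_0 by (intro convergent_imp_Bseq) (auto simp: convergent_def)
  then obtain Q where "\<And>k. norm (E k) \<le> Q" "0 < Q" unfolding Bseq_def by blast
  then show thesis using that[of Q] by (auto simp: abs_le_iff)
qed

text \<open>The tangential part is at most \<open>sqrt (E k)\<close>. The normal part is of order
  \<open>E k\<close>, and boundedness of \<open>E\<close> trades one factor
  \<open>sqrt (E k)\<close> for a constant.\<close>

lemma step_length: obtains C where "\<And>k. norm (x (Suc (Suc k)) - x (Suc k)) \<le> C * sqrt (E k)" "0 \<le> C"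
proof -
  obtain Q where Q: "\<And>k. E k \<le> Q" "0 \<le> Q" using E_bounded by blast
  let ?C = "1 + normal_const / \<tau>bar\<^sup>2 * sqrt Q"
  have "norm (x (Suc (Suc k)) - x (Suc k)) \<le> ?C * sqrt (E k)" for k
  proof -
    let ?j = "Suc k"
    have "norm (d ?j) \<le> sqrt (E k)"
      using order_trans[OF S_ge(3) S_le_E(2)] by (rule real_le_rsqrt)
    moreover have "norm (x (Suc ?j) - y ?j) \<le> normal_const / \<tau>bar\<^sup>2 * sqrt Q * sqrt (E k)"
    proof -
      have "E k = sqrt (E k) * sqrt (E k)" using E_nonneg by simp
      also have "\<dots> \<le> sqrt Q * sqrt (E k)"
        using Q E_nonneg by (intro mult_right_mono) auto
      finally have "S ?j \<le> sqrt Q * sqrt (E k)" using S_le_E(2)[of k] by linarith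
      then have "norm (h (y ?j)) \<le> sqrt Q * sqrt (E k) / \<tau>bar\<^sup>2"
        using h_y_le[of ?j] divide_right_mono[of "S ?j" _ "\<tau>bar\<^sup>2"] order_trans by fastforce
      then have "normal_const * norm (h (y ?j)) \<le> normal_const * (sqrt Q * sqrt (E k) / \<tau>bar\<^sup>2)"
        using normal_const_pos by (intro mult_left_mono) auto
      then show ?thesis using normal_step_taken(4)[of ?j] by (simp add: mult_ac)
    qed
    moreover have "x (Suc ?j) - x ?j = (x (Suc ?j) - y ?j) + d ?j" by (simp add: y_eq)
    then have "norm (x (Suc ?j) - x ?j) \<le> norm (x (Suc ?j) - y ?j) + norm (d ?j)"
      by (metis norm_triangle_ineq)
    ultimately show ?thesis unfolding distrib_right by linarith
  qed
  moreover have "0 \<le> ?C" using normal_const_pos Q by simp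
  ultimately show thesis using that by blast
qed

lemma V_bound: obtains C where "\<And>k. norm (V k) \<le> C * sqrt (E k)" "0 \<le> C"
proof -
  obtain Q where Q: "\<And>k. E k \<le> Q" "0 \<le> Q" using E_bounded by blast
  obtain C where C: "\<And>k. norm (x (Suc (Suc k)) - x (Suc k)) \<le> C * sqrt (E k)" "0 \<le> C"
    using step_length by blast
  let ?c1 = "1 / tmin + (Lf + Lh * lam_max + LA * mu_max) * C"
  let ?c2 = "1 / tmin"
  let ?c3 = "real CARD('c) * (3 * lam_max * sqrt (1 + Q / \<tau>bar\<^sup>2)) / \<tau>bar"
  let ?c4 = "real CARD('b) * (3 * mu_max * sqrt (1 + A_gap_const * Q)) * sqrt A_gap_const"
  let ?c5 = "2 * sqrt K_pot"
  let ?C = "?c1 + ?c2 + ?c3 + ?c4 + ?c5"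
  have "norm (V k) \<le> ?C * sqrt (E k)" for k
  proof -
    let ?j = "Suc k"
    let ?u = "x (Suc ?j)" and ?w = "x ?j"
    have tinv: "1 / t ?j \<le> 1 / tmin" using t_bounds[of ?j] t_range by (intro divide_left_mono) auto
    have scaled: "norm ((1 / t ?j) *\<^sub>R a) \<le> 1 / tmin * sqrt (E k)" if "(norm a)\<^sup>2 \<le> S ?j" for a :: "'k::real_normed_vector"
    proof -
      have "norm a \<le> sqrt (E k)"
        using order_trans[OF that S_le_E(2)] by (rule real_le_rsqrt)
      then have "1 / t ?j * norm a \<le> 1 / tmin * sqrt (E k)"
        using tinv t_range by (intro mult_mono) auto
      then show ?thesis using t_bounds(1)[of ?j] by simp
    qed
    have n2: "norm (\<zeta> ?j - mu ?j) \<le> ?c2 * sqrt (E k)"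
      using scaled[OF S_ge(2)] by simp
    have n1: "norm (grad f ?u + transpose (Jh ?u) *v lam ?j + transpose (JA ?u) *v mu ?j) \<le> ?c1 * sqrt (E k)"
    proof -
      define r where "r = norm (?u - ?w)"
      define G1 where "G1 = grad f ?u - grad f ?w"
      define G2 where "G2 = transpose (Jh ?u) *v lam ?j - transpose (Jh ?w) *v lam ?j"
      define G3 where "G3 = transpose (JA ?u) *v mu ?j - transpose (JA ?w) *v mu ?j"
      \<comment> \<open>At the old iterate the same combination is exactly \<open>- d / t\<close>;
        moving to the new one costs Lipschitz constants times the step length.\<close>
      have eqn: "grad f ?u + transpose (Jh ?u) *v lam ?j + transpose (JA ?u) *v mu ?j
          = G1 + G2 + G3 - (1 / t ?j) *\<^sub>R d ?j"
        using t_bounds(1)[of ?j] by (simp add: G1_def G2_def G3_def d_def)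
      have "norm G1 \<le> Lf * r"
        using lipschitz_onD[OF f_lipschitz, of ?u ?w] by (simp add: G1_def r_def dist_norm)
      moreover have "norm G2 \<le> Lh * lam_max * r"
      proof -
        have "norm G2 \<le> Lh * r * norm (lam ?j)"
          unfolding G2_def r_def by (rule norm_transpose_jacobian_diff[OF h_lipschitz])
        also have "\<dots> \<le> Lh * r * lam_max"
          using norm_lam_le Lh_pos by (intro mult_left_mono) (auto simp: r_def)
        finally show ?thesis by (simp add: mult_ac)
      qed
      moreover have "norm G3 \<le> LA * mu_max * r"
      proof -
        have "norm G3 \<le> LA * r * norm (mu ?j)"
          unfolding G3_def r_def by (rule norm_transpose_jacobian_diff[OF A_lipschitz])
        also have "\<dots> \<le> LA * r * mu_max"
          using norm_mu_le LA_nonneg by (intro mult_left_mono) (auto simp: r_def)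
        finally show ?thesis by (simp add: mult_ac)
      qed
      moreover have "(Lf + Lh * lam_max + LA * mu_max) * r \<le> (Lf + Lh * lam_max + LA * mu_max) * (C * sqrt (E k))"
        using C(1)[of k] Lf_nonneg Lh_pos LA_nonneg lam_max_nonneg mu_max_nonneg
        by (intro mult_left_mono) (auto simp: r_def)
      moreover have "norm ((1 / t ?j) *\<^sub>R d ?j) \<le> 1 / tmin * sqrt (E k)"
        by (rule scaled[OF S_ge(3)])
      moreover have "norm (G1 + G2 + G3 - (1 / t ?j) *\<^sub>R d ?j)
          \<le> norm G1 + norm G2 + norm G3 + norm ((1 / t ?j) *\<^sub>R d ?j)"
        using norm_triangle_ineq4[of "G1 + G2 + G3" "(1 / t ?j) *\<^sub>R d ?j"]
          norm_triangle_ineq[of "G1 + G2" G3] norm_triangle_ineq[of G1 G2] by linarith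
      ultimately have "norm (grad f ?u + transpose (Jh ?u) *v lam ?j + transpose (JA ?u) *v mu ?j)
          \<le> 1 / tmin * sqrt (E k) + (Lf + Lh * lam_max + LA * mu_max) * (C * sqrt (E k))"
        unfolding eqn distrib_right[of _ _ r] by linarith
      then show ?thesis by (simp add: algebra_simps)
    qed
    have n3: "norm (\<chi> i. - 3 * lam ?j $ i * (cbrt_vec (h ?u) $ i)\<^sup>2) \<le> ?c3 * sqrt (E k)"
    proof -
      have "E k / \<tau>bar\<^sup>2 \<le> Q / \<tau>bar\<^sup>2" using Q by (intro divide_right_mono) auto
      from cbrt_multiplier_bound[OF h_iterate_le_E this norm_lam_le[of ?j]] show ?thesis
        using bar_pos by (simp add: real_sqrt_divide)
    qed
    have n4: "norm (\<chi> i. - 3 * mu ?j $ i * (cbrt_vec (A ?u - z ?j) $ i)\<^sup>2) \<le> ?c4 * sqrt (E k)"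
    proof -
      have "A_gap_const * E k \<le> A_gap_const * Q" using Q A_gap_const_nonneg by (intro mult_left_mono) auto
      from cbrt_multiplier_bound[OF A_gap this norm_mu_le[of ?j]] show ?thesis
        by (simp add: real_sqrt_mult mult.assoc)
    qed
    have n5: "norm (2 * sqrt (K_pot * E k)) \<le> ?c5 * sqrt (E k)"
      using K_pot_nonneg E_nonneg by (simp add: real_sqrt_mult)
    have "norm (V k) \<le> ?c1 * sqrt (E k) + ?c2 * sqrt (E k) + ?c3 * sqrt (E k) + ?c4 * sqrt (E k) + ?c5 * sqrt (E k)"
      unfolding V_def by (intro order_trans[OF norm_tuple5_le] add_mono n1 n2 n3 n4 n5)
    also have "\<dots> = ?C * sqrt (E k)"
      by (simp only: distrib_right)
    finally show ?thesis .
  qed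
  moreover have "0 \<le> ?C"
    using t_range Lf_nonneg Lh_pos LA_nonneg lam_max_nonneg mu_max_nonneg C(2) Q(2) A_gap_const_nonneg
      K_pot_nonneg bar_pos
    by (intro add_nonneg_nonneg mult_nonneg_nonneg divide_nonneg_nonneg) auto
  ultimately show thesis using that by blast
qed

section \<open>Convergence\<close>

lemma S_tendsto_0: "S \<longlonglongrightarrow> 0"
  using S_nonneg S_le_E by (intro tendsto_sandwich[OF _ _ tendsto_const E_tendsto_0]) auto

lemma d_tendsto_0: "d \<longlonglongrightarrow> 0" and v_tendsto_0: "v \<longlonglongrightarrow> 0"
proof -
  have lim: "(\<lambda>k. sqrt (S k)) \<longlonglongrightarrow> 0"
    using tendsto_real_sqrt[OF S_tendsto_0] by simp
  show "d \<longlonglongrightarrow> 0" "v \<longlonglongrightarrow> 0"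
    by (rule Lim_null_comparison[OF _ lim], intro always_eventually allI real_le_rsqrt S_ge)+
qed

lemma scaled_E_tendsto_0: "(\<lambda>k. c * E k) \<longlonglongrightarrow> 0"
  using tendsto_mult_left[OF E_tendsto_0, of c] by simp

lemma A_gap_tendsto_0: "(\<lambda>k. A (x (Suc (Suc k))) - z (Suc k)) \<longlonglongrightarrow> 0"
  by (rule Lim_null_comparison[OF _ scaled_E_tendsto_0[of A_gap_const]])
     (intro always_eventually allI A_gap)

lemma h_tendsto_0: "(\<lambda>k. h (x (Suc (Suc k)))) \<longlonglongrightarrow> 0"
  using h_iterate_le_E
  by (intro Lim_null_comparison[OF _ scaled_E_tendsto_0[of "1 / \<tau>bar\<^sup>2"]]) auto

lemma W_rest_tendsto_0: "(\<lambda>k. snd (snd (W k))) \<longlonglongrightarrow> 0"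
proof -
  have "(\<lambda>k. sqrt (K_pot * E k)) \<longlonglongrightarrow> sqrt 0"
    by (intro tendsto_real_sqrt scaled_E_tendsto_0)
  then show ?thesis
    unfolding W_def snd_conv zero_prod_def
    by (intro tendsto_Pair tendsto_cbrt_vec_zero h_tendsto_0 A_gap_tendsto_0) simp
qed

lemma step_tendsto_0: "(\<lambda>k. x (Suc (Suc k)) - x (Suc k)) \<longlonglongrightarrow> 0"
proof -
  obtain C where C: "\<And>k. norm (x (Suc (Suc k)) - x (Suc k)) \<le> C * sqrt (E k)"
    using step_length by blast
  have "(\<lambda>k. C * sqrt (E k)) \<longlonglongrightarrow> C * sqrt 0"
    by (intro tendsto_intros E_tendsto_0)
  then have lim: "(\<lambda>k. C * sqrt (E k)) \<longlonglongrightarrow> 0" by simp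
  show ?thesis
    by (rule Lim_null_comparison[OF _ lim]) (intro always_eventually allI C)
qed

lemma V_tendsto_0: "V \<longlonglongrightarrow> 0"
proof -
  obtain C where C: "\<And>k. norm (V k) \<le> C * sqrt (E k)" using V_bound by blast
  have "(\<lambda>k. C * sqrt (E k)) \<longlonglongrightarrow> C * sqrt 0"
    by (intro tendsto_intros E_tendsto_0)
  then have lim: "(\<lambda>k. C * sqrt (E k)) \<longlonglongrightarrow> 0" by simp
  show ?thesis
    by (rule Lim_null_comparison[OF _ lim]) (intro always_eventually allI C)
qed

lemma p_tendsto: "H \<longlonglongrightarrow> L \<Longrightarrow> p \<longlonglongrightarrow> L"
proof (rule tendsto_sandwich)
  assume H: "H \<longlonglongrightarrow> L"
  show "(\<lambda>k. H (Suc k)) \<longlonglongrightarrow> L" using H by (rule LIMSEQ_Suc)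
  have "(\<lambda>k. H (Suc k) + (lg * A_gap_const + K_pot) * E k) \<longlonglongrightarrow> L + 0"
    by (intro tendsto_add LIMSEQ_Suc[OF H] scaled_E_tendsto_0)
  then show "(\<lambda>k. H (Suc k) + (lg * A_gap_const + K_pot) * E k) \<longlonglongrightarrow> L" by simp
qed (use p_lower p_upper in auto)

lemma h_continuous: "isCont h w" and A_continuous: "isCont A w" and gradf_continuous: "isCont (grad f) w"
  using has_derivative_continuous[OF h_has_derivative] has_derivative_continuous[OF A_has_derivative]
    lipschitz_on_continuous_on[OF f_lipschitz] by (auto simp: continuous_on_eq_continuous_at)

text \<open>\<open>H (q i)\<close> contains the merit function at \<open>x (Suc (q i))\<close>,
  whose penalty and stored term vanish in the limit, so \<open>L\<close> is the objective value at
  \<open>a\<close>. Vanishing steps and gaps carry the convergence over to the shifted points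
  \<open>W (q i)\<close>.\<close>

lemma cluster_point_values:
  assumes q: "strict_mono q" and xq: "(\<lambda>i. x (Suc (q i))) \<longlonglongrightarrow> a" and H: "H \<longlonglongrightarrow> L"
  shows "h a = 0" "L = F a" "(\<lambda>i. W (q i)) \<longlonglongrightarrow> (a, A a, 0)"
proof -
  note sub = LIMSEQ_subseq_LIMSEQ[OF _ q, unfolded o_def]
  have "(\<lambda>i. x (Suc (Suc (q i))) - x (Suc (q i)) + x (Suc (q i))) \<longlonglongrightarrow> 0 + a"
    by (intro tendsto_add sub[OF step_tendsto_0] xq)
  then have xq': "(\<lambda>i. x (Suc (Suc (q i)))) \<longlonglongrightarrow> a" by simp
  have "(\<lambda>i. h (x (Suc (Suc (q i))))) \<longlonglongrightarrow> h a"
    by (rule isCont_tendsto_compose[OF h_continuous xq'])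
  then show ha: "h a = 0"
    using sub[OF h_tendsto_0] LIMSEQ_unique by blast
  have Fq: "(\<lambda>i. F (x (Suc (q i)))) \<longlonglongrightarrow> F a"
    using F_continuous xq by (auto intro: continuous_on_tendsto_compose)
  have "(\<lambda>i. h (x (Suc (q i)))) \<longlonglongrightarrow> h a"
    by (rule isCont_tendsto_compose[OF h_continuous xq])
  then have "(\<lambda>i. H (q i)) \<longlonglongrightarrow> F a + \<alpha> * norm (h a) + \<sigma> / 4 * 0"
    unfolding H_def \<Phi>_def using Fq by (intro tendsto_intros sub[OF S_tendsto_0])
  then show "L = F a"
    using sub[OF H] LIMSEQ_unique ha by fastforce
  have Aq: "(\<lambda>i. A (x (Suc (Suc (q i))))) \<longlonglongrightarrow> A a"
    by (rule isCont_tendsto_compose[OF A_continuous xq'])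
  have "(\<lambda>i. A (x (Suc (Suc (q i)))) - (A (x (Suc (Suc (q i)))) - z (Suc (q i)))) \<longlonglongrightarrow> A a - 0"
    by (intro tendsto_diff Aq sub[OF A_gap_tendsto_0])
  then have zq: "(\<lambda>i. z (Suc (q i))) \<longlonglongrightarrow> A a" by simp
  have "(\<lambda>i. (x (Suc (Suc (q i))), z (Suc (q i)), snd (snd (W (q i))))) \<longlonglongrightarrow> (a, A a, 0)"
    by (intro tendsto_Pair xq' zq sub[OF W_rest_tendsto_0])
  then show "(\<lambda>i. W (q i)) \<longlonglongrightarrow> (a, A a, 0)" by (simp add: W_def)
qed

lemma x_convergent:
  assumes KL: "KL_property (KL_potential f g A h)"
  obtains a where "x \<longlonglongrightarrow> a" "h a = 0"
proof -
  \<comment> \<open>Shifted by one because \<open>E k\<close> controls the step from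
    \<open>x (Suc k)\<close> to \<open>x (Suc (Suc k))\<close>.\<close>
  define X where "X k = x (Suc k)" for k
  let ?P = "KL_potential f g A h"
  obtain L where H: "H \<longlonglongrightarrow> L" using H_convergent by blast
  have H_ge: "L \<le> H k" for k
    using H by (intro decseq_ge) (auto simp: decseq_Suc_iff H_Suc_le)
  have "bounded (range X)"
    using x_bounded by (rule bounded_subset) (auto simp: X_def)
  then obtain a q where q: "strict_mono q" "(X \<circ> q) \<longlonglongrightarrow> a"
    using bounded_imp_convergent_subsequence by blast
  have xq: "(\<lambda>i. x (Suc (q i))) \<longlonglongrightarrow> a" using q(2) by (simp add: o_def X_def)
  note cluster = cluster_point_values[OF q(1) xq H]
  define wa where "wa = (a, A a, 0 :: (real^'c) \<times> (real^'b) \<times> real)"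
  have Pwa: "?P wa = ereal L"
    unfolding wa_def KL_potential_def delta_def zero_prod_def cluster(2) F_def using cluster(1) by simp
  \<comment> \<open>The KL property speaks only about points with nonempty subdifferential, so it
    must be shown that the limit of the \<open>W (q i)\<close> is one of them.\<close>
  have "0 \<in> limiting_subdiff ?P wa"
    unfolding limiting_subdiff_def
  proof (intro CollectI conjI exI allI)
    show "\<bar>?P wa\<bar> \<noteq> \<infinity>" by (simp add: Pwa)
    show "(\<lambda>i. W (q i)) \<longlonglongrightarrow> wa" unfolding wa_def by (rule cluster(3))
    show "(\<lambda>i. ?P (W (q i))) \<longlonglongrightarrow> ?P wa"
      unfolding KL_potential_W Pwa
      using LIMSEQ_subseq_LIMSEQ[OF p_tendsto[OF H] q(1)] by (simp add: o_def)
    show "V (q i) \<in> regular_subdiff ?P (W (q i))" for i by (rule V_subgradient)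
    show "(\<lambda>i. V (q i)) \<longlonglongrightarrow> 0"
      using LIMSEQ_subseq_LIMSEQ[OF V_tendsto_0 q(1)] by (simp add: o_def)
  qed
  then have "KL_at ?P wa" using KL unfolding KL_property_def by blast
  then obtain \<epsilon> \<delta> \<phi> \<phi>' where \<epsilon>: "0 < \<epsilon>" and \<delta>: "0 < \<delta>"
    and cont: "continuous_on {s. 0 \<le> s \<and> ereal s < \<epsilon>} \<phi>"
    and conc: "concave_on {s. 0 \<le> s \<and> ereal s < \<epsilon>} \<phi>"
    and \<phi>_nonneg: "\<And>s. 0 \<le> s \<Longrightarrow> ereal s < \<epsilon> \<Longrightarrow> 0 \<le> \<phi> s"
    and \<phi>0: "\<phi> 0 = 0"
    and der: "\<And>s. 0 < s \<Longrightarrow> ereal s < \<epsilon> \<Longrightarrow> (\<phi> has_real_derivative \<phi>' s) (at s)"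
    and der_pos: "\<And>s. 0 < s \<Longrightarrow> ereal s < \<epsilon> \<Longrightarrow> 0 < \<phi>' s"
    and KL_ineq: "\<And>w. norm (w - wa) \<le> \<delta> \<Longrightarrow> ?P wa < ?P w \<Longrightarrow> ?P w < ?P wa + \<epsilon> \<Longrightarrow>
       ereal (\<phi>' (real_of_ereal (?P w - ?P wa))) * (INF v\<in>limiting_subdiff ?P w. ereal (norm v)) > 1"
    unfolding KL_at_def by (elim exE conjE) blast
  \<comment> \<open>The width \<epsilon> may be infinite; a positive real below it serves
    instead.\<close>
  obtain \<epsilon>0 where \<epsilon>0: "0 < \<epsilon>0" "ereal \<epsilon>0 < \<epsilon>"
    using ereal_dense2[OF \<epsilon>] by auto
  have small: "ereal s < \<epsilon>" if "s < \<epsilon>0" for s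
    using that by (intro order_less_trans[OF _ \<epsilon>0(2)]) simp
  obtain C where C: "\<And>k. norm (V k) \<le> C * sqrt (E k)" "0 \<le> C" using V_bound by blast
  obtain c where c: "\<And>k. norm (X (Suc k) - X k) \<le> c * sqrt (E k)" "0 \<le> c"
    unfolding X_def using step_length by blast
  \<comment> \<open>Where the argument may lie outside the domain of \<open>\<phi>\<close> the value
    is set to 0, which keeps \<open>r\<close> nonnegative at all indices. The factor 4 is half of
    the 8 from the descent of \<open>H\<close>.\<close>
  define r where "r k = (if H (Suc k) - L < \<epsilon>0 then 4 * C / \<sigma> * \<phi> (H (Suc k) - L) else 0)" for k
  obtain \<delta>1 where \<delta>1: "0 < \<delta>1" "\<And>u. norm (u - a) < \<delta>1 \<Longrightarrow> norm (A u - A a) < \<delta> / 4"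
    using A_continuous[of a] \<delta> unfolding continuous_at_eps_delta dist_norm
    by (metis divide_pos_pos zero_less_numeral)
  \<comment> \<open>\<open>W k\<close> contains \<open>X (Suc k)\<close> whereas the recursion is
    conditioned on \<open>X k\<close>; half of \<open>\<delta>2\<close> is reserved for the step
    between them. The three blocks of \<open>W k - wa\<close> then have norms below
    \<open>\<delta> / 4\<close>, \<open>\<delta> / 2\<close> and
    \<open>\<delta> / 4\<close>.\<close>
  define \<delta>2 where "\<delta>2 = min \<delta>1 (\<delta> / 4)"
  have \<delta>2: "0 < \<delta>2" using \<delta> \<delta>1 by (simp add: \<delta>2_def)
  have "\<forall>\<^sub>F k in sequentially. H (Suc k) - L < \<epsilon>0"
    using order_tendstoD(2)[OF LIMSEQ_Suc[OF H], of "L + \<epsilon>0"] \<epsilon>0 by (simp add: algebra_simps)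
  moreover have "\<forall>\<^sub>F k in sequentially. p k - L < \<epsilon>0"
    using order_tendstoD(2)[OF p_tendsto[OF H], of "L + \<epsilon>0"] \<epsilon>0 by (simp add: algebra_simps)
  moreover have "\<forall>\<^sub>F k in sequentially. norm (X (Suc k) - X k) < \<delta>2 / 2"
    using order_tendstoD(2)[OF tendsto_norm_zero[OF step_tendsto_0], of "\<delta>2 / 2"] \<delta>2 by (simp add: X_def)
  moreover have "\<forall>\<^sub>F k in sequentially. norm (A (X (Suc k)) - z (Suc k)) < \<delta> / 4"
    using order_tendstoD(2)[OF tendsto_norm_zero[OF A_gap_tendsto_0], of "\<delta> / 4"] \<delta> by (simp add: X_def)
  moreover have "\<forall>\<^sub>F k in sequentially. norm (snd (snd (W k))) < \<delta> / 4"
    using order_tendstoD(2)[OF tendsto_norm_zero[OF W_rest_tendsto_0], of "\<delta> / 4"] \<delta> by simp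
  ultimately have "\<forall>\<^sub>F k in sequentially. H (Suc k) - L < \<epsilon>0 \<and> p k - L < \<epsilon>0
      \<and> norm (X (Suc k) - X k) < \<delta>2 / 2 \<and> norm (A (X (Suc k)) - z (Suc k)) < \<delta> / 4
      \<and> norm (snd (snd (W k))) < \<delta> / 4"
    by (intro eventually_conj)
  then obtain k0 where k0: "\<And>k. k0 \<le> k \<Longrightarrow> H (Suc k) - L < \<epsilon>0"
    "\<And>k. k0 \<le> k \<Longrightarrow> p k - L < \<epsilon>0"
    "\<And>k. k0 \<le> k \<Longrightarrow> norm (X (Suc k) - X k) < \<delta>2 / 2"
    "\<And>k. k0 \<le> k \<Longrightarrow> norm (A (X (Suc k)) - z (Suc k)) < \<delta> / 4"
    "\<And>k. k0 \<le> k \<Longrightarrow> norm (snd (snd (W k))) < \<delta> / 4"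
    unfolding eventually_sequentially by blast
  have near: "norm (W k - wa) \<le> \<delta>" if k: "k0 \<le> k" and X: "norm (X k - a) < \<delta>2 / 2" for k
  proof -
    have Xa: "norm (X (Suc k) - a) < \<delta>2"
      using k0(3)[OF k] X norm_triangle_ineq[of "X (Suc k) - X k" "X k - a"] by simp
    have "norm (A (X (Suc k)) - A a) < \<delta> / 4" using Xa by (intro \<delta>1(2)) (simp add: \<delta>2_def)
    then have "norm (z (Suc k) - A a) < \<delta> / 2"
      using k0(4)[OF k] norm_triangle_ineq4[of "A (X (Suc k)) - A a" "A (X (Suc k)) - z (Suc k)"] by simp
    moreover have "W k - wa = (X (Suc k) - a, z (Suc k) - A a, snd (snd (W k)))"
      by (simp add: W_def wa_def X_def)
    moreover have "norm (X (Suc k) - a) < \<delta> / 4" using Xa by (simp add: \<delta>2_def)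
    ultimately show ?thesis
      using k0(5)[OF k] norm_Pair_le[of "X (Suc k) - a" "(z (Suc k) - A a, snd (snd (W k)))"]
        norm_Pair_le[of "z (Suc k) - A a" "snd (snd (W k))"] by simp
  qed
  have rec: "sqrt (E (Suc k)) \<le> sqrt (E k) / 2 + (r k - r (Suc k))"
    if k: "k0 \<le> k" and X: "norm (X k - a) < \<delta>2 / 2" for k
  proof (cases "H (Suc k) = L")
    \<comment> \<open>Once the limit value is attained, \<open>H\<close> stays constant, so
      \<open>E (Suc k)\<close> vanishes without any appeal to the KL inequality.\<close>
    case True
    then have "H (Suc (Suc k)) = L" using H_Suc_le[of "Suc k"] H_ge[of "Suc (Suc k)"] by simp
    then have "\<sigma> / 8 * E (Suc k) \<le> 0" using H_descent[of "Suc k"] True by simp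
    then have "E (Suc k) = 0" using \<sigma>_pos E_nonneg[of "Suc k"] by (simp add: mult_le_0_iff)
    moreover have "r k = r (Suc k)"
      unfolding r_def by (simp add: True \<open>H (Suc (Suc k)) = L\<close>)
    ultimately show ?thesis using E_nonneg by simp
  next
    case False
    then have HL: "L < H (Suc k)" using H_ge[of "Suc k"] by simp
    define P' where "P' = \<phi>' (p k - L)"
    have pL: "L < p k" "p k - L < \<epsilon>0" using HL p_lower[of k] k0(2)[OF k] by auto
    have "ereal (p k) < ereal L + \<epsilon>"
    proof -
      have "ereal (p k) = ereal L + ereal (p k - L)" by simp
      also have "\<dots> < ereal L + \<epsilon>" using small[OF pL(2)] by (cases \<epsilon>) auto
      finally show ?thesis .
    qed
    then have "1 < ereal P' * (INF v\<in>limiting_subdiff ?P (W k). ereal (norm v))"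
      using KL_ineq[OF near[OF k X]] pL by (simp add: KL_potential_W Pwa P'_def)
    moreover have P'_pos: "0 < P'" unfolding P'_def using pL small by (intro der_pos) auto
    moreover have "(INF v\<in>limiting_subdiff ?P (W k). ereal (norm v)) \<le> ereal (norm (V k))"
      using V_subgradient regular_subset_limiting_subdiff by (intro INF_lower) blast
    then have "ereal P' * (INF v\<in>limiting_subdiff ?P (W k). ereal (norm v)) \<le> ereal P' * ereal (norm (V k))"
      by (rule ereal_mult_left_mono) (use P'_pos in simp)
    ultimately have "1 < ereal P' * ereal (norm (V k))"
      by (meson order_less_le_trans)
    then have V1: "1 < P' * norm (V k)" by (simp add: one_ereal_def)
    \<comment> \<open>Decrease of the desingularized values over one step. The slope
      \<open>P'\<close> comes from \<open>p k - L\<close>, which lies above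
      \<open>H (Suc k) - L\<close>, so concavity allows it as a lower estimate.\<close>
    define D where "D = \<phi> (H (Suc k) - L) - \<phi> (H (Suc (Suc k)) - L)"
    have "P' * (\<sigma> / 8 * E (Suc k)) \<le> P' * (H (Suc k) - H (Suc (Suc k)))"
      using H_descent P'_pos by (intro mult_left_mono) auto
    also have "\<dots> = P' * ((H (Suc k) - L) - (H (Suc (Suc k)) - L))" by simp
    also have "\<dots> \<le> D"
      unfolding P'_def D_def
      using HL H_ge H_Suc_le p_lower small[OF pL(2)]
      by (intro desingularizing_decrease[OF conc der]) auto
    finally have D: "P' * (\<sigma> / 8 * E (Suc k)) \<le> D" .
    have "0 \<le> P' * (\<sigma> / 8 * E (Suc k))" using P'_pos \<sigma>_pos E_nonneg by simp
    then have D0: "0 \<le> D" using D by simp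
    have "\<sigma> / 8 * E (Suc k) \<le> (P' * norm (V k)) * (\<sigma> / 8 * E (Suc k))"
      using V1 \<sigma>_pos E_nonneg[of "Suc k"] mult_right_mono[of 1 "P' * norm (V k)" "\<sigma> / 8 * E (Suc k)"] by simp
    also have "\<dots> = norm (V k) * (P' * (\<sigma> / 8 * E (Suc k)))" by (simp only: mult_ac)
    also have "\<dots> \<le> (C * sqrt (E k)) * D"
      using C(1)[of k] D D0 C(2) E_nonneg[of k] \<open>0 \<le> P' * (\<sigma> / 8 * E (Suc k))\<close>
      by (intro mult_mono) auto
    finally have E_le: "E (Suc k) \<le> sqrt (E k) * (8 * C / \<sigma> * D)"
      using \<sigma>_pos by (simp add: field_simps)
    have "sqrt (E (Suc k)) \<le> sqrt (sqrt (E k) * (8 * C / \<sigma> * D))"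
      using E_le by (rule real_sqrt_le_mono)
    \<comment> \<open>The arithmetic-geometric mean inequality separates the product into half of
      the previous length plus a telescoping term.\<close>
    also have "\<dots> \<le> (sqrt (E k) + 8 * C / \<sigma> * D) / 2"
      using C(2) \<sigma>_pos D0 E_nonneg by (intro arith_geo_mean_sqrt) auto
    also have "\<dots> = sqrt (E k) / 2 + (r k - r (Suc k))"
      using k0(1)[OF k] k0(1)[of "Suc k"] k \<sigma>_pos unfolding r_def D_def by (simp add: field_simps)
    finally show ?thesis .
  qed
  have r_lim: "r \<longlonglongrightarrow> 0"
  proof -
    have HL: "(\<lambda>k. H (Suc k) - L) \<longlonglongrightarrow> 0"
      using tendsto_diff[OF LIMSEQ_Suc[OF H] tendsto_const[of L]] by simp
    have ev: "\<forall>\<^sub>F k in sequentially. H (Suc k) - L < \<epsilon>0"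
      using order_tendstoD(2)[OF HL \<epsilon>0(1)] .
    then have "\<forall>\<^sub>F k in sequentially. H (Suc k) - L \<in> {s. 0 \<le> s \<and> ereal s < \<epsilon>}"
      by eventually_elim (use H_ge small in auto)
    then have "(\<lambda>k. \<phi> (H (Suc k) - L)) \<longlonglongrightarrow> \<phi> 0"
      using \<epsilon> by (intro continuous_on_tendsto_compose[OF cont HL]) (auto simp: zero_ereal_def)
    then have "(\<lambda>k. 4 * C / \<sigma> * \<phi> (H (Suc k) - L)) \<longlonglongrightarrow> 4 * C / \<sigma> * 0"
      unfolding \<phi>0 by (intro tendsto_intros)
    moreover have "\<forall>\<^sub>F k in sequentially. 4 * C / \<sigma> * \<phi> (H (Suc k) - L) = r k"
      using ev by eventually_elim (simp add: r_def)
    ultimately show ?thesis using Lim_transform_eventually by fastforce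
  qed
  have "0 \<le> r k" for k
    using C(2) \<sigma>_pos H_ge[of "Suc k"] small by (auto simp: r_def intro!: mult_nonneg_nonneg divide_nonneg_nonneg \<phi>_nonneg)
  moreover have "(\<lambda>k. sqrt (E k)) \<longlonglongrightarrow> 0" using tendsto_real_sqrt[OF E_tendsto_0] by simp
  ultimately show thesis
    using that[OF LIMSEQ_imp_Suc cluster(1)] c E_nonneg rec r_lim \<delta>2 q
      local_descent_imp_convergent[where X=X and e="\<lambda>k. sqrt (E k)" and c=c and r=r
        and a=a and \<delta>="\<delta>2 / 2" and ?k0.0=k0 and q=q]
    unfolding X_def[abs_def] by simp
qed

text \<open>The uniform bounds on the multipliers give a convergent subsequence. Along it the
  Lagrangian gradient equals \<open>- d / t\<close>, which vanishes since \<open>t\<close> stays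
  above \<open>tmin\<close>, and \<open>\<zeta>\<close> has the same limit as \<open>mu\<close>
  because \<open>v / t\<close> vanishes as well.\<close>

lemma limit_stationary:
  assumes xa: "x \<longlonglongrightarrow> a" and ha: "h a = 0"
  shows "stationary_point f g A h a"
proof -
  have "bounded (range (\<lambda>k. (lam k, mu k)))"
    unfolding bounded_iff
    by (intro exI[of _ "lam_max + mu_max"])
       (auto intro: order_trans[OF norm_Pair_le] add_mono norm_lam_le norm_mu_le)
  then obtain lm q where q: "strict_mono q" "((\<lambda>k. (lam k, mu k)) \<circ> q) \<longlonglongrightarrow> lm"
    using bounded_imp_convergent_subsequence by blast
  define l m where "l = fst lm" and "m = snd lm"
  have lq: "(\<lambda>i. lam (q i)) \<longlonglongrightarrow> l" and mq: "(\<lambda>i. mu (q i)) \<longlonglongrightarrow> m"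
    using tendsto_fst[OF q(2)] tendsto_snd[OF q(2)] by (simp_all add: o_def l_def m_def)
  note sub = LIMSEQ_subseq_LIMSEQ[OF _ q(1), unfolded o_def]
  have scaled: "(\<lambda>k. (1 / t k) *\<^sub>R w k) \<longlonglongrightarrow> 0" if "w \<longlonglongrightarrow> 0" for w :: "nat \<Rightarrow> 'k::real_normed_vector"
  proof (rule Lim_null_comparison)
    show "(\<lambda>k. 1 / tmin * norm (w k)) \<longlonglongrightarrow> 0"
      using tendsto_mult_left[OF tendsto_norm_zero[OF that], of "1 / tmin"] by simp
    have "norm ((1 / t k) *\<^sub>R w k) \<le> 1 / tmin * norm (w k)" for k
    proof -
      have "1 / t k * norm (w k) \<le> 1 / tmin * norm (w k)"
        using t_bounds[of k] t_range by (intro mult_right_mono divide_left_mono) auto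
      then show ?thesis using t_bounds(1)[of k] by simp
    qed
    then show "\<forall>\<^sub>F k in sequentially. norm ((1 / t k) *\<^sub>R w k) \<le> 1 / tmin * norm (w k)" by simp
  qed
  have xq: "(\<lambda>i. x (q i)) \<longlonglongrightarrow> a" by (rule sub[OF xa])
  have "(\<lambda>i. grad f (x (q i)) + transpose (Jh (x (q i))) *v lam (q i) + transpose (JA (x (q i))) *v mu (q i))
      \<longlonglongrightarrow> grad f a + transpose (Jh a) *v l + transpose (JA a) *v m"
    by (intro tendsto_add isCont_tendsto_compose[OF gradf_continuous xq]
        tendsto_transpose_jacobian_mult[OF h_lipschitz xq lq]
        tendsto_transpose_jacobian_mult[OF A_lipschitz xq mq])
  moreover have "grad f (x k) + transpose (Jh (x k)) *v lam k + transpose (JA (x k)) *v mu k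
      = - ((1 / t k) *\<^sub>R d k)" for k
    using t_bounds(1)[of k] by (simp add: d_def)
  moreover have "(\<lambda>i. - ((1 / t (q i)) *\<^sub>R d (q i))) \<longlonglongrightarrow> - 0"
    by (intro tendsto_minus sub[OF scaled[OF d_tendsto_0]])
  ultimately have eq: "grad f a + transpose (Jh a) *v l + transpose (JA a) *v m = 0"
    using LIMSEQ_unique by fastforce
  have "m \<in> limiting_subdiff (\<lambda>u. ereal (g u)) (A a)"
  proof (rule convex_subgradient_limit)
    show "continuous_on UNIV g" using g_lipschitz by (rule lipschitz_on_continuous_on)
    show "g (z (q i)) + \<zeta> (q i) \<bullet> (u - z (q i)) \<le> g u" for i u by (rule \<zeta>_subgradient)
    have "(\<lambda>i. A (x (q i)) + v (q i)) \<longlonglongrightarrow> A a + 0"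
      by (intro tendsto_add isCont_tendsto_compose[OF A_continuous xq] sub[OF v_tendsto_0])
    then show "(\<lambda>i. z (q i)) \<longlonglongrightarrow> A a" by (simp add: v_def)
    have "(\<lambda>i. mu (q i) - (1 / t (q i)) *\<^sub>R v (q i)) \<longlonglongrightarrow> m - 0"
      by (intro tendsto_diff mq sub[OF scaled[OF v_tendsto_0]])
    then show "(\<lambda>i. \<zeta> (q i)) \<longlonglongrightarrow> m" by simp
  qed
  moreover have "grad f a + transpose (JA a) *v m + transpose (Jh a) *v l = 0"
    using eq by (simp add: algebra_simps)
  ultimately show ?thesis
    unfolding stationary_point_def using ha by (intro conjI exI[of _ l]) auto
qed

end

theorem theorem12:
  fixes f :: "real^'n \<Rightarrow> real" and g :: "real^'p \<Rightarrow> real"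
    and A :: "real^'n \<Rightarrow> real^'p" and h :: "real^'n \<Rightarrow> real^'m"
    and M :: "(real^'n) set"
    and \<kappa> \<theta> C1 C2 Lh Lf lg LA lf lA :: real
    and \<gamma> \<alpha> tmin tmax \<Delta>bar \<eta>bar \<tau>bar \<sigma> :: real and \<rho> :: "nat \<Rightarrow> real"
    and t \<Delta> :: "nat \<Rightarrow> real"
    and lam :: "nat \<Rightarrow> real^'m" and mu :: "nat \<Rightarrow> real^'p"
    and x y :: "nat \<Rightarrow> real^'n"
  assumes run: "fsipl_run_regime f g A h M \<kappa> \<theta> C1 C2 Lh Lf lg LA lf lA
                  \<gamma> \<alpha> tmin tmax \<Delta>bar \<eta>bar \<tau>bar \<sigma> \<rho> t \<Delta> lam mu x y"
    and KL: "KL_property (KL_potential f g A h)"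
  shows "\<exists>xstar. stationary_point f g A h xstar \<and> x \<longlonglongrightarrow> xstar \<and> y \<longlonglongrightarrow> xstar"
proof -
  interpret fsipl_run_regime f g A h M \<kappa> \<theta> C1 C2 Lh Lf lg LA lf lA
    \<gamma> \<alpha> tmin tmax \<Delta>bar \<eta>bar \<tau>bar \<sigma> \<rho> t \<Delta> lam mu x y
    by (rule run)
  obtain a where a: "x \<longlonglongrightarrow> a" "h a = 0" using x_convergent[OF KL] by blast
  have "(\<lambda>k. x k + d k) \<longlonglongrightarrow> a + 0" by (intro tendsto_add a(1) d_tendsto_0)
  then have "y \<longlonglongrightarrow> a" by (simp flip: y_eq)
  then show ?thesis using limit_stationary[OF a] a(1) by blast
qed

end
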